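(* Let $(X,\mathcal{F},\mu)$ be a probability space with $L^2(X,\mu)$ infinite dimensional, and let $P$ be a reversible Markov operator on $L^2(X,\mu)$. Then \[ \overline{\lambda}_{\mathrm{ess}}(P)>-1 \iff \inf_{k\geq 1}\overline{h}_P(k)<1. \]
   Context: A Markov operator is a linear operator $P:L^2(X,\mu)\to L^2(X,\mu)$ with $P1=1$ and $Pf\geq 0$ whenever $f\geq 0$; it is reversible (with invariant measure $\mu$) if $\int_X gPf\,d\mu=\int_X fPg\,d\mu$ for all $f,g\in L^2(X,\mu)$. Write $(f,g)_\mu=\int_X fg\,d\mu$ and $1_A$ for the indicator of a measurable set $A$. $\overline{\lambda}_{\mathrm{ess}}(P):=\inf\sigma_{\mathrm{ess}}(P)$ is the infimum of the essential spectrum of $P$. The $k$-way dual Cheeger constant is \[ \overline{h}_P(k):=\sup\min_{1\leq i\leq k}\frac{2(1_{A_{2i-1}},P1_{A_{2i}})_\mu}{\mu(A_{2i-1}\cup A_{2i})}, \] the supremum over all collections of $k$ pairs of measurable sets $(A_1,A_2),\ldots,(A_{2k-1},A_{2k})$ with $A_p\cap A_q=\emptyset$ for all $1\leq p\neq q\leq 2k$ and $\mu(A_{2i-1}\cup A_{2i})>0$ for each $i$. *)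

theory Defs
  imports "HOL-Probability.Probability"
begin

text \<open>Elements of L^2(X,mu) are represented by real-valued functions; everything is
  understood modulo mu-almost-everywhere equality.\<close>

definition L2 :: "'a measure \<Rightarrow> ('a \<Rightarrow> real) set" where
  "L2 M = {f. f \<in> borel_measurable M \<and> integrable M (\<lambda>x. (f x)\<^sup>2)}"

definition L2_inner :: "'a measure \<Rightarrow> ('a \<Rightarrow> real) \<Rightarrow> ('a \<Rightarrow> real) \<Rightarrow> real" where
  "L2_inner M f g = (\<integral>x. f x * g x \<partial>M)"

definition L2_fin_dim :: "'a measure \<Rightarrow> ('a \<Rightarrow> real) set \<Rightarrow> bool" where
  "L2_fin_dim M E \<longleftrightarrow> (\<exists>B. finite B \<and> B \<subseteq> L2 M \<and>
      (\<forall>f\<in>E. \<exists>c. AE x in M. f x = (\<Sum>b\<in>B. c b * b x)))"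

definition L2_operator :: "'a measure \<Rightarrow> (('a \<Rightarrow> real) \<Rightarrow> ('a \<Rightarrow> real)) \<Rightarrow> bool" where
  "L2_operator M P \<longleftrightarrow>
     (\<forall>f\<in>L2 M. P f \<in> L2 M) \<and>
     (\<forall>f\<in>L2 M. \<forall>g\<in>L2 M. (AE x in M. f x = g x) \<longrightarrow> (AE x in M. P f x = P g x)) \<and>
     (\<forall>f\<in>L2 M. \<forall>g\<in>L2 M. \<forall>a b::real.
        AE x in M. P (\<lambda>y. a * f y + b * g y) x = a * P f x + b * P g x)"

definition markov_operator :: "'a measure \<Rightarrow> (('a \<Rightarrow> real) \<Rightarrow> ('a \<Rightarrow> real)) \<Rightarrow> bool" where
  "markov_operator M P \<longleftrightarrow> L2_operator M P \<and>
     (AE x in M. P (\<lambda>_. 1) x = 1) \<and>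
     (\<forall>f\<in>L2 M. (AE x in M. f x \<ge> 0) \<longrightarrow> (AE x in M. P f x \<ge> 0))"

definition reversible :: "'a measure \<Rightarrow> (('a \<Rightarrow> real) \<Rightarrow> ('a \<Rightarrow> real)) \<Rightarrow> bool" where
  "reversible M P \<longleftrightarrow> (\<forall>f\<in>L2 M. \<forall>g\<in>L2 M. L2_inner M g (P f) = L2_inner M f (P g))"

definition L2_spectrum :: "'a measure \<Rightarrow> (('a \<Rightarrow> real) \<Rightarrow> ('a \<Rightarrow> real)) \<Rightarrow> real set" where
  "L2_spectrum M P = {l. \<not> (
      (\<forall>f\<in>L2 M. (AE x in M. P f x - l * f x = 0) \<longrightarrow> (AE x in M. f x = 0)) \<and>
      (\<forall>g\<in>L2 M. \<exists>f\<in>L2 M. AE x in M. P f x - l * f x = g x))}"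

definition L2_eigenspace :: "'a measure \<Rightarrow> (('a \<Rightarrow> real) \<Rightarrow> ('a \<Rightarrow> real)) \<Rightarrow> real \<Rightarrow> ('a \<Rightarrow> real) set" where
  "L2_eigenspace M P l = {f\<in>L2 M. AE x in M. P f x = l * f x}"

definition L2_discrete_spectrum :: "'a measure \<Rightarrow> (('a \<Rightarrow> real) \<Rightarrow> ('a \<Rightarrow> real)) \<Rightarrow> real set" where
  "L2_discrete_spectrum M P = {l \<in> L2_spectrum M P.
      (\<exists>e>0. \<forall>m\<in>L2_spectrum M P. \<bar>m - l\<bar> < e \<longrightarrow> m = l) \<and>
      (\<exists>f\<in>L2_eigenspace M P l. \<not> (AE x in M. f x = 0)) \<and>
      L2_fin_dim M (L2_eigenspace M P l)}"

definition L2_ess_spectrum :: "'a measure \<Rightarrow> (('a \<Rightarrow> real) \<Rightarrow> ('a \<Rightarrow> real)) \<Rightarrow> real set" where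
  "L2_ess_spectrum M P = L2_spectrum M P - L2_discrete_spectrum M P"

definition lambda_ess_bot :: "'a measure \<Rightarrow> (('a \<Rightarrow> real) \<Rightarrow> ('a \<Rightarrow> real)) \<Rightarrow> real" where
  "lambda_ess_bot M P = Inf (L2_ess_spectrum M P)"

definition dual_cheeger :: "'a measure \<Rightarrow> (('a \<Rightarrow> real) \<Rightarrow> ('a \<Rightarrow> real)) \<Rightarrow> nat \<Rightarrow> real" where
  "dual_cheeger M P k = Sup {Min ((\<lambda>i. 2 * L2_inner M (indicator (A (2*i-1))) (P (indicator (A (2*i))))
                                      / measure M (A (2*i-1) \<union> A (2*i))) ` {1..k}) | A.
      (\<forall>p\<in>{1..2*k}. A p \<in> sets M) \<and>
      (\<forall>p\<in>{1..2*k}. \<forall>q\<in>{1..2*k}. p \<noteq> q \<longrightarrow> A p \<inter> A q = {}) \<and>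
      (\<forall>i\<in>{1..k}. measure M (A (2*i-1) \<union> A (2*i)) > 0)}"

end

theory Submission
  imports Defs "HOL-Library.Function_Algebras"
begin

text \<open>
  Let \<open>energy f = (f, f) + (f, P f)\<close>. Both sides of the equivalence say that this form is coercive on
  the orthogonal complement of a finite set of vectors.

  For the essential spectrum this is Weyl's criterion at the bottom \<open>- 1\<close> of the spectrum. A symmetric
  operator is onto if and only if it is bounded below, so the spectrum consists of the points whose shift
  is not bounded below, and the essential spectrum of those whose shift is not even bounded below on the
  orthogonal complement of a finite set. Completeness enters only through a contracting iteration and a
  gliding hump, and no spectral theorem is needed.

  If \<open>k\<close> disjoint pairs \<open>(A\<^sub>i, B\<^sub>i)\<close> have ratios close to 1, the functions \<open>1\<^bsub>A\<^sub>i\<^esub> - 1\<^bsub>B\<^sub>i\<^esub>\<close> are orthogonal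
  with small energy, which excludes coercivity when \<open>k\<close> is large. Conversely, without coercivity the
  number of pairs can be increased one at a time. Take \<open>k + 1\<close> almost orthonormal simple functions of
  small energy and only then \<open>k\<close> pairs whose defects are tiny compared with the sup norms of these
  functions. Some normalised combination \<open>f\<close> is orthogonal to every \<open>1\<^bsub>A\<^sub>i\<^esub> - 1\<^bsub>B\<^sub>i\<^esub>\<close>. Either \<open>f\<close> has mass
  outside all pairs, and its level sets there give a new pair, or it has mass on some \<open>A\<^sub>i \<union> B\<^sub>i\<close>, and
  cutting at a median-like level \<open>c\<close> the positive and negative parts of \<open>\<plusminus> f - c\<close> split that pair in two.
\<close>

section \<open>Homogeneous linear systems\<close>

instantiation "fun" :: (type, real_vector) real_vector
begin

definition scaleR_fun :: "real \<Rightarrow> ('a \<Rightarrow> 'b) \<Rightarrow> 'a \<Rightarrow> 'b" where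
  "scaleR_fun c f = (\<lambda>x. c *\<^sub>R f x)"

instance
  by standard (auto simp: scaleR_fun_def plus_fun_def algebra_simps)

end

lemma scaleR_fun_apply [simp]: "(c *\<^sub>R f) x = c *\<^sub>R f x"
  by (simp add: scaleR_fun_def)

lemma sum_fun_apply: "(sum f I) x = (\<Sum>i\<in>I. f i x)"
  by (induction I rule: infinite_finite_induct) auto

lemma linear_relation_of_card_less:
  fixes v :: "'l \<Rightarrow> 'v::real_vector"
  assumes "finite T" "finite L" "card T < card L" and v: "\<And>l. l \<in> L \<Longrightarrow> v l \<in> span T"
  shows "\<exists>a. (\<exists>l\<in>L. a l \<noteq> 0) \<and> (\<Sum>l\<in>L. a l *\<^sub>R v l) = 0"
proof (cases "inj_on v L")
  case False
  then obtain k l where kl: "k \<in> L" "l \<in> L" "k \<noteq> l" "v k = v l"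
    by (auto simp: inj_on_def)
  define a :: "'l \<Rightarrow> real" where "a j = of_bool (j = k) - of_bool (j = l)" for j
  have "(\<Sum>j\<in>L. a j *\<^sub>R v j) = (\<Sum>j\<in>L. if j = k then v j else 0) - (\<Sum>j\<in>L. if j = l then v j else 0)"
    unfolding sum_subtractf[symmetric] by (intro sum.cong) (auto simp: a_def)
  also have "\<dots> = v k - v l" using kl(1,2) assms(2) by simp
  finally have "(\<Sum>j\<in>L. a j *\<^sub>R v j) = 0" using kl(4) by simp
  moreover have "a k \<noteq> 0" using kl(3) by (simp add: a_def)
  ultimately show ?thesis using kl(1) by blast
next
  case True
  have "v ` L \<subseteq> span T" using v by blast
  moreover have "card T < card (v ` L)" using assms(3) by (simp add: card_image[OF True])
  ultimately have "dependent (v ` L)" using independent_span_bound[of T "v ` L"] assms(1) by force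
  then obtain u where u: "\<exists>x\<in>v ` L. u x \<noteq> 0" "(\<Sum>x\<in>v ` L. u x *\<^sub>R x) = 0"
    using assms(2) by (auto simp: dependent_finite)
  have "(\<Sum>l\<in>L. u (v l) *\<^sub>R v l) = 0" using u(2) sum.reindex[OF True, of "\<lambda>x. u x *\<^sub>R x"] by simp
  then show ?thesis using u(1) by (intro exI[of _ "\<lambda>l. u (v l)"]) auto
qed

lemma homogeneous_system_nontrivial:
  fixes m :: "'i \<Rightarrow> 'l \<Rightarrow> real"
  assumes "finite I" "finite L" "card I < card L"
  shows "\<exists>a. (\<exists>l\<in>L. a l \<noteq> 0) \<and> (\<forall>i\<in>I. (\<Sum>l\<in>L. a l * m i l) = 0)"
proof -
  define column where "column l = (\<lambda>i. if i \<in> I then m i l else 0)" for l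
  define unit :: "'i \<Rightarrow> 'i \<Rightarrow> real" where "unit i = (\<lambda>j. of_bool (j = i))" for i
  have "column l = (\<Sum>i\<in>I. m i l *\<^sub>R unit i)" for l
  proof
    fix j
    have "(\<Sum>i\<in>I. m i l *\<^sub>R unit i) j = (\<Sum>i\<in>I. if i = j then m i l else 0)"
      unfolding sum_fun_apply by (intro sum.cong) (auto simp: unit_def)
    then show "column l j = (\<Sum>i\<in>I. m i l *\<^sub>R unit i) j" using assms(1) by (simp add: column_def)
  qed
  then have "column l \<in> span (unit ` I)" for l
    by (simp add: span_sum span_scale span_base)
  moreover have "card (unit ` I) < card L"
    using card_image_le[OF assms(1), of unit] assms(3) by linarith
  ultimately obtain a where a: "\<exists>l\<in>L. a l \<noteq> 0" "(\<Sum>l\<in>L. a l *\<^sub>R column l) = 0"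
    using linear_relation_of_card_less[of "unit ` I" L column] assms(1,2) by blast
  have "(\<Sum>l\<in>L. a l * m i l) = 0" if "i \<in> I" for i
    using fun_cong[OF a(2), of i] that by (simp add: sum_fun_apply column_def)
  then show ?thesis using a(1) by blast
qed

section \<open>Semi-inner product spaces\<close>

lemma discriminant_bound:
  fixes a b c :: real
  assumes quadratic_nonneg: "\<And>t. 0 \<le> a + 2 * t * b + t\<^sup>2 * c" and "0 \<le> c"
  shows "b\<^sup>2 \<le> a * c"
proof (cases "c = 0")
  case True
  have "b = 0"
  proof (rule ccontr)
    assume "b \<noteq> 0"
    then show False using quadratic_nonneg[of "- (a + 1) / (2 * b)"] True by (simp add: field_simps)
  qed
  then show ?thesis using True by simp
next
  case False
  have "a + 2 * (- b / c) * b + (- b / c)\<^sup>2 * c = a - b\<^sup>2 / c"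
    using False by (simp add: field_simps power2_eq_square)
  then have "0 \<le> a - b\<^sup>2 / c" using quadratic_nonneg[of "- b / c"] by linarith
  then show ?thesis using False \<open>0 \<le> c\<close> by (simp add: field_simps)
qed

locale semi_inner_space =
  fixes H :: "'v::real_vector set" and ip :: "'v \<Rightarrow> 'v \<Rightarrow> real"
  assumes subspace_H: "subspace H"
    and ip_sym: "x \<in> H \<Longrightarrow> y \<in> H \<Longrightarrow> ip x y = ip y x"
    and ip_add_left: "x \<in> H \<Longrightarrow> y \<in> H \<Longrightarrow> z \<in> H \<Longrightarrow> ip (x + y) z = ip x z + ip y z"
    and ip_scale_left: "x \<in> H \<Longrightarrow> y \<in> H \<Longrightarrow> ip (c *\<^sub>R x) y = c * ip x y"
    and ip_nonneg: "x \<in> H \<Longrightarrow> 0 \<le> ip x x"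
begin

definition nrm :: "'v \<Rightarrow> real" where "nrm x = sqrt (ip x x)"

lemma H_closed [simp, intro]:
  "0 \<in> H" "x \<in> H \<Longrightarrow> y \<in> H \<Longrightarrow> x + y \<in> H" "x \<in> H \<Longrightarrow> y \<in> H \<Longrightarrow> x - y \<in> H"
  "x \<in> H \<Longrightarrow> c *\<^sub>R x \<in> H" "x \<in> H \<Longrightarrow> - x \<in> H"
  using subspace_H by (auto intro: subspace_0 subspace_add subspace_diff subspace_scale subspace_neg)

lemma H_sum [simp, intro]: "(\<And>i. i \<in> I \<Longrightarrow> f i \<in> H) \<Longrightarrow> sum f I \<in> H"
  using subspace_H by (rule subspace_sum)

lemma ip_add_right: "x \<in> H \<Longrightarrow> y \<in> H \<Longrightarrow> z \<in> H \<Longrightarrow> ip x (y + z) = ip x y + ip x z"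
  by (metis H_closed(2) ip_add_left ip_sym)

lemma ip_scale_right: "x \<in> H \<Longrightarrow> y \<in> H \<Longrightarrow> ip x (c *\<^sub>R y) = c * ip x y"
  by (metis H_closed(4) ip_scale_left ip_sym)

lemma ip_minus_left: "x \<in> H \<Longrightarrow> y \<in> H \<Longrightarrow> ip (- x) y = - ip x y"
  using ip_scale_left[of x y "-1"] by simp

lemma ip_minus_right: "x \<in> H \<Longrightarrow> y \<in> H \<Longrightarrow> ip x (- y) = - ip x y"
  using ip_scale_right[of x y "-1"] by simp

lemma ip_diff_left: "x \<in> H \<Longrightarrow> y \<in> H \<Longrightarrow> z \<in> H \<Longrightarrow> ip (x - y) z = ip x z - ip y z"
  using ip_add_left[of x "- y" z] by (simp add: ip_minus_left)

lemma ip_diff_right: "x \<in> H \<Longrightarrow> y \<in> H \<Longrightarrow> z \<in> H \<Longrightarrow> ip x (y - z) = ip x y - ip x z"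
  using ip_add_right[of x y "- z"] by (simp add: ip_minus_right)

lemma ip_zero: "x \<in> H \<Longrightarrow> ip 0 x = 0" "x \<in> H \<Longrightarrow> ip x 0 = 0"
  using ip_scale_left[of 0 x 0] ip_scale_right[of x 0 0] by simp_all

lemmas ip_simps = ip_add_left ip_add_right ip_scale_left ip_scale_right ip_minus_left
  ip_minus_right ip_diff_left ip_diff_right ip_zero

lemma ip_sum_left:
  "(\<And>i. i \<in> I \<Longrightarrow> f i \<in> H) \<Longrightarrow> y \<in> H \<Longrightarrow> ip (sum f I) y = (\<Sum>i\<in>I. ip (f i) y)"
  by (induction I rule: infinite_finite_induct) (simp_all add: ip_simps)

lemma ip_sum_right:
  "(\<And>i. i \<in> I \<Longrightarrow> f i \<in> H) \<Longrightarrow> y \<in> H \<Longrightarrow> ip y (sum f I) = (\<Sum>i\<in>I. ip y (f i))"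
  by (induction I rule: infinite_finite_induct) (simp_all add: ip_simps)

lemma nrm_power2: "x \<in> H \<Longrightarrow> (nrm x)\<^sup>2 = ip x x"
  by (simp add: nrm_def ip_nonneg)

lemma nrm_mult_self: "x \<in> H \<Longrightarrow> nrm x * nrm x = ip x x"
  by (simp add: nrm_def ip_nonneg)

lemma nrm_nonneg [simp]: "x \<in> H \<Longrightarrow> 0 \<le> nrm x"
  by (simp add: nrm_def ip_nonneg)

lemma nrm_zero [simp]: "nrm 0 = 0"
  using ip_zero(1)[OF H_closed(1)] by (simp add: nrm_def)

lemma nrm_scale: "x \<in> H \<Longrightarrow> nrm (c *\<^sub>R x) = \<bar>c\<bar> * nrm x"
  by (simp add: nrm_def ip_simps real_sqrt_mult flip: mult.assoc)

lemma nrm_minus_commute: "x \<in> H \<Longrightarrow> y \<in> H \<Longrightarrow> nrm (x - y) = nrm (y - x)"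
  using nrm_scale[of "x - y" "-1"] by simp

lemma nrm_normalize: "x \<in> H \<Longrightarrow> nrm x \<noteq> 0 \<Longrightarrow> nrm ((1 / nrm x) *\<^sub>R x) = 1"
  by (simp add: nrm_scale)

lemma nrm_add_power2:
  assumes "x \<in> H" "y \<in> H" "ip x y = 0"
  shows "(nrm (x + y))\<^sup>2 = (nrm x)\<^sup>2 + (nrm y)\<^sup>2"
  using assms by (simp add: nrm_power2 ip_simps ip_sym[of y x])

lemma Cauchy_Schwarz_power2:
  assumes "x \<in> H" "y \<in> H"
  shows "(ip x y)\<^sup>2 \<le> ip x x * ip y y"
proof (rule discriminant_bound)
  show "0 \<le> ip x x + 2 * t * ip x y + t\<^sup>2 * ip y y" for t
    using ip_nonneg[of "x + t *\<^sub>R y"] assms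
    by (simp add: ip_simps ip_sym[of y x] power2_eq_square algebra_simps)
qed (use assms in \<open>simp add: ip_nonneg\<close>)

lemma Cauchy_Schwarz:
  assumes "x \<in> H" "y \<in> H"
  shows "\<bar>ip x y\<bar> \<le> nrm x * nrm y"
proof (rule power2_le_imp_le)
  show "\<bar>ip x y\<bar>\<^sup>2 \<le> (nrm x * nrm y)\<^sup>2"
    using Cauchy_Schwarz_power2[OF assms] assms by (simp add: power_mult_distrib nrm_power2)
qed (use assms in simp)

lemma nrm_triangle:
  assumes "x \<in> H" "y \<in> H"
  shows "nrm (x + y) \<le> nrm x + nrm y"
proof (rule power2_le_imp_le)
  have "(nrm (x + y))\<^sup>2 = (nrm x)\<^sup>2 + 2 * ip x y + (nrm y)\<^sup>2"
    using assms by (simp add: nrm_power2 ip_simps ip_sym[of y x])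
  also have "\<dots> \<le> (nrm x + nrm y)\<^sup>2"
    using Cauchy_Schwarz[OF assms] by (simp add: power2_sum)
  finally show "(nrm (x + y))\<^sup>2 \<le> (nrm x + nrm y)\<^sup>2" .
qed (use assms in simp)

lemma nrm_triangle_diff: "x \<in> H \<Longrightarrow> y \<in> H \<Longrightarrow> nrm (x - y) \<le> nrm x + nrm y"
  using nrm_triangle[of x "- y"] nrm_scale[of y "-1"] by simp

lemma nrm_triangle_mid: "x \<in> H \<Longrightarrow> y \<in> H \<Longrightarrow> z \<in> H \<Longrightarrow> nrm (x - z) \<le> nrm (x - y) + nrm (y - z)"
  using nrm_triangle[of "x - y" "y - z"] by simp

lemma nrm_le_diff: "x \<in> H \<Longrightarrow> y \<in> H \<Longrightarrow> nrm x - nrm y \<le> nrm (x - y)"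
  using nrm_triangle[of "x - y" y] by simp

lemma nrm_sum_le: "(\<And>i. i \<in> I \<Longrightarrow> x i \<in> H) \<Longrightarrow> nrm (sum x I) \<le> (\<Sum>i\<in>I. nrm (x i))"
proof (induction I rule: infinite_finite_induct)
  case (insert i I)
  have "nrm (x i + sum x I) \<le> nrm (x i) + nrm (sum x I)"
    using insert.prems by (intro nrm_triangle H_sum) auto
  then show ?case using insert by simp
qed simp_all

lemma nrm_combination_le:
  fixes c :: real
  assumes "\<And>i. i \<in> I \<Longrightarrow> x i \<in> H \<and> nrm (x i) \<le> c \<and> \<bar>a i\<bar> \<le> 1"
  shows "nrm (\<Sum>i\<in>I. a i *\<^sub>R x i) \<le> card I * c"
proof -
  have "nrm (\<Sum>i\<in>I. a i *\<^sub>R x i) \<le> (\<Sum>i\<in>I. nrm (a i *\<^sub>R x i))"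
    using assms by (intro nrm_sum_le) auto
  also have "\<dots> \<le> (\<Sum>i\<in>I. 1 * c)"
  proof (rule sum_mono)
    fix i assume "i \<in> I"
    then show "nrm (a i *\<^sub>R x i) \<le> 1 * c" unfolding nrm_scale[OF conjunct1[OF assms[OF \<open>i \<in> I\<close>]]]
      using assms by (intro mult_mono) auto
  qed
  finally show ?thesis by simp
qed

lemma nrm_sum_power2_le:
  assumes "\<And>i. i \<in> I \<Longrightarrow> x i \<in> H"
  shows "(nrm (sum x I))\<^sup>2 \<le> card I * (\<Sum>i\<in>I. (nrm (x i))\<^sup>2)"
proof -
  have "(nrm (sum x I))\<^sup>2 \<le> (\<Sum>i\<in>I. nrm (x i))\<^sup>2"
    using assms by (intro power_mono nrm_sum_le) auto
  also have "\<dots> \<le> (\<Sum>i\<in>I. (nrm (x i))\<^sup>2) * card I" by (rule sum_squared_le_sum_of_squares)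
  finally show ?thesis by (simp add: mult.commute)
qed

lemma nrm_sum_power2_orthogonal:
  assumes "finite I" "\<And>i. i \<in> I \<Longrightarrow> x i \<in> H"
    and "\<And>i j. i \<in> I \<Longrightarrow> j \<in> I \<Longrightarrow> i \<noteq> j \<Longrightarrow> ip (x i) (x j) = 0"
  shows "(nrm (sum x I))\<^sup>2 = (\<Sum>i\<in>I. (nrm (x i))\<^sup>2)"
  using assms
proof (induction I rule: finite_induct)
  case (insert i I)
  have "ip (x i) (sum x I) = (\<Sum>j\<in>I. ip (x i) (x j))" using insert.prems by (intro ip_sum_right) auto
  also have "\<dots> = 0" using insert by (intro sum.neutral) auto
  finally have "(nrm (x i + sum x I))\<^sup>2 = (nrm (x i))\<^sup>2 + (nrm (sum x I))\<^sup>2"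
    using insert.prems by (intro nrm_add_power2) auto
  then show ?case using insert by simp
qed simp

lemma nrm_diff_le_sum_increments:
  assumes "\<And>n. X n \<in> H" "m \<le> (n::nat)"
  shows "nrm (X m - X n) \<le> (\<Sum>i=m..<n. nrm (X (Suc i) - X i))"
  using assms(2)
proof (induction n rule: dec_induct)
  case (step n)
  then show ?case
    using nrm_triangle_mid[of "X m" "X n" "X (Suc n)"] nrm_minus_commute[of "X n" "X (Suc n)"] assms(1)
    by simp
qed simp

lemma ip_null: "x \<in> H \<Longrightarrow> nrm x = 0 \<Longrightarrow> y \<in> H \<Longrightarrow> ip x y = 0"
  using Cauchy_Schwarz[of x y] by simp

lemma null_iff: "x \<in> H \<Longrightarrow> nrm x = 0 \<longleftrightarrow> (\<forall>y\<in>H. ip x y = 0)"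
  using ip_null nrm_def by auto

lemma ip_eq_of_null_diff: "x \<in> H \<Longrightarrow> y \<in> H \<Longrightarrow> z \<in> H \<Longrightarrow> nrm (x - y) = 0 \<Longrightarrow> ip x z = ip y z"
  using ip_null[of "x - y" z] by (simp add: ip_simps)

lemma nrm_cong_ip: "x \<in> H \<Longrightarrow> y \<in> H \<Longrightarrow> (\<And>z. z \<in> H \<Longrightarrow> ip x z = ip y z) \<Longrightarrow> nrm x = nrm y"
  by (metis ip_sym nrm_def)

subsection \<open>Orthogonal complements of finite sets\<close>

definition orth :: "'v set \<Rightarrow> 'v set" where
  "orth K = {x \<in> H. \<forall>k\<in>K. ip x k = 0}"

definition fin_dim :: "'v set \<Rightarrow> bool" where
  "fin_dim E \<longleftrightarrow> (\<exists>B. finite B \<and> B \<subseteq> H \<and> (\<forall>f\<in>E. \<exists>c. nrm (f - (\<Sum>b\<in>B. c b *\<^sub>R b)) = 0))"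

lemma orthD: "f \<in> orth K \<Longrightarrow> f \<in> H" "f \<in> orth K \<Longrightarrow> k \<in> K \<Longrightarrow> ip f k = 0"
  by (auto simp: orth_def)

lemma orth_empty [simp]: "orth {} = H"
  by (simp add: orth_def)

lemma subspace_orth: "K \<subseteq> H \<Longrightarrow> subspace (orth K)"
  by (auto simp: subspace_def orth_def ip_simps subset_iff)

lemma span_subset_H: "U \<subseteq> H \<Longrightarrow> span U \<subseteq> H"
  by (rule span_minimal[OF _ subspace_H])

lemma ip_orth_span:
  assumes "U \<subseteq> H" "y \<in> orth U" "p \<in> span U"
  shows "ip y p = 0"
proof -
  have "y \<in> H" using assms by (auto dest: orthD)
  then have "subspace {p \<in> H. ip y p = 0}" by (auto simp: subspace_def ip_simps)
  moreover have "U \<subseteq> {p \<in> H. ip y p = 0}" using assms by (auto dest: orthD)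
  ultimately show ?thesis using span_minimal[of U "{p \<in> H. ip y p = 0}"] assms(3) by auto
qed

lemma orthogonal_decomposition_insert:
  assumes U: "U \<subseteq> H" "u \<in> H" and x: "x \<in> H"
    and p: "p \<in> span U" "x - p \<in> orth U" and q: "q \<in> span U" "u - q \<in> orth U"
  shows "\<exists>p'\<in>span (insert u U). x - p' \<in> orth (insert u U)"
proof -
  have pH: "p \<in> H" "q \<in> H" using p(1) q(1) subsetD[OF span_subset_H[OF U(1)]] by simp_all
  define d where "d = u - q"
  define t where "t = (if ip d d = 0 then 0 else ip (x - p) d / ip d d)"
  define r where "r = (x - p) - t *\<^sub>R d"
  have dH: "d \<in> H" using U(2) pH by (simp add: d_def)
  have rU: "r \<in> orth U"
    unfolding r_def d_def
    by (rule subspace_diff[OF subspace_orth[OF U(1)] p(2) subspace_scale[OF subspace_orth[OF U(1)] q(2)]])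
  then have rH: "r \<in> H" by (rule orthD)
  have "ip r d = 0"
  proof (cases "ip d d = 0")
    case True
    then have "ip d r = 0" using ip_null[OF dH, of r] rH by (simp add: nrm_def)
    then show ?thesis using ip_sym[OF dH rH] by simp
  next
    case False
    then show ?thesis using x pH dH by (simp add: r_def ip_diff_left ip_scale_left t_def)
  qed
  then have "ip r u = 0"
    using ip_orth_span[OF U(1) rU q(1)] U(2) pH rH by (simp add: d_def ip_diff_right)
  then have "x - (p + t *\<^sub>R d) \<in> orth (insert u U)" using rU by (simp add: orth_def r_def diff_diff_eq)
  moreover have "span U \<subseteq> span (insert u U)" by (intro span_mono) blast
  then have "p + t *\<^sub>R d \<in> span (insert u U)"
    unfolding d_def using p(1) q(1) by (intro span_add span_scale span_diff) (auto intro: span_base)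
  ultimately show ?thesis by blast
qed

lemma orthogonal_decomposition:
  assumes "finite U" "U \<subseteq> H" "x \<in> H"
  shows "\<exists>p\<in>span U. x - p \<in> orth U"
  using assms
proof (induction U arbitrary: x rule: finite_induct)
  case empty
  then show ?case by (intro bexI[of _ 0]) simp_all
next
  case (insert u U)
  have U: "U \<subseteq> H" "u \<in> H" using insert.prems by auto
  obtain p q where "p \<in> span U" "x - p \<in> orth U" "q \<in> span U" "u - q \<in> orth U"
    using insert.IH[OF U(1) insert.prems(2)] insert.IH[OF U] by (elim bexE)
  then show ?case by (rule orthogonal_decomposition_insert[OF U insert.prems(2)])
qed

lemma fin_dim_if_null_complement:
  assumes "finite U" "U \<subseteq> H" "E \<subseteq> H" "\<And>x p. x \<in> E \<Longrightarrow> p \<in> span U \<Longrightarrow> x - p \<in> orth U \<Longrightarrow> nrm (x - p) = 0"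
  shows "fin_dim E"
  unfolding fin_dim_def
proof (intro exI[of _ U] conjI ballI assms(1,2))
  fix x assume "x \<in> E"
  then obtain p where p: "p \<in> span U" "x - p \<in> orth U"
    using orthogonal_decomposition[OF assms(1,2), of x] assms(3) by blast
  then obtain c where "p = (\<Sum>b\<in>U. c b *\<^sub>R b)" using assms(1) by (auto simp: span_finite)
  then show "\<exists>c. nrm (x - (\<Sum>b\<in>U. c b *\<^sub>R b)) = 0" using assms(4)[OF \<open>x \<in> E\<close> p] by blast
qed

lemma infinite_dim_orth:
  assumes "\<not> fin_dim H" "finite K" "K \<subseteq> H"
  obtains f where "f \<in> orth K" "nrm f \<noteq> 0"
proof (rule ccontr)
  assume "\<not> thesis"
  then have "fin_dim H" using that by (intro fin_dim_if_null_complement[OF assms(2,3)]) auto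
  then show False using assms(1) by simp
qed

lemma normalized_combination_orth:
  fixes w :: "'l \<Rightarrow> 'v"
  assumes "finite K" "K \<subseteq> H" "finite L" "card K < card L" "\<And>l. l \<in> L \<Longrightarrow> w l \<in> H"
  shows "\<exists>a. (\<Sum>l\<in>L. (a l)\<^sup>2) = 1 \<and> (\<forall>l\<in>L. \<bar>a l\<bar> \<le> 1) \<and> (\<Sum>l\<in>L. a l *\<^sub>R w l) \<in> orth K"
proof -
  obtain b where b: "\<exists>l\<in>L. b l \<noteq> 0" "\<forall>k\<in>K. (\<Sum>l\<in>L. b l * ip (w l) k) = 0"
    using homogeneous_system_nontrivial[OF assms(1,3,4), of "\<lambda>k l. ip (w l) k"] by blast
  define r where "r = sqrt (\<Sum>l\<in>L. (b l)\<^sup>2)"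
  define a where "a l = b l / r" for l
  have r: "r > 0" "r\<^sup>2 = (\<Sum>l\<in>L. (b l)\<^sup>2)"
    using b(1) assms(3) by (auto simp: r_def sum_nonneg intro!: sum_pos2)
  have unit: "(\<Sum>l\<in>L. (a l)\<^sup>2) = 1"
    using r(1) by (simp add: a_def power_divide flip: sum_divide_distrib r(2))
  show ?thesis
  proof (intro exI[of _ a] conjI ballI unit)
    fix l assume "l \<in> L"
    then have "(a l)\<^sup>2 \<le> (\<Sum>l\<in>L. (a l)\<^sup>2)" using assms(3) by (intro member_le_sum) auto
    then show "\<bar>a l\<bar> \<le> 1" using unit by (simp add: abs_square_le_1)
  next
    have "ip (\<Sum>l\<in>L. a l *\<^sub>R w l) k = 0" if "k \<in> K" for k
    proof -
      have "ip (\<Sum>l\<in>L. a l *\<^sub>R w l) k = (\<Sum>l\<in>L. b l * ip (w l) k) / r"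
        using assms that
        by (subst ip_sum_left) (auto simp: ip_simps a_def sum_divide_distrib subset_iff intro!: sum.cong)
      then show ?thesis using b(2) that by simp
    qed
    then show "(\<Sum>l\<in>L. a l *\<^sub>R w l) \<in> orth K" using assms(5) by (auto simp: orth_def)
  qed
qed

subsection \<open>Symmetric operators\<close>

definition symop :: "('v \<Rightarrow> 'v) \<Rightarrow> bool" where
  "symop A \<longleftrightarrow> (\<forall>x\<in>H. A x \<in> H) \<and> (\<forall>x\<in>H. \<forall>y\<in>H. ip (A x) y = ip x (A y))"

definition bound_op :: "('v \<Rightarrow> 'v) \<Rightarrow> real \<Rightarrow> bool" where
  "bound_op A L \<longleftrightarrow> 0 < L \<and> (\<forall>x\<in>H. nrm (A x) \<le> L * nrm x)"

definition surj_op :: "('v \<Rightarrow> 'v) \<Rightarrow> bool" where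
  "surj_op A \<longleftrightarrow> (\<forall>g\<in>H. \<exists>f\<in>H. nrm (A f - g) = 0)"

definition psd_on :: "'v set \<Rightarrow> ('v \<Rightarrow> 'v) \<Rightarrow> bool" where
  "psd_on V A \<longleftrightarrow> (\<forall>x\<in>V. 0 \<le> ip (A x) x)"

definition bounded_below_on :: "'v set \<Rightarrow> ('v \<Rightarrow> 'v) \<Rightarrow> bool" where
  "bounded_below_on V A \<longleftrightarrow> (\<exists>c>0. \<forall>x\<in>V. c * nrm x \<le> nrm (A x))"

definition coercive_on :: "'v set \<Rightarrow> ('v \<Rightarrow> 'v) \<Rightarrow> bool" where
  "coercive_on V A \<longleftrightarrow> (\<exists>c>0. \<forall>x\<in>V. c * (nrm x)\<^sup>2 \<le> ip (A x) x)"

definition shift :: "('v \<Rightarrow> 'v) \<Rightarrow> real \<Rightarrow> 'v \<Rightarrow> 'v" where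
  "shift A c x = A x - c *\<^sub>R x"

definition ker :: "('v \<Rightarrow> 'v) \<Rightarrow> 'v set" where
  "ker A = {x \<in> H. nrm (A x) = 0}"

lemma symop_closed [simp]: "symop A \<Longrightarrow> x \<in> H \<Longrightarrow> A x \<in> H"
  by (simp add: symop_def)

lemma symopD: "symop A \<Longrightarrow> x \<in> H \<Longrightarrow> y \<in> H \<Longrightarrow> ip (A x) y = ip x (A y)"
  by (simp add: symop_def)

text \<open>A symmetric map is linear up to null vectors, so linearity is only ever used inside the
  semi-inner product.\<close>

lemma symop_linear:
  "symop A \<Longrightarrow> x \<in> H \<Longrightarrow> y \<in> H \<Longrightarrow> z \<in> H \<Longrightarrow> ip (A (x + y)) z = ip (A x) z + ip (A y) z"
  "symop A \<Longrightarrow> x \<in> H \<Longrightarrow> y \<in> H \<Longrightarrow> z \<in> H \<Longrightarrow> ip (A (x - y)) z = ip (A x) z - ip (A y) z"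
  "symop A \<Longrightarrow> x \<in> H \<Longrightarrow> z \<in> H \<Longrightarrow> ip (A (c *\<^sub>R x)) z = c * ip (A x) z"
  by (simp_all add: symopD ip_simps)

lemma nrm_symop_diff:
  assumes "symop A" "x \<in> H" "y \<in> H"
  shows "nrm (A (x - y)) = nrm (A x - A y)"
  using assms by (intro nrm_cong_ip) (simp_all add: ip_simps symop_linear)

lemma nrm_symop_scale:
  assumes "symop A" "x \<in> H"
  shows "nrm (A (c *\<^sub>R x)) = \<bar>c\<bar> * nrm (A x)"
proof -
  have "nrm (A (c *\<^sub>R x)) = nrm (c *\<^sub>R A x)"
    using assms by (intro nrm_cong_ip) (simp_all add: ip_simps symop_linear)
  then show ?thesis using assms by (simp add: nrm_scale)
qed

lemma symop_shift: "symop A \<Longrightarrow> symop (shift A c)"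
  by (auto simp: symop_def shift_def ip_simps)

lemma symop_square: "symop A \<Longrightarrow> symop (\<lambda>x. A (A x))"
  by (auto simp: symop_def)

lemma ip_square: "symop A \<Longrightarrow> x \<in> H \<Longrightarrow> ip (A (A x)) x = (nrm (A x))\<^sup>2"
  by (simp add: symopD nrm_power2)

lemma ip_shift: "symop A \<Longrightarrow> x \<in> H \<Longrightarrow> y \<in> H \<Longrightarrow> ip (shift A c x) y = ip (A x) y - c * ip x y"
  by (simp add: shift_def ip_simps)

lemma shift_shift: "shift (shift A b) c = shift A (b + c)"
  by (rule ext) (simp add: shift_def algebra_simps)

lemma bound_opD: "bound_op A L \<Longrightarrow> x \<in> H \<Longrightarrow> nrm (A x) \<le> L * nrm x"
  by (simp add: bound_op_def)

lemma bound_op_pos: "bound_op A L \<Longrightarrow> 0 < L"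
  by (simp add: bound_op_def)

lemma bound_op_mono:
  assumes "bound_op A L" "L \<le> M"
  shows "bound_op A M"
proof -
  have "L * nrm x \<le> M * nrm x" if "x \<in> H" for x using assms(2) that by (intro mult_right_mono) auto
  then show ?thesis using assms by (force simp: bound_op_def)
qed

lemma bound_op_shift:
  assumes "symop A" "bound_op A L"
  shows "bound_op (shift A c) (L + \<bar>c\<bar>)"
proof -
  have "nrm (shift A c x) \<le> (L + \<bar>c\<bar>) * nrm x" if "x \<in> H" for x
    using nrm_triangle_diff[of "A x" "c *\<^sub>R x"] bound_opD[OF assms(2) that] that assms(1)
    by (simp add: shift_def nrm_scale algebra_simps)
  then show ?thesis using assms(2) by (auto simp: bound_op_def)
qed

lemma bound_op_square:
  assumes "symop A" "bound_op A L"
  shows "bound_op (\<lambda>x. A (A x)) (L * L)"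
proof -
  have "nrm (A (A x)) \<le> L * L * nrm x" if "x \<in> H" for x
  proof -
    have "nrm (A (A x)) \<le> L * nrm (A x)" using assms that by (simp add: bound_opD)
    also have "\<dots> \<le> L * (L * nrm x)"
      using assms that bound_op_pos[OF assms(2)] by (intro mult_left_mono) (auto simp: bound_opD)
    finally show ?thesis by (simp add: mult.assoc)
  qed
  then show ?thesis using bound_op_pos[OF assms(2)] by (simp add: bound_op_def)
qed

lemma form_bound:
  assumes "symop A" "bound_op A L" "x \<in> H"
  shows "\<bar>ip (A x) x\<bar> \<le> L * (nrm x)\<^sup>2"
proof -
  have "\<bar>ip (A x) x\<bar> \<le> nrm (A x) * nrm x" using assms by (simp add: Cauchy_Schwarz)
  also have "\<dots> \<le> L * nrm x * nrm x" using assms by (intro mult_right_mono) (auto simp: bound_opD)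
  finally show ?thesis by (simp add: power2_eq_square)
qed

lemma semi_inner_space_form:
  assumes "symop A" "subspace V" "V \<subseteq> H" "psd_on V A"
  shows "semi_inner_space V (\<lambda>x y. ip (A x) y)"
proof
  show "ip (A x) y = ip (A y) x" if "x \<in> V" "y \<in> V" for x y
    using assms(1,3) that by (metis ip_sym subsetD symopD symop_closed)
qed (use assms in \<open>auto simp: symop_linear psd_on_def subset_iff\<close>)

lemma psd_nrm_bound:
  assumes A: "symop A" "bound_op A L" and V: "subspace V" "V \<subseteq> H" "psd_on V A" and x: "x \<in> V" "A x \<in> V"
  shows "(nrm (A x))\<^sup>2 \<le> L * ip (A x) x"
proof (cases "nrm (A x) = 0")
  case True
  then show ?thesis using bound_op_pos[OF A(2)] V(3) x(1) by (simp add: psd_on_def)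
next
  case False
  have AxH: "A x \<in> H" using V(2) x(2) by blast
  interpret form: semi_inner_space V "\<lambda>x y. ip (A x) y"
    using A(1) V by (rule semi_inner_space_form)
  have "((nrm (A x))\<^sup>2)\<^sup>2 \<le> ip (A x) x * ip (A (A x)) (A x)"
    using form.Cauchy_Schwarz_power2[OF x] AxH by (simp add: nrm_power2)
  also have "\<dots> \<le> ip (A x) x * (L * (nrm (A x))\<^sup>2)"
    using form_bound[OF A AxH] V(3) x(1) by (intro mult_left_mono) (auto simp: psd_on_def)
  finally have "(nrm (A x))\<^sup>2 * (nrm (A x))\<^sup>2 \<le> (L * ip (A x) x) * (nrm (A x))\<^sup>2"
    by (simp add: power2_eq_square algebra_simps)
  moreover have "0 < (nrm (A x))\<^sup>2" using False by simp
  ultimately show ?thesis by (simp only: mult_le_cancel_right_pos)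
qed

lemma kerD: "f \<in> ker A \<Longrightarrow> f \<in> H" "f \<in> ker A \<Longrightarrow> symop A \<Longrightarrow> z \<in> H \<Longrightarrow> ip (A f) z = 0"
  by (auto simp: ker_def ip_null)

lemma subspace_ker:
  assumes "symop A"
  shows "subspace (ker A)"
proof -
  have "ker A = {x \<in> H. \<forall>z\<in>H. ip (A x) z = 0}" using assms by (auto simp: ker_def null_iff)
  then show ?thesis using assms by (auto simp: subspace_def symop_linear symopD ip_zero)
qed

lemma bounded_below_on_mono: "bounded_below_on V A \<Longrightarrow> W \<subseteq> V \<Longrightarrow> bounded_below_on W A"
  unfolding bounded_below_on_def by blast

lemma coercive_on_imp_bounded_below_on:
  assumes "symop A" "V \<subseteq> H" "coercive_on V A"
  shows "bounded_below_on V A"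
proof -
  obtain c where c: "c > 0" "\<And>x. x \<in> V \<Longrightarrow> c * (nrm x)\<^sup>2 \<le> ip (A x) x"
    using assms(3) by (auto simp: coercive_on_def)
  have "c * nrm x \<le> nrm (A x)" if "x \<in> V" for x
  proof (cases "nrm x = 0")
    case False
    have xH: "x \<in> H" using assms(2) that by blast
    have "c * nrm x * nrm x \<le> ip (A x) x" using c(2)[OF that] by (simp add: power2_eq_square)
    also have "\<dots> \<le> nrm (A x) * nrm x" using Cauchy_Schwarz[of "A x" x] assms(1) xH by simp
    finally show ?thesis using False nrm_nonneg[OF xH] by (simp add: mult_le_cancel_right)
  qed (use assms that in auto)
  then show ?thesis using c(1) by (auto simp: bounded_below_on_def)
qed

lemma psd_bounded_below_on_imp_coercive_on:
  assumes A: "symop A" "bound_op A L" "psd_on H A" and "V \<subseteq> H" "bounded_below_on V A"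
  shows "coercive_on V A"
proof -
  obtain c where c: "c > 0" "\<And>x. x \<in> V \<Longrightarrow> c * nrm x \<le> nrm (A x)"
    using assms(5) by (auto simp: bounded_below_on_def)
  have "c\<^sup>2 / L * (nrm x)\<^sup>2 \<le> ip (A x) x" if "x \<in> V" for x
  proof -
    have xH: "x \<in> H" using assms(4) that by blast
    have "(c * nrm x)\<^sup>2 \<le> (nrm (A x))\<^sup>2" using c(1) c(2)[OF that] xH by (intro power_mono) auto
    also have "\<dots> \<le> L * ip (A x) x" using A xH by (intro psd_nrm_bound[where V = H] subspace_H) auto
    finally show ?thesis using bound_op_pos[OF A(2)] by (simp add: field_simps power_mult_distrib)
  qed
  moreover have "0 < c\<^sup>2 / L" using c(1) bound_op_pos[OF A(2)] by simp
  ultimately show ?thesis unfolding coercive_on_def by blast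
qed

lemma bounded_below_shift_square:
  assumes A: "symop A" and \<theta>: "0 \<le> \<theta>"
    and "bounded_below_on H (shift A (sqrt \<theta>))" "bounded_below_on H (shift A (- sqrt \<theta>))"
  shows "bounded_below_on H (shift (\<lambda>x. A (A x)) \<theta>)"
proof -
  let ?B = "shift A (sqrt \<theta>)" and ?C = "shift A (- sqrt \<theta>)"
  obtain b c where b: "b > 0" "\<And>x. x \<in> H \<Longrightarrow> b * nrm x \<le> nrm (?B x)"
    and c: "c > 0" "\<And>x. x \<in> H \<Longrightarrow> c * nrm x \<le> nrm (?C x)"
    using assms(3,4) by (auto simp: bounded_below_on_def)
  have "b * c * nrm x \<le> nrm (shift (\<lambda>x. A (A x)) \<theta> x)" if x: "x \<in> H" for x
  proof -
    have CH: "?C x \<in> H" using A x by (simp add: symop_shift)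
    have "b * (c * nrm x) \<le> b * nrm (?C x)" using b(1) c(2)[OF x] by (intro mult_left_mono) auto
    also have "\<dots> \<le> nrm (?B (?C x))" using b(2)[OF CH] .
    also have "\<dots> = nrm (shift (\<lambda>x. A (A x)) \<theta> x)"
    proof (rule nrm_cong_ip)
      show "ip (?B (?C x)) z = ip (shift (\<lambda>x. A (A x)) \<theta> x) z" if "z \<in> H" for z
        using A x that \<theta> by (simp add: shift_def ip_simps symop_linear algebra_simps flip: mult.assoc)
    qed (use A x CH in \<open>auto simp: symop_shift symop_square\<close>)
    finally show ?thesis by (simp add: mult.assoc)
  qed
  then show ?thesis using b(1) c(1) unfolding bounded_below_on_def by (intro exI[of _ "b * c"]) simp
qed

definition form_bounds :: "('v \<Rightarrow> 'v) \<Rightarrow> real set" where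
  "form_bounds A = {s. \<forall>x\<in>H. s * (nrm x)\<^sup>2 \<le> ip (A x) x}"

lemma form_bounds_downward_closed: "s \<in> form_bounds A \<Longrightarrow> r \<le> s \<Longrightarrow> r \<in> form_bounds A"
  by (auto simp: form_bounds_def intro: order_trans[OF mult_right_mono])

lemma Sup_form_bounds:
  assumes ne: "form_bounds A \<noteq> {}" and null: "\<And>x. x \<in> H \<Longrightarrow> nrm x = 0 \<Longrightarrow> 0 \<le> ip (A x) x"
  shows "Sup (form_bounds A) \<in> form_bounds A"
proof -
  have "Sup (form_bounds A) * (nrm x)\<^sup>2 \<le> ip (A x) x" if x: "x \<in> H" for x
  proof (cases "nrm x = 0")
    case True
    then show ?thesis using null[OF x] by simp
  next
    case False
    then have pos: "0 < (nrm x)\<^sup>2" by simp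
    have "Sup (form_bounds A) \<le> ip (A x) x / (nrm x)\<^sup>2"
      using ne by (rule cSup_least) (use x pos in \<open>simp add: form_bounds_def pos_le_divide_eq\<close>)
    then show ?thesis using pos by (simp add: pos_le_divide_eq)
  qed
  then show ?thesis by (simp add: form_bounds_def)
qed

text \<open>If the best constant \<open>s\<close> in \<open>s (nrm x)\<^sup>2 \<le> ip (A x) x\<close> were below \<open>r\<close>, then \<open>A - s\<close> would be
  positive and bounded below, hence coercive, and \<open>s\<close> could be improved.\<close>

lemma psd_ge_of_bounded_below_shifts:
  assumes A: "symop A" "bound_op A L" "psd_on H A"
    and below: "\<And>\<theta>. 0 \<le> \<theta> \<Longrightarrow> \<theta> < r \<Longrightarrow> bounded_below_on H (shift A \<theta>)"
  shows "r \<in> form_bounds A"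
proof (rule ccontr)
  assume r: "r \<notin> form_bounds A"
  define s where "s = Sup (form_bounds A)"
  have bounds_less: "t < r" if "t \<in> form_bounds A" for t
    using form_bounds_downward_closed[OF that, of r] r by (meson not_less)
  then have bdd: "bdd_above (form_bounds A)" by (meson bdd_aboveI less_imp_le)
  have zero: "0 \<in> form_bounds A" using A(3) by (simp add: form_bounds_def psd_on_def)
  have s: "s \<in> form_bounds A"
    unfolding s_def using zero A(3) by (intro Sup_form_bounds) (auto simp: psd_on_def)
  have "0 \<le> s" unfolding s_def using zero bdd by (rule cSup_upper)
  then have "bounded_below_on H (shift A s)" using below bounds_less[OF s] by blast
  moreover have "psd_on H (shift A s)"
    using s A(1) by (simp add: psd_on_def ip_shift form_bounds_def nrm_power2)
  ultimately have "coercive_on H (shift A s)"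
    using symop_shift[OF A(1)] bound_op_shift[OF A(1,2)]
    by (intro psd_bounded_below_on_imp_coercive_on) auto
  then obtain m where m: "m > 0" "\<And>x. x \<in> H \<Longrightarrow> m * (nrm x)\<^sup>2 \<le> ip (shift A s x) x"
    by (auto simp: coercive_on_def)
  then have "s + m \<in> form_bounds A"
    using A(1) by (simp add: form_bounds_def ip_shift nrm_power2 algebra_simps)
  then have "s + m \<le> s" unfolding s_def using bdd by (rule cSup_upper)
  then show False using m(1) by simp
qed

lemma nrm_ge_of_bounded_below_shifts:
  assumes T: "symop T" "bound_op T L" and r: "r > 0"
    and below: "\<And>\<theta>. \<bar>\<theta> - c\<bar> < r \<Longrightarrow> bounded_below_on H (shift T \<theta>)" and x: "x \<in> H"
  shows "r * nrm x \<le> nrm (shift T c x)"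
proof -
  let ?T = "shift T c"
  have T': "symop ?T" "bound_op ?T (L + \<bar>c\<bar>)" using T by (simp_all add: symop_shift bound_op_shift)
  have "r\<^sup>2 \<in> form_bounds (\<lambda>x. ?T (?T x))"
  proof (rule psd_ge_of_bounded_below_shifts[OF symop_square[OF T'(1)] bound_op_square[OF T']])
    show "psd_on H (\<lambda>x. ?T (?T x))" using ip_square[OF T'(1)] by (simp add: psd_on_def)
    fix \<theta> :: real assume \<theta>: "0 \<le> \<theta>" "\<theta> < r\<^sup>2"
    then have "sqrt \<theta> < r" using r by (simp add: real_less_lsqrt)
    then have "bounded_below_on H (shift ?T (sqrt \<theta>))" "bounded_below_on H (shift ?T (- sqrt \<theta>))"
      using \<theta>(1) unfolding shift_shift by (auto intro!: below)
    then show "bounded_below_on H (shift (\<lambda>x. ?T (?T x)) \<theta>)"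
      by (rule bounded_below_shift_square[OF T'(1) \<theta>(1)])
  qed
  then have "r\<^sup>2 * (nrm x)\<^sup>2 \<le> ip (?T (?T x)) x" using x unfolding form_bounds_def by blast
  then have "(r * nrm x)\<^sup>2 \<le> (nrm (?T x))\<^sup>2" using ip_square[OF T'(1) x] by (simp add: power_mult_distrib)
  then show ?thesis by (rule power2_le_imp_le) (use T' x in simp)
qed

lemma bounded_below_shift_of_kernel:
  assumes T: "symop T" and U: "finite U" "U \<subseteq> ker T"
    and c: "\<And>x. x \<in> orth U \<Longrightarrow> c * nrm x \<le> nrm (T x)" and \<theta>: "\<theta> \<noteq> 0" "\<bar>\<theta>\<bar> < c"
  shows "bounded_below_on H (shift T \<theta>)"
proof -
  define d where "d = min \<bar>\<theta>\<bar> (c - \<bar>\<theta>\<bar>)"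
  have d: "d > 0" using \<theta> by (simp add: d_def)
  have UH: "U \<subseteq> H" using U kerD(1) by blast
  have "d * nrm x \<le> nrm (shift T \<theta> x)" if x: "x \<in> H" for x
  proof (rule power2_le_imp_le)
    obtain p where p: "p \<in> span U" "x - p \<in> orth U" using orthogonal_decomposition[OF U(1) UH x] by blast
    define y where "y = x - p"
    have x_eq: "x = p + y" and yU: "y \<in> orth U" using p by (simp_all add: y_def)
    have p_ker: "p \<in> ker T" using span_minimal[OF U(2) subspace_ker[OF T]] p(1) by blast
    have H: "p \<in> H" "y \<in> H" "shift T \<theta> y \<in> H"
      using kerD(1)[OF p_ker] orthD(1)[OF yU] T by (simp_all add: symop_shift)
    have yp: "ip y p = 0" by (rule ip_orth_span[OF UH yU p(1)])
    have "ip (T y) p = 0" using kerD(2)[OF p_ker T H(2)] T H by (simp add: symopD[of T y] ip_sym[of y])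
    then have orthogonal: "ip (- \<theta> *\<^sub>R p) (shift T \<theta> y) = 0"
      using H T yp by (simp add: ip_simps shift_def ip_sym[of p] ip_sym[of p "T y"])
    have "nrm (shift T \<theta> x) = nrm (- \<theta> *\<^sub>R p + shift T \<theta> y)"
    proof (rule nrm_cong_ip)
      show "ip (shift T \<theta> x) z = ip (- \<theta> *\<^sub>R p + shift T \<theta> y) z" if "z \<in> H" for z
        using kerD(2)[OF p_ker T that] H T that
        by (simp add: x_eq shift_def ip_simps symop_linear algebra_simps)
    qed (use H x T in \<open>auto simp: symop_shift\<close>)
    then have split: "(nrm (shift T \<theta> x))\<^sup>2 = (\<bar>\<theta>\<bar> * nrm p)\<^sup>2 + (nrm (shift T \<theta> y))\<^sup>2"
      using nrm_add_power2[OF _ H(3) orthogonal] H(1) nrm_scale[OF H(1), of "- \<theta>"] by simp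
    have "(c - \<bar>\<theta>\<bar>) * nrm y \<le> nrm (T y) - nrm (\<theta> *\<^sub>R y)"
      using c[OF yU] H by (simp add: nrm_scale algebra_simps)
    also have "\<dots> \<le> nrm (shift T \<theta> y)" unfolding shift_def using H T by (intro nrm_le_diff) auto
    finally have "d * nrm y \<le> nrm (shift T \<theta> y)"
      using H(2) by (smt (verit) d_def mult_right_mono nrm_nonneg)
    moreover have "d * nrm p \<le> \<bar>\<theta>\<bar> * nrm p" using H(1) by (intro mult_right_mono) (auto simp: d_def)
    ultimately have "(d * nrm p)\<^sup>2 + (d * nrm y)\<^sup>2 \<le> (nrm (shift T \<theta> x))\<^sup>2"
      unfolding split using d H by (intro add_mono power_mono) auto
    moreover have "(nrm x)\<^sup>2 = (nrm p)\<^sup>2 + (nrm y)\<^sup>2"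
      unfolding x_eq using H yp ip_sym[of p y] by (intro nrm_add_power2) auto
    ultimately show "(d * nrm x)\<^sup>2 \<le> (nrm (shift T \<theta> x))\<^sup>2" by (simp add: power_mult_distrib distrib_left)
  qed (use T x in \<open>simp add: symop_shift\<close>)
  then show ?thesis using d by (auto simp: bounded_below_on_def)
qed

end

section \<open>Complete semi-inner product spaces\<close>

locale semi_hilbert_space = semi_inner_space H ip
  for H :: "'v::real_vector set" and ip :: "'v \<Rightarrow> 'v \<Rightarrow> real" +
  assumes complete: "(\<And>n. X n \<in> H) \<Longrightarrow> summable (\<lambda>n. nrm (X (Suc n) - X n)) \<Longrightarrow>
        \<exists>x\<in>H. (\<lambda>n. nrm (X n - x)) \<longlonglongrightarrow> 0"
begin

definition nrm_converges :: "(nat \<Rightarrow> 'v) \<Rightarrow> 'v \<Rightarrow> bool" where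
  "nrm_converges X x \<longleftrightarrow> (\<forall>n. X n \<in> H) \<and> x \<in> H \<and> (\<lambda>n. nrm (X n - x)) \<longlonglongrightarrow> 0"

lemma nrm_convergesD:
  assumes "nrm_converges X x"
  shows "X n \<in> H" "x \<in> H" "(\<lambda>n. nrm (X n - x)) \<longlonglongrightarrow> 0"
  using assms by (simp_all add: nrm_converges_def)

lemma nrm_converges_const: "x \<in> H \<Longrightarrow> nrm_converges (\<lambda>_. x) x"
  by (simp add: nrm_converges_def)

lemma nrm_converges_diff_const:
  assumes "nrm_converges X x" "y \<in> H"
  shows "nrm_converges (\<lambda>n. X n - y) (x - y)"
  using assms by (simp add: nrm_converges_def)

lemma nrm_converges_symop:
  assumes A: "symop A" "bound_op A L" and X: "nrm_converges X x"
  shows "nrm_converges (\<lambda>n. A (X n)) (A x)"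
  unfolding nrm_converges_def
proof (intro conjI allI)
  note XH = nrm_convergesD(1,2)[OF X]
  show "(\<lambda>n. nrm (A (X n) - A x)) \<longlonglongrightarrow> 0"
  proof (rule Lim_null_comparison)
    have "nrm (A (X n) - A x) \<le> L * nrm (X n - x)" for n
      using bound_opD[OF A(2), of "X n - x"] nrm_symop_diff[OF A(1) XH] XH by simp
    then show "\<forall>\<^sub>F n in sequentially. norm (nrm (A (X n) - A x)) \<le> L * nrm (X n - x)"
      using A XH by simp
    show "(\<lambda>n. L * nrm (X n - x)) \<longlonglongrightarrow> 0"
      using nrm_convergesD(3)[OF X] by (rule tendsto_mult_right_zero)
  qed
qed (use A nrm_convergesD[OF X] in auto)

lemma tendsto_ip:
  assumes X: "nrm_converges X x" and Y: "nrm_converges Y y"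
  shows "(\<lambda>n. ip (X n) (Y n)) \<longlonglongrightarrow> ip x y"
proof (rule LIM_zero_cancel, rule Lim_null_comparison)
  note H = nrm_convergesD(1,2)[OF X] nrm_convergesD(1,2)[OF Y]
  show "\<forall>\<^sub>F n in sequentially. norm (ip (X n) (Y n) - ip x y) \<le>
      nrm (X n - x) * nrm (Y n - y) + nrm (X n - x) * nrm y + nrm x * nrm (Y n - y)"
  proof (intro always_eventually allI)
    fix n
    have "ip (X n) (Y n) - ip x y = ip (X n - x) (Y n - y) + ip (X n - x) y + ip x (Y n - y)"
      using H by (simp add: ip_simps)
    then show "norm (ip (X n) (Y n) - ip x y) \<le>
        nrm (X n - x) * nrm (Y n - y) + nrm (X n - x) * nrm y + nrm x * nrm (Y n - y)"
      using Cauchy_Schwarz[of "X n - x" "Y n - y"] Cauchy_Schwarz[of "X n - x" y]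
        Cauchy_Schwarz[of x "Y n - y"] H by simp
  qed
  have "(\<lambda>n. nrm (X n - x) * nrm (Y n - y) + nrm (X n - x) * nrm y + nrm x * nrm (Y n - y))
      \<longlonglongrightarrow> 0 * 0 + 0 * nrm y + nrm x * 0"
    by (intro tendsto_intros nrm_convergesD(3)[OF X] nrm_convergesD(3)[OF Y])
  then show "(\<lambda>n. nrm (X n - x) * nrm (Y n - y) + nrm (X n - x) * nrm y + nrm x * nrm (Y n - y)) \<longlonglongrightarrow> 0"
    by simp
qed

lemma tendsto_nrm: "nrm_converges X x \<Longrightarrow> (\<lambda>n. nrm (X n)) \<longlonglongrightarrow> nrm x"
  unfolding nrm_def by (intro tendsto_real_sqrt tendsto_ip)

lemma complete_geometric:
  assumes XH: "\<And>n. X n \<in> H" and increments: "\<And>n. nrm (X (Suc n) - X n) \<le> C * q ^ n"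
    and q: "0 \<le> q" "q < 1"
  shows "\<exists>x. nrm_converges X x \<and> (\<forall>n. nrm (X n - x) \<le> C * q ^ n / (1 - q))"
proof -
  have geometric: "summable (\<lambda>n. C * q ^ n)" using q by (intro summable_mult summable_geometric) simp
  then have "summable (\<lambda>n. nrm (X (Suc n) - X n))"
    using XH increments by (intro summable_comparison_test'[OF geometric]) simp
  then obtain x where "x \<in> H" "(\<lambda>n. nrm (X n - x)) \<longlonglongrightarrow> 0" using complete[of X] XH by blast
  then have x: "nrm_converges X x" using XH by (simp add: nrm_converges_def)
  have "0 \<le> C"
    using increments[of 0] XH by (smt (verit) H_closed(3) mult_cancel_left1 nrm_nonneg power_0)
  have "nrm (X n - x) \<le> C * q ^ n / (1 - q)" for n
  proof (rule LIMSEQ_le_const2)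
    show "(\<lambda>m. nrm (X m - X n)) \<longlonglongrightarrow> nrm (X n - x)"
      using tendsto_nrm[OF nrm_converges_diff_const[OF x XH, of n]] nrm_convergesD(2)[OF x] XH
      by (simp add: nrm_minus_commute)
    have "nrm (X m - X n) \<le> C * q ^ n / (1 - q)" if "n \<le> m" for m
    proof -
      have "nrm (X m - X n) \<le> (\<Sum>i=n..<m. nrm (X (Suc i) - X i))"
        using nrm_diff_le_sum_increments[OF XH that] XH by (simp add: nrm_minus_commute)
      also have "\<dots> \<le> (\<Sum>i=n..<m. C * q ^ i)" by (intro sum_mono increments)
      also have "\<dots> = C * (q ^ n - q ^ m) / (1 - q)"
        using that 
      proof (induction m rule: dec_induct)
        case (step m)
        then show ?case using q by (simp only: sum.atLeastLessThan_Suc) (simp add: field_simps)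
      qed simp
      also have "\<dots> \<le> C * q ^ n / (1 - q)"
        using q \<open>0 \<le> C\<close> by (intro divide_right_mono mult_left_mono) auto
      finally show ?thesis .
    qed
    then show "\<exists>N. \<forall>m\<ge>N. nrm (X m - X n) \<le> C * q ^ n / (1 - q)" by blast
  qed
  then show ?thesis using x by blast
qed

lemma contraction_step:
  assumes A: "symop A" "bound_op A L" "psd_on H A" and z: "z \<in> H"
    and \<gamma>: "0 < \<gamma>" "\<gamma> \<le> L" "\<gamma> * (nrm z)\<^sup>2 \<le> ip (A z) z"
  shows "nrm (z - (1 / L) *\<^sub>R A z) \<le> (1 - \<gamma> / (2 * L)) * nrm z"
proof (rule power2_le_imp_le)
  have L: "0 < L" using A(2) by (rule bound_op_pos)
  have "(nrm (z - (1 / L) *\<^sub>R A z))\<^sup>2 = (nrm z)\<^sup>2 - 2 / L * ip (A z) z + (nrm (A z))\<^sup>2 / L\<^sup>2"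
    using A z L
    by (simp add: nrm_power2 ip_simps ip_sym[of z "A z"] power2_eq_square nrm_mult_self field_simps)
  also have "\<dots> \<le> (nrm z)\<^sup>2 - 2 / L * ip (A z) z + L * ip (A z) z / L\<^sup>2"
    using psd_nrm_bound[OF A(1,2) subspace_H order_refl A(3) z] A z
    by (intro add_left_mono divide_right_mono) auto
  also have "\<dots> = (nrm z)\<^sup>2 - ip (A z) z / L" using L by (simp add: field_simps power2_eq_square)
  also have "\<dots> \<le> (nrm z)\<^sup>2 - \<gamma> * (nrm z)\<^sup>2 / L"
    using \<gamma>(3) L by (intro diff_left_mono divide_right_mono) auto
  also have "\<dots> \<le> (nrm z)\<^sup>2 - \<gamma> * (nrm z)\<^sup>2 / L + (\<gamma> / (2 * L))\<^sup>2 * (nrm z)\<^sup>2" by simp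
  also have "\<dots> = (1 - \<gamma> / (2 * L))\<^sup>2 * (nrm z)\<^sup>2" by (simp add: power2_diff algebra_simps)
  finally show "(nrm (z - (1 / L) *\<^sub>R A z))\<^sup>2 \<le> ((1 - \<gamma> / (2 * L)) * nrm z)\<^sup>2"
    by (simp add: power_mult_distrib)
  show "0 \<le> (1 - \<gamma> / (2 * L)) * nrm z"
    using \<gamma>(1,2) L z by (intro mult_nonneg_nonneg) (auto simp: field_simps)
qed

primrec residual_iterate :: "('v \<Rightarrow> 'v) \<Rightarrow> 'v \<Rightarrow> real \<Rightarrow> 'v \<Rightarrow> nat \<Rightarrow> 'v" where
  "residual_iterate A g M f 0 = f"
| "residual_iterate A g M f (Suc n) =
    residual_iterate A g M f n - (1 / M) *\<^sub>R (A (residual_iterate A g M f n) - g)"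

lemma residual_iterate_closed:
  assumes "symop A" "g \<in> H" "f \<in> H"
  shows "residual_iterate A g M f n \<in> H"
  by (induction n) (use assms in simp_all)

lemma residual_iterate_contraction:
  assumes A: "symop A" "bound_op A M" "psd_on H A" and g: "g \<in> H" and f: "f \<in> H" and \<gamma>: "0 < \<gamma>" "\<gamma> \<le> M"
    and coercive: "\<And>x. x \<in> H \<Longrightarrow> \<gamma> * (nrm (A x - g))\<^sup>2 \<le> ip (A (A x - g)) (A x - g)"
  shows "nrm (A (residual_iterate A g M f n) - g) \<le> nrm (A f - g) * (1 - \<gamma> / (2 * M)) ^ n"
proof (induction n)
  case (Suc n)
  define X where "X = residual_iterate A g M f n"
  define residual where "residual = A X - g"
  have XH: "X \<in> H" unfolding X_def by (rule residual_iterate_closed[OF A(1) g f])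
  have RH: "residual \<in> H" using A(1) XH g by (simp add: residual_def)
  have M: "0 \<le> 1 - \<gamma> / (2 * M)" using \<gamma> by (simp add: field_simps)
  have "nrm (A (residual_iterate A g M f (Suc n)) - g) = nrm (residual - (1 / M) *\<^sub>R A residual)"
  proof (rule nrm_cong_ip)
    fix z assume z: "z \<in> H"
    have "ip (A (X - (1 / M) *\<^sub>R residual) - g) z = ip (A X - g) z - 1 / M * ip (A residual) z"
      using z A(1) g XH RH by (simp add: ip_simps symop_linear)
    also have "\<dots> = ip (residual - (1 / M) *\<^sub>R A residual) z"
      using z A(1) RH by (simp add: ip_simps residual_def[symmetric])
    finally show "ip (A (residual_iterate A g M f (Suc n)) - g) z
       = ip (residual - (1 / M) *\<^sub>R A residual) z"
      by (simp add: X_def residual_def)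
  qed (use A(1) g RH residual_iterate_closed[OF A(1) g f] in auto)
  also have "\<dots> \<le> (1 - \<gamma> / (2 * M)) * nrm residual"
    using coercive[OF XH] \<gamma> RH by (intro contraction_step A) (auto simp: residual_def)
  also have "\<dots> \<le> (1 - \<gamma> / (2 * M)) * (nrm (A f - g) * (1 - \<gamma> / (2 * M)) ^ n)"
    using Suc.IH M by (intro mult_left_mono) (auto simp: residual_def X_def)
  finally show ?case by (simp add: mult_ac)
qed simp

lemma ip_residual_iterate:
  assumes A: "symop A" and gf: "g \<in> H" "f \<in> H" and z: "z \<in> H" "\<forall>y\<in>H. ip (A y - g) z = 0"
  shows "ip (residual_iterate A g M f n) z = ip f z"
proof (induction n)
  case (Suc n)
  define x where "x = residual_iterate A g M f n"
  have x: "x \<in> H" unfolding x_def by (rule residual_iterate_closed[OF A gf])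
  then have "ip (residual_iterate A g M f (Suc n)) z = ip x z - 1 / M * ip (A x - g) z"
    using z(1) A gf(1) by (simp add: x_def[symmetric] ip_diff_left[of _ "_ *\<^sub>R _"] ip_scale_left)
  then show ?case using Suc.IH z(2) x by (simp add: x_def)
qed simp

lemma residual_iteration:
  assumes A: "symop A" "bound_op A L" "psd_on H A" and g: "g \<in> H" and f: "f \<in> H" and \<gamma>: "\<gamma> > 0"
    and coercive: "\<And>x. x \<in> H \<Longrightarrow> \<gamma> * (nrm (A x - g))\<^sup>2 \<le> ip (A (A x - g)) (A x - g)"
  shows "\<exists>x\<in>H. nrm (A x - g) = 0 \<and> \<gamma> * nrm (f - x) \<le> 2 * nrm (A f - g) \<and>
    (\<forall>z\<in>H. (\<forall>y\<in>H. ip (A y - g) z = 0) \<longrightarrow> ip x z = ip f z)"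
proof -
  define M where "M = max L \<gamma>"
  have AM: "bound_op A M" using A(2) by (rule bound_op_mono) (simp add: M_def)
  have M: "0 < M" "\<gamma> \<le> M" using \<gamma> by (simp_all add: M_def)
  define q where "q = 1 - \<gamma> / (2 * M)"
  have q: "0 \<le> q" "q < 1" using \<gamma> M by (simp_all add: q_def field_simps)
  define X where "X = residual_iterate A g M f"
  have XH: "X n \<in> H" for n unfolding X_def by (rule residual_iterate_closed[OF A(1) g f])
  have RH: "A (X n) - g \<in> H" for n using A(1) g XH by simp
  have residual_le: "nrm (A (X n) - g) \<le> nrm (A f - g) * q ^ n" for n
    unfolding X_def q_def
    using coercive by (intro residual_iterate_contraction[OF A(1) AM A(3) g f \<gamma> M(2)])
  have "nrm (X (Suc n) - X n) \<le> nrm (A f - g) / M * q ^ n" for n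
    using residual_le[of n] M(1) nrm_scale[OF RH, of "- (1 / M)" n] by (simp add: X_def field_simps)
  from complete_geometric[OF XH this q] obtain x where
    x: "nrm_converges X x" and dist: "\<forall>n. nrm (X n - x) \<le> nrm (A f - g) / M * q ^ n / (1 - q)"
    by blast
  have xH: "x \<in> H" using x by (rule nrm_convergesD)
  have "(\<lambda>n. nrm (A (X n) - g)) \<longlonglongrightarrow> nrm (A x - g)"
    by (intro tendsto_nrm nrm_converges_diff_const nrm_converges_symop[OF A(1,2)] x g)
  moreover have "(\<lambda>n. nrm (A (X n) - g)) \<longlonglongrightarrow> 0"
  proof (rule Lim_null_comparison)
    show "(\<lambda>n. nrm (A f - g) * q ^ n) \<longlonglongrightarrow> 0"
      using q by (intro tendsto_mult_right_zero LIMSEQ_realpow_zero)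
  qed (use residual_le RH in simp)
  ultimately have "nrm (A x - g) = 0" by (rule LIMSEQ_unique)
  moreover have "\<gamma> * nrm (f - x) \<le> 2 * nrm (A f - g)"
    using spec[OF dist, of 0] \<gamma> M(1) by (simp add: X_def q_def field_simps)
  moreover have "ip x z = ip f z" if z: "z \<in> H" "\<forall>y\<in>H. ip (A y - g) z = 0" for z
  proof -
    have "ip (X n) z = ip f z" for n unfolding X_def by (rule ip_residual_iterate[OF A(1) g f z])
    then have "(\<lambda>n. ip f z) \<longlonglongrightarrow> ip x z" using tendsto_ip[OF x nrm_converges_const[OF z(1)]] by simp
    then show ?thesis by (simp add: LIMSEQ_const_iff)
  qed
  ultimately show ?thesis using xH by blast
qed

lemma coercive_imp_surj_op:
  assumes A: "symop A" "bound_op A L" and "coercive_on H A"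
  shows "surj_op A"
  unfolding surj_op_def
proof
  fix g assume g: "g \<in> H"
  obtain c where c: "c > 0" "\<And>x. x \<in> H \<Longrightarrow> c * (nrm x)\<^sup>2 \<le> ip (A x) x"
    using assms(3) by (auto simp: coercive_on_def)
  then have "psd_on H A"
    unfolding psd_on_def by (meson mult_nonneg_nonneg less_imp_le order_trans zero_le_power2)
  then show "\<exists>f\<in>H. nrm (A f - g) = 0"
    using residual_iteration[OF A _ g H_closed(1) c(1)] c(2) A(1) g by (meson H_closed(3) symop_closed)
qed

lemma bounded_below_imp_surj_op:
  assumes A: "symop A" "bound_op A L" and "bounded_below_on H A"
  shows "surj_op A"
proof -
  obtain c where c: "c > 0" "\<And>x. x \<in> H \<Longrightarrow> c * nrm x \<le> nrm (A x)"
    using assms(3) by (auto simp: bounded_below_on_def)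
  have "c\<^sup>2 * (nrm x)\<^sup>2 \<le> ip (A (A x)) x" if "x \<in> H" for x
    using power_mono[OF c(2)[OF that], of 2] c(1) that by (simp add: ip_square A power_mult_distrib)
  then have "coercive_on H (\<lambda>x. A (A x))"
    using c(1) unfolding coercive_on_def by (intro exI[of _ "c\<^sup>2"]) simp
  then have "surj_op (\<lambda>x. A (A x))"
    using symop_square[OF A(1)] bound_op_square[OF A] by (rule coercive_imp_surj_op[rotated 2])
  then show ?thesis unfolding surj_op_def using A(1) by (meson symop_closed)
qed

text \<open>A gliding hump: the sign of the \<open>n\<close>-th correction \<open>\<plusminus> 3\<^sup>-\<^sup>n u n\<close> is chosen so that the
  pairing with \<open>u n\<close> does not decrease, and the later corrections cannot undo its effect.\<close>

lemma pairing_lower_bound: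
  fixes u :: "nat \<Rightarrow> 'v"
  assumes u: "\<And>n. u n \<in> H" "\<And>n. nrm (u n) = 1"
  shows "\<exists>g\<in>H. \<forall>n. (1/3) ^ n / 2 \<le> \<bar>ip g (u n)\<bar>"
proof -
  define s :: "nat \<Rightarrow> 'v \<Rightarrow> real" where "s n x = (if ip x (u n) \<ge> 0 then 1 else - 1)" for n x
  define X where "X = rec_nat 0 (\<lambda>n x. x + (s n x * (1/3) ^ n) *\<^sub>R u n)"
  have X_Suc: "X (Suc n) = X n + (s n (X n) * (1/3) ^ n) *\<^sub>R u n" for n by (simp add: X_def)
  have XH [simp]: "X n \<in> H" for n by (induction n) (simp_all add: X_def u)
  have "nrm (X (Suc n) - X n) \<le> 1 * (1/3) ^ n" for n
    using u by (simp add: X_Suc nrm_scale s_def)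
  then obtain g where g: "nrm_converges X g"
    and dist: "\<forall>n. nrm (X n - g) \<le> 1 * (1/3) ^ n / (1 - 1/3)"
    using complete_geometric[of X 1 "1/3"] by auto
  have gH: "g \<in> H" using g by (rule nrm_convergesD)
  have "(1/3) ^ n / 2 \<le> \<bar>ip g (u n)\<bar>" for n
  proof -
    have "ip (u n) (u n) = 1" using nrm_power2[OF u(1), of n] u(2)[of n] by simp
    then have "ip (X (Suc n)) (u n) = ip (X n) (u n) + s n (X n) * (1/3) ^ n"
      using u by (simp add: X_Suc ip_simps)
    then have "(1/3) ^ n \<le> \<bar>ip (X (Suc n)) (u n)\<bar>" by (simp add: s_def split: if_splits)
    moreover have "\<bar>ip (X (Suc n) - g) (u n)\<bar> \<le> nrm (X (Suc n) - g)"
      using Cauchy_Schwarz[of "X (Suc n) - g" "u n"] u gH by simp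
    moreover have "nrm (X (Suc n) - g) \<le> (1/3) ^ n / 2" using spec[OF dist, of "Suc n"] by simp
    ultimately show ?thesis using gH u by (simp add: ip_simps)
  qed
  then show ?thesis using gH by blast
qed

lemma surj_op_imp_bounded_below:
  assumes A: "symop A" and surj: "surj_op A"
  shows "bounded_below_on H A"
proof (rule ccontr)
  assume not_bounded: "\<not> ?thesis"
  have "\<exists>x\<in>H. nrm (A x) < (1/4) ^ n * nrm x" for n :: nat
  proof (rule ccontr)
    assume "\<not> ?thesis"
    then have "\<forall>x\<in>H. (1/4) ^ n * nrm x \<le> nrm (A x)" by (simp add: not_less)
    moreover have "0 < (1/4 :: real) ^ n" by simp
    ultimately show False using not_bounded unfolding bounded_below_on_def by blast
  qed
  then obtain x where x: "\<And>n::nat. x n \<in> H" "\<And>n. nrm (A (x n)) < (1/4) ^ n * nrm (x n)" by metis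
  have nonnull: "0 < nrm (x n)" for n
  proof -
    have "0 \<le> nrm (A (x n))" using A x(1) by simp
    then have "nrm (x n) \<noteq> 0" using x(2)[of n] by auto
    then show ?thesis using nrm_nonneg[OF x(1), of n] by linarith
  qed
  define u where "u n = (1 / nrm (x n)) *\<^sub>R x n" for n
  have u: "u n \<in> H" "nrm (u n) = 1" for n
    using x(1)[of n] nonnull[of n] by (simp_all add: u_def nrm_normalize)
  have Au: "nrm (A (u n)) \<le> (1/4) ^ n" for n
    using x(2)[of n] x(1)[of n] nonnull[of n] by (simp add: u_def nrm_symop_scale A divide_le_eq)
  obtain g where g: "g \<in> H" "\<forall>n. (1/3) ^ n / 2 \<le> \<bar>ip g (u n)\<bar>"
    using pairing_lower_bound[of u, OF u] by (rule bexE)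
  obtain h where h: "h \<in> H" "nrm (A h - g) = 0" using surj g(1) by (auto simp: surj_op_def)
  have power_le: "(4/3) ^ n \<le> 2 * nrm h" for n
  proof -
    have "(1/3) ^ n / 2 \<le> \<bar>ip g (u n)\<bar>" using g(2) by blast
    also have "\<dots> = \<bar>ip h (A (u n))\<bar>"
      using ip_eq_of_null_diff[OF _ g(1) u(1) h(2), of n] A h(1) u(1) by (simp add: symopD)
    also have "\<dots> \<le> nrm h * nrm (A (u n))" using A h(1) u(1) by (simp add: Cauchy_Schwarz)
    also have "\<dots> \<le> nrm h * (1/4) ^ n" using Au h(1) by (intro mult_left_mono) auto
    finally show ?thesis by (simp add: power_divide field_simps)
  qed
  obtain n where "2 * nrm h < (4/3) ^ n" using real_arch_pow[of "4/3" "2 * nrm h"] by auto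
  then show False using power_le[of n] by linarith
qed

subsection \<open>Finite-codimensional lower bounds\<close>

definition ess_bounded_below :: "('v \<Rightarrow> 'v) \<Rightarrow> bool" where
  "ess_bounded_below A \<longleftrightarrow> (\<exists>K. finite K \<and> K \<subseteq> H \<and> bounded_below_on (orth K) A)"

definition ess_coercive :: "('v \<Rightarrow> 'v) \<Rightarrow> bool" where
  "ess_coercive A \<longleftrightarrow> (\<exists>K. finite K \<and> K \<subseteq> H \<and> coercive_on (orth K) A)"

lemma orth_subset_H: "orth K \<subseteq> H"
  by (auto simp: orth_def)

lemma nrm_le_of_almost_null:
  assumes T: "symop T" and K: "K \<subseteq> H" and e: "e \<in> H"
    and c: "c > 0" "\<And>x. x \<in> orth K \<Longrightarrow> ip x e = 0 \<Longrightarrow> c * nrm x \<le> nrm (T x)"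
    and h: "h \<in> orth K" "ip h e = 1" and f: "f \<in> orth K" "nrm (T f) \<le> c / 2 * nrm f"
  shows "nrm f \<le> 2 * (nrm (T h) / c + nrm h) * \<bar>ip f e\<bar>"
proof -
  have H: "f \<in> H" "h \<in> H" using f(1) h(1) by (auto dest: orthD)
  define g where "g = f - ip f e *\<^sub>R h"
  have gH: "g \<in> H" using H by (simp add: g_def)
  have "g \<in> orth K"
    unfolding g_def
    by (rule subspace_diff[OF subspace_orth[OF K] f(1) subspace_scale[OF subspace_orth[OF K] h(1)]])
  moreover have "ip g e = 0" using H e h(2) by (simp add: g_def ip_simps)
  ultimately have "c * nrm g \<le> nrm (T g)" by (rule c(2))
  also have "\<dots> \<le> nrm (T f) + \<bar>ip f e\<bar> * nrm (T h)"
    using nrm_triangle_diff[of "T f" "T (ip f e *\<^sub>R h)"] T H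
    by (simp add: g_def nrm_symop_diff nrm_symop_scale)
  also have "nrm (T f) \<le> c / 2 * nrm f" by (rule f(2))
  finally have "nrm g \<le> nrm f / 2 + \<bar>ip f e\<bar> * nrm (T h) / c" using c(1) by (simp add: field_simps)
  moreover have "nrm f \<le> nrm g + \<bar>ip f e\<bar> * nrm h"
    using nrm_triangle[of g "ip f e *\<^sub>R h"] gH H by (simp add: g_def nrm_scale)
  ultimately have "nrm f \<le> nrm f / 2 + \<bar>ip f e\<bar> * (nrm (T h) / c + nrm h)" by (simp add: distrib_left)
  then show ?thesis unfolding mult.assoc mult.commute[of "_ + _"] by linarith
qed

lemma ip_eq_one_of_lost_bound:
  assumes K: "K \<subseteq> H" and e: "e \<in> H"
    and bounded: "bounded_below_on (orth (insert e K)) T" and unbounded: "\<not> bounded_below_on (orth K) T"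
  shows "\<exists>h\<in>orth K. ip h e = 1"
proof -
  obtain c where c: "c > 0" "\<And>x. x \<in> orth (insert e K) \<Longrightarrow> c * nrm x \<le> nrm (T x)"
    using bounded by (auto simp: bounded_below_on_def)
  obtain f where f: "f \<in> orth K" "nrm (T f) < c * nrm f"
    using unbounded c(1) by (auto simp: bounded_below_on_def not_le)
  have "ip f e \<noteq> 0" using c(2)[of f] f by (auto simp: orth_def)
  then have "ip ((1 / ip f e) *\<^sub>R f) e = 1" using e orthD(1)[OF f(1)] by (simp add: ip_simps)
  then show ?thesis using subspace_scale[OF subspace_orth[OF K] f(1)] by blast
qed

lemma approximate_null_vector:
  assumes T: "symop T" and K: "K \<subseteq> H" and e: "e \<in> H"
    and bounded: "bounded_below_on (orth (insert e K)) T" and unbounded: "\<not> bounded_below_on (orth K) T"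
    and \<eta>: "\<eta> > 0"
  shows "\<exists>u\<in>orth K. ip u e = 1 \<and> nrm (T u) < \<eta>"
proof -
  note sub = subspace_orth[OF K]
  obtain c where c: "c > 0" "\<And>x. x \<in> orth K \<Longrightarrow> ip x e = 0 \<Longrightarrow> c * nrm x \<le> nrm (T x)"
    using bounded by (auto simp: bounded_below_on_def orth_def)
  have small: "\<exists>f\<in>orth K. nrm (T f) < \<epsilon> * nrm f" if "\<epsilon> > 0" for \<epsilon>
    using unbounded that by (auto simp: bounded_below_on_def not_le)
  obtain h where h: "h \<in> orth K" "ip h e = 1"
    using ip_eq_one_of_lost_bound[OF K e bounded unbounded] by blast
  define D where "D = nrm (T h) / c + nrm h"
  have D: "0 \<le> D" using c(1) orthD(1)[OF h(1)] T by (simp add: D_def)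
  define \<epsilon> where "\<epsilon> = min (c / 2) (\<eta> / (2 * D + 1))"
  have \<epsilon>: "0 < \<epsilon>" "\<epsilon> \<le> c / 2" "\<epsilon> \<le> \<eta> / (2 * D + 1)"
    unfolding \<epsilon>_def using c(1) \<eta> D by (simp_all only: min.cobounded1 min.cobounded2) simp
  obtain f where f: "f \<in> orth K" "nrm (T f) < \<epsilon> * nrm f" using small[OF \<epsilon>(1)] by blast
  have fH: "f \<in> H" using f(1) by (rule orthD)
  have "\<epsilon> * nrm f \<le> c / 2 * nrm f" using \<epsilon>(2) fH by (intro mult_right_mono) auto
  then have nrm_f_le: "nrm f \<le> 2 * D * \<bar>ip f e\<bar>"
    unfolding D_def using f(2) by (intro nrm_le_of_almost_null[OF T K e c h f(1)]) auto
  have "ip f e \<noteq> 0"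
  proof
    assume "ip f e = 0"
    then have "nrm f = 0" using nrm_f_le nrm_nonneg[OF fH] by simp
    then have "nrm (T f) < 0" using f(2) by simp
    then show False using nrm_nonneg[OF symop_closed[OF T fH]] by linarith
  qed
  define u where "u = (1 / ip f e) *\<^sub>R f"
  have "nrm (T u) = nrm (T f) / \<bar>ip f e\<bar>" using T fH by (simp add: u_def nrm_symop_scale)
  also have "\<dots> < \<epsilon> * nrm f / \<bar>ip f e\<bar>" using f(2) \<open>ip f e \<noteq> 0\<close> by (simp add: divide_strict_right_mono)
  also have "\<dots> \<le> \<epsilon> * (2 * D)"
    using mult_left_mono[OF nrm_f_le, of \<epsilon>] \<epsilon>(1) \<open>ip f e \<noteq> 0\<close> by (simp add: divide_le_eq)
  also have "\<dots> \<le> \<eta> / (2 * D + 1) * (2 * D + 1)" using \<epsilon>(1,3) \<eta> D by (intro mult_mono) auto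
  also have "\<dots> = \<eta>" using D by simp
  finally have "nrm (T u) < \<eta>" .
  moreover have "u \<in> orth K" unfolding u_def using sub f(1) by (rule subspace_scale)
  moreover have "ip u e = 1" using fH e \<open>ip f e \<noteq> 0\<close> by (simp add: u_def ip_simps)
  ultimately show ?thesis by blast
qed

lemma kernel_vector_of_lost_bound:
  assumes T: "symop T" "bound_op T L" and K: "K \<subseteq> H" and e: "e \<in> H"
    and bounded: "bounded_below_on (orth (insert e K)) T" and unbounded: "\<not> bounded_below_on (orth K) T"
  obtains v where "v \<in> ker T" "v \<in> orth K" "ip v e = 1"
proof -
  note sub = subspace_orth[OF K]
  obtain c where c: "c > 0" "\<And>x. x \<in> orth K \<Longrightarrow> ip x e = 0 \<Longrightarrow> c * nrm x \<le> nrm (T x)"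
    using bounded by (auto simp: bounded_below_on_def orth_def)
  have "\<exists>u\<in>orth K. ip u e = 1 \<and> nrm (T u) < c * (1/2) ^ n" for n :: nat
    using c(1) by (intro approximate_null_vector[OF T(1) K e bounded unbounded]) simp
  then obtain u where u: "\<And>n::nat. u n \<in> orth K" "\<And>n. ip (u n) e = 1"
    and Tu: "\<And>n. nrm (T (u n)) < c * (1/2) ^ n" by metis
  have uH: "u n \<in> H" for n using u(1) by (rule orthD)
  have "nrm (u (Suc n) - u n) \<le> 2 * (1/2) ^ n" for n
  proof -
    have "c * nrm (u (Suc n) - u n) \<le> nrm (T (u (Suc n) - u n))"
      using u sub uH e by (intro c(2) subspace_diff) (auto simp: ip_simps)
    also have "\<dots> \<le> nrm (T (u (Suc n))) + nrm (T (u n))"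
      using nrm_triangle_diff[of "T (u (Suc n))" "T (u n)"] T(1) uH by (simp add: nrm_symop_diff)
    also have "\<dots> \<le> c * (1/2) ^ n + c * (1/2) ^ n"
      using Tu[of "Suc n"] Tu[of n] c(1) by (simp add: field_simps)
    finally show ?thesis using c(1) by (simp add: field_simps)
  qed
  from complete_geometric[of u 2 "1/2", OF uH this] obtain v where v: "nrm_converges u v" by auto
  have vH: "v \<in> H" using v by (rule nrm_convergesD)
  have tendsto: "(\<lambda>n. ip (u n) z) \<longlonglongrightarrow> ip v z" if "z \<in> H" for z
    using v nrm_converges_const[OF that] by (rule tendsto_ip)
  have "ip v e = 1" using tendsto[OF e] u(2) by (simp add: LIMSEQ_const_iff)
  moreover have "ip v k = 0" if "k \<in> K" for k
    using tendsto[of k] that K orthD(2)[OF u(1) that] by (auto simp: LIMSEQ_const_iff)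
  then have "v \<in> orth K" using vH by (simp add: orth_def)
  moreover have "nrm (T v) = 0"
  proof (rule LIMSEQ_unique)
    show "(\<lambda>n. nrm (T (u n))) \<longlonglongrightarrow> nrm (T v)" by (intro tendsto_nrm nrm_converges_symop[OF T] v)
    show "(\<lambda>n. nrm (T (u n))) \<longlonglongrightarrow> 0"
    proof (rule Lim_null_comparison)
      show "(\<lambda>n. c * (1/2) ^ n) \<longlonglongrightarrow> 0" by (intro tendsto_mult_right_zero LIMSEQ_realpow_zero) auto
    qed (use Tu T(1) uH in \<open>auto simp: less_imp_le\<close>)
  qed
  then have "v \<in> ker T" using vH by (simp add: ker_def)
  ultimately show ?thesis using that by blast
qed

lemma bounded_below_on_orth_exchange:
  assumes T: "symop T" and K: "K \<subseteq> H" and e: "e \<in> H"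
    and bounded: "bounded_below_on (orth (insert e K)) T" and v: "v \<in> ker T" "v \<in> orth K" "ip v e = 1"
  shows "bounded_below_on (orth (insert v K)) T"
proof -
  obtain c where c: "c > 0" "\<And>x. x \<in> orth K \<Longrightarrow> ip x e = 0 \<Longrightarrow> c * nrm x \<le> nrm (T x)"
    using bounded by (auto simp: bounded_below_on_def orth_def)
  have vH: "v \<in> H" using v(1) by (rule kerD)
  have "c * nrm f \<le> nrm (T f)" if f: "f \<in> orth (insert v K)" for f
  proof -
    have fH: "f \<in> H" and fK: "f \<in> orth K" and fv: "ip f v = 0" using f by (auto simp: orth_def)
    define g where "g = f - ip f e *\<^sub>R v"
    have gH: "g \<in> H" using fH vH by (simp add: g_def)
    have "g \<in> orth K"
      unfolding g_def using subspace_orth[OF K] fK v(2) by (intro subspace_diff subspace_scale)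
    moreover have "ip g e = 0" using fH vH e v(3) by (simp add: g_def ip_simps)
    ultimately have "c * nrm g \<le> nrm (T g)" by (rule c(2))
    also have "nrm (T g) = nrm (T f)"
      using T fH gH vH kerD(2)[OF v(1) T]
      by (intro nrm_cong_ip) (auto simp: g_def symop_linear)
    finally have "c * nrm g \<le> nrm (T f)" .
    moreover have "nrm f \<le> nrm g"
    proof (rule power2_le_imp_le)
      have "(nrm g)\<^sup>2 = (nrm f)\<^sup>2 + (ip f e)\<^sup>2 * (nrm v)\<^sup>2"
        using fH vH fv
        by (simp add: g_def nrm_power2 ip_simps ip_sym[of v f] power2_eq_square nrm_mult_self)
      then show "(nrm f)\<^sup>2 \<le> (nrm g)\<^sup>2" by simp
    qed (use gH in simp)
    ultimately show ?thesis using c(1) by (smt (verit) mult_left_mono)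
  qed
  then show ?thesis using c(1) unfolding bounded_below_on_def by blast
qed

lemma ess_bounded_below_imp_kernel_bound:
  assumes T: "symop T" "bound_op T L" and "ess_bounded_below T"
  obtains U where "finite U" "U \<subseteq> ker T" "bounded_below_on (orth U) T"
proof -
  have "\<exists>U. finite U \<and> U \<subseteq> ker T \<and> bounded_below_on (orth U) T"
    if "finite K" "K \<subseteq> H" "finite R" "R \<subseteq> ker T" "bounded_below_on (orth (K \<union> R)) T" for K R
    using that
  proof (induction K arbitrary: R rule: finite_induct)
    case empty
    then show ?case by auto
  next
    case (insert e K)
    have KR: "K \<subseteq> H" "e \<in> H" "K \<union> R \<subseteq> H" using insert.prems kerD(1) by auto
    have bounded: "bounded_below_on (orth (insert e (K \<union> R))) T" using insert.prems(4) by simp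
    show ?case
    proof (cases "bounded_below_on (orth (K \<union> R)) T")
      case True
      show ?thesis by (rule insert.IH[OF KR(1) insert.prems(2,3) True])
    next
      case False
      obtain v where v: "v \<in> ker T" "v \<in> orth (K \<union> R)" "ip v e = 1"
        using kernel_vector_of_lost_bound[OF T KR(3,2) bounded False] .
      have "bounded_below_on (orth (K \<union> insert v R)) T"
        using bounded_below_on_orth_exchange[OF T(1) KR(3,2) bounded v] by simp
      then show ?thesis using insert.IH[OF KR(1), of "insert v R"] insert.prems v(1) by simp
    qed
  qed
  moreover obtain K where "finite K" "K \<subseteq> H" "bounded_below_on (orth K) T"
    using assms(3) by (auto simp: ess_bounded_below_def)
  ultimately show ?thesis using that by (metis Un_empty_right empty_subsetI finite.emptyI)
qed

lemma not_ess_coercive_orthonormal_family: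
  assumes T: "symop T" and psd: "psd_on H T" and not_coercive: "\<not> ess_coercive T" and \<eta>: "\<eta> > 0"
  shows "\<exists>v. (\<forall>i<N::nat. v i \<in> H \<and> ip (T (v i)) (v i) < \<eta>) \<and>
      (\<forall>i<N. \<forall>j<N. ip (v i) (v j) = (if i = j then 1 else 0))"
proof (induction N)
  case (Suc N)
  then obtain v where v: "\<And>i. i < N \<Longrightarrow> v i \<in> H" "\<And>i. i < N \<Longrightarrow> ip (T (v i)) (v i) < \<eta>"
    "\<And>i j. i < N \<Longrightarrow> j < N \<Longrightarrow> ip (v i) (v j) = (if i = j then 1 else 0)" by auto
  have "\<not> coercive_on (orth (v ` {..<N})) T"
    using not_coercive v(1)
    unfolding ess_coercive_def by (metis finite_imageI finite_lessThan image_subsetI lessThan_iff)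
  then obtain f where f: "f \<in> orth (v ` {..<N})" "ip (T f) f < \<eta> * (nrm f)\<^sup>2"
    using \<eta> by (auto simp: coercive_on_def not_le)
  have fH: "f \<in> H" using f(1) by (rule orthD)
  have "nrm f \<noteq> 0" using f(2) psd fH by (auto simp: psd_on_def dest: bspec)
  define u where "u = (1 / nrm f) *\<^sub>R f"
  have u: "u \<in> H" "ip u u = 1"
    using fH nrm_power2[of u] nrm_normalize[OF fH \<open>nrm f \<noteq> 0\<close>] by (simp_all add: u_def)
  have "ip (T u) u = ip (T f) f / (nrm f)\<^sup>2"
    using fH T by (simp add: u_def symop_linear ip_simps power2_eq_square)
  also have "\<dots> < \<eta>" using f(2) \<open>nrm f \<noteq> 0\<close> by (simp add: field_simps)
  finally have "ip (T u) u < \<eta>" .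
  moreover have "ip u (v i) = 0" "ip (v i) u = 0" if "i < N" for i
    using that f(1) fH v(1) by (auto simp: u_def ip_simps orth_def ip_sym[of "v i" f])
  ultimately show ?case
    by (intro exI[of _ "v(N := u)"]) (use u v in \<open>auto simp: less_Suc_eq\<close>)
qed simp

subsection \<open>The essential spectrum\<close>

definition spec :: "('v \<Rightarrow> 'v) \<Rightarrow> real set" where
  "spec P = {l. \<not> ((\<forall>f\<in>H. nrm (shift P l f) = 0 \<longrightarrow> nrm f = 0) \<and> surj_op (shift P l))}"

definition discrete_spec :: "('v \<Rightarrow> 'v) \<Rightarrow> real set" where
  "discrete_spec P = {l \<in> spec P. (\<exists>e>0. \<forall>m\<in>spec P. \<bar>m - l\<bar> < e \<longrightarrow> m = l) \<and>
      (\<exists>f\<in>ker (shift P l). nrm f \<noteq> 0) \<and> fin_dim (ker (shift P l))}"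

definition ess_spec :: "('v \<Rightarrow> 'v) \<Rightarrow> real set" where
  "ess_spec P = spec P - discrete_spec P"

lemma spec_iff_not_bounded_below:
  assumes P: "symop P" "bound_op P L"
  shows "l \<in> spec P \<longleftrightarrow> \<not> bounded_below_on H (shift P l)"
proof -
  have "nrm f = 0"
    if bounded: "bounded_below_on H (shift P l)" and f: "f \<in> H" "nrm (shift P l f) = 0" for f
  proof -
    obtain c where "c > 0" "\<forall>x\<in>H. c * nrm x \<le> nrm (shift P l x)"
      using bounded by (auto simp: bounded_below_on_def)
    then have "c > 0" "c * nrm f \<le> 0" using f by auto
    then show ?thesis using nrm_nonneg[OF f(1)] by (simp add: mult_le_0_iff)
  qed
  moreover have "surj_op (shift P l) \<longleftrightarrow> bounded_below_on H (shift P l)"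
    using surj_op_imp_bounded_below[OF symop_shift[OF P(1)]]
      bounded_below_imp_surj_op[OF symop_shift[OF P(1)] bound_op_shift[OF P]] by (rule iffI)
  ultimately show ?thesis unfolding spec_def by blast
qed

lemma nrm_square_ge_of_isolated:
  assumes T: "symop T" "bound_op T L" and e: "e > 0"
    and below: "\<And>\<theta>. 0 < \<bar>\<theta>\<bar> \<Longrightarrow> \<bar>\<theta>\<bar> < e \<Longrightarrow> bounded_below_on H (shift T \<theta>)" and x: "x \<in> H"
  shows "e\<^sup>2 * (nrm (T x))\<^sup>2 \<le> (nrm (T (T x)))\<^sup>2"
proof -
  define A where "A x = T (T x)" for x
  have A: "symop A" "bound_op A (L * L)"
    unfolding A_def using T by (auto intro: symop_square bound_op_square)
  define \<gamma> where "\<gamma> = e\<^sup>2"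
  have \<gamma>: "0 < \<gamma>" using e by (simp add: \<gamma>_def)
  have A_below: "bounded_below_on H (shift A \<theta>)" if \<theta>: "0 < \<theta>" "\<theta> < \<gamma>" for \<theta>
  proof -
    have "sqrt \<theta> < e" using \<theta> e by (intro real_less_lsqrt) (auto simp: \<gamma>_def)
    then show ?thesis
      unfolding A_def using \<theta>(1) by (intro bounded_below_shift_square[OF T(1)] below) auto
  qed
  have "\<gamma> / 2 * nrm x \<le> nrm (shift A (\<gamma> / 2) x)"
  proof (rule nrm_ge_of_bounded_below_shifts[OF A _ _ x])
    fix \<theta> assume "\<bar>\<theta> - \<gamma> / 2\<bar> < \<gamma> / 2"
    then show "bounded_below_on H (shift A \<theta>)"
      by (intro A_below) (auto simp: abs_real_def split: if_splits)
  qed (use \<gamma> in simp)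
  then have "(\<gamma> / 2 * nrm x)\<^sup>2 \<le> (nrm (shift A (\<gamma> / 2) x))\<^sup>2" using \<gamma> x by (intro power_mono) auto
  also have "\<dots> = (nrm (A x))\<^sup>2 - \<gamma> * ip (A x) x + (\<gamma> / 2 * nrm x)\<^sup>2"
    unfolding power_mult_distrib using x A
    by (simp add: shift_def nrm_power2 ip_simps ip_sym[of x "A x"])
      (simp add: power2_eq_square field_simps)
  finally show ?thesis using ip_square[OF T(1) x] by (simp add: A_def \<gamma>_def)
qed

text \<open>The positive operator \<open>A = T\<^sup>2\<close> has no spectrum in the open interval from \<open>0\<close> to \<open>e\<^sup>2\<close>, so
  \<open>A (A - e\<^sup>2)\<close> is positive and the residual iteration for \<open>A x = 0\<close> moves a vector orthogonal to the
  kernel by at most a multiple of \<open>nrm (A f)\<close>, towards a kernel vector.\<close>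

lemma isolated_imp_bounded_below_on_orth_ker:
  assumes T: "symop T" "bound_op T L" and e: "e > 0"
    and below: "\<And>\<theta>. 0 < \<bar>\<theta>\<bar> \<Longrightarrow> \<bar>\<theta>\<bar> < e \<Longrightarrow> bounded_below_on H (shift T \<theta>)"
  shows "bounded_below_on (orth (ker T)) T"
proof -
  define A where "A x = T (T x)" for x
  have A: "symop A" "bound_op A (L * L)"
    unfolding A_def using T by (auto intro: symop_square bound_op_square)
  have ip_A: "ip (A x) x = (nrm (T x))\<^sup>2" if "x \<in> H" for x
    using ip_square[OF T(1) that] by (simp add: A_def)
  have A_psd: "psd_on H A" using ip_A by (simp add: psd_on_def)
  have range: "e\<^sup>2 * (nrm (A x - 0))\<^sup>2 \<le> ip (A (A x - 0)) (A x - 0)" if "x \<in> H" for x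
    using nrm_square_ge_of_isolated[OF T e below, of "T x"] ip_A[of "A x"] T(1) that by (simp add: A_def)
  have "e\<^sup>2 / (2 * L) * nrm f \<le> nrm (T f)" if f: "f \<in> orth (ker T)" for f
  proof -
    have fH: "f \<in> H" using f by (rule orthD)
    have "\<exists>x\<in>H. nrm (A x - 0) = 0 \<and> e\<^sup>2 * nrm (f - x) \<le> 2 * nrm (A f - 0) \<and>
        (\<forall>z\<in>H. (\<forall>y\<in>H. ip (A y - 0) z = 0) \<longrightarrow> ip x z = ip f z)"
      using range e by (intro residual_iteration[OF A A_psd H_closed(1) fH]) auto
    then obtain x where x: "x \<in> H" "nrm (A x) = 0" "e\<^sup>2 * nrm (f - x) \<le> 2 * nrm (A f)"
      "\<forall>z\<in>H. (\<forall>y\<in>H. ip (A y) z = 0) \<longrightarrow> ip x z = ip f z"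
      unfolding diff_zero by (elim bexE conjE)
    have "(nrm (T x))\<^sup>2 = 0" using ip_A[OF x(1)] ip_null[OF _ x(2) x(1)] A(1) x(1) by simp
    then have "x \<in> ker T" using x(1) by (simp add: ker_def)
    have "ip (A y) x = 0" if "y \<in> H" for y
      using kerD(2)[OF \<open>x \<in> ker T\<close> T(1), of "T y"] symopD[OF T(1), of "T y" x] ip_sym[of "T x" "T y"]
        that T(1) x(1) by (simp add: A_def)
    then have "ip x x = ip f x" using x(1,4) by blast
    also have "\<dots> = 0" using f \<open>x \<in> ker T\<close> by (rule orthD)
    finally have "nrm x = 0" by (simp add: nrm_def)
    then have "e\<^sup>2 * nrm f \<le> e\<^sup>2 * nrm (f - x)"
      using nrm_le_diff[OF fH x(1)] by (intro mult_left_mono) auto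
    also have "\<dots> \<le> 2 * nrm (T (T f))" using x(3) by (simp add: A_def)
    also have "\<dots> \<le> 2 * (L * nrm (T f))" using bound_opD[OF T(2), of "T f"] T(1) fH by simp
    finally show ?thesis using bound_op_pos[OF T(2)] by (simp add: field_simps)
  qed
  moreover have "0 < e\<^sup>2 / (2 * L)" using e bound_op_pos[OF T(2)] by simp
  ultimately show ?thesis unfolding bounded_below_on_def by blast
qed

lemma not_ess_spec_imp_ess_bounded_below:
  assumes P: "symop P" "bound_op P L" and l: "l \<notin> ess_spec P"
  shows "ess_bounded_below (shift P l)"
proof (cases "l \<in> spec P")
  case False
  then have "bounded_below_on (orth {}) (shift P l)" using spec_iff_not_bounded_below[OF P] by simp
  then show ?thesis unfolding ess_bounded_below_def by blast
next
  case True
  with l obtain e where e: "e > 0" "\<And>m. m \<in> spec P \<Longrightarrow> \<bar>m - l\<bar> < e \<Longrightarrow> m = l"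
    and "fin_dim (ker (shift P l))" by (auto simp: ess_spec_def discrete_spec_def)
  then obtain B where B: "finite B" "B \<subseteq> H"
    "\<And>f. f \<in> ker (shift P l) \<Longrightarrow> \<exists>c. nrm (f - (\<Sum>b\<in>B. c b *\<^sub>R b)) = 0" by (auto simp: fin_dim_def)
  have "bounded_below_on (orth (ker (shift P l))) (shift P l)"
  proof (rule isolated_imp_bounded_below_on_orth_ker[OF symop_shift[OF P(1)] bound_op_shift[OF P] e(1)])
    show "bounded_below_on H (shift (shift P l) \<theta>)" if "0 < \<bar>\<theta>\<bar>" "\<bar>\<theta>\<bar> < e" for \<theta>
      using e(2)[of "l + \<theta>"] that spec_iff_not_bounded_below[OF P] by (auto simp: shift_shift)
  qed
  moreover have "orth B \<subseteq> orth (ker (shift P l))"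
  proof
    fix f assume f: "f \<in> orth B"
    have "ip f g = 0" if g: "g \<in> ker (shift P l)" for g
    proof -
      obtain c where c: "nrm (g - (\<Sum>b\<in>B. c b *\<^sub>R b)) = 0" using B(3)[OF g] by blast
      have p: "(\<Sum>b\<in>B. c b *\<^sub>R b) \<in> span B" by (intro span_sum span_scale span_base)
      then have "(\<Sum>b\<in>B. c b *\<^sub>R b) \<in> H" using span_subset_H[OF B(2)] by blast
      then show ?thesis
        using ip_eq_of_null_diff[OF kerD(1)[OF g] _ orthD(1)[OF f] c] ip_orth_span[OF B(2) f p]
          orthD(1)[OF f] kerD(1)[OF g] by (simp add: ip_sym)
    qed
    then show "f \<in> orth (ker (shift P l))" using f by (simp add: orth_def)
  qed
  ultimately have "bounded_below_on (orth B) (shift P l)" by (rule bounded_below_on_mono)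
  then show ?thesis using B(1,2) unfolding ess_bounded_below_def by blast
qed

lemma ess_bounded_below_imp_not_ess_spec:
  assumes P: "symop P" "bound_op P L" and "ess_bounded_below (shift P l)"
  shows "l \<notin> ess_spec P"
proof (cases "l \<in> spec P")
  case True
  let ?T = "shift P l"
  have T: "symop ?T" "bound_op ?T (L + \<bar>l\<bar>)" using P by (simp_all add: symop_shift bound_op_shift)
  obtain U where U: "finite U" "U \<subseteq> ker ?T" "bounded_below_on (orth U) ?T"
    using ess_bounded_below_imp_kernel_bound[OF T assms(3)] .
  then obtain c where c: "c > 0" "\<And>x. x \<in> orth U \<Longrightarrow> c * nrm x \<le> nrm (?T x)"
    by (auto simp: bounded_below_on_def)
  have UH: "U \<subseteq> H" using U(2) kerD(1) by blast
  have "m = l" if "m \<in> spec P" "\<bar>m - l\<bar> < c" for m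
    using bounded_below_shift_of_kernel[OF T(1) U(1,2) c(2), of "m - l"] that
      spec_iff_not_bounded_below[OF P]
    by (auto simp: shift_shift)
  moreover have "fin_dim (ker ?T)"
  proof (rule fin_dim_if_null_complement[OF U(1) UH])
    fix x p assume "x \<in> ker ?T" "p \<in> span U" "x - p \<in> orth U"
    then have "x - p \<in> ker ?T"
      using span_minimal[OF U(2) subspace_ker[OF T(1)]] subspace_diff[OF subspace_ker[OF T(1)]] by blast
    then have "c * nrm (x - p) \<le> 0" using c(2)[OF \<open>x - p \<in> orth U\<close>] by (simp add: ker_def)
    then show "nrm (x - p) = 0"
      using c(1) nrm_nonneg[OF orthD(1)[OF \<open>x - p \<in> orth U\<close>]] by (simp add: mult_le_0_iff)
  qed (use kerD(1) in blast)
  moreover have "\<exists>f\<in>ker ?T. nrm f \<noteq> 0"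
  proof (rule ccontr)
    assume "\<not> ?thesis"
    then have "H \<subseteq> orth U" using U(2) ip_null ip_sym UH by (auto simp: orth_def) (metis subsetD)
    then have "bounded_below_on H ?T" using U(3) by (rule bounded_below_on_mono[rotated])
    then show False using True spec_iff_not_bounded_below[OF P] by blast
  qed
  ultimately show ?thesis using c(1) by (auto simp: ess_spec_def discrete_spec_def)
qed (simp add: ess_spec_def)

theorem Weyl_criterion:
  assumes "symop P" "bound_op P L"
  shows "l \<in> ess_spec P \<longleftrightarrow> \<not> ess_bounded_below (shift P l)"
  using not_ess_spec_imp_ess_bounded_below[OF assms] ess_bounded_below_imp_not_ess_spec[OF assms]
  by blast

lemma ess_coercive_imp_ess_spec_ge:
  assumes P: "symop P" "bound_op P L" and "ess_coercive (shift P l)"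
  obtains \<delta> where "\<delta> > 0" "\<And>m. m \<in> ess_spec P \<Longrightarrow> l + \<delta> \<le> m"
proof -
  obtain K \<delta> where K: "finite K" "K \<subseteq> H" and \<delta>: "\<delta> > 0"
    "\<And>f. f \<in> orth K \<Longrightarrow> \<delta> * (nrm f)\<^sup>2 \<le> ip (shift P l f) f"
    using assms(3) by (auto simp: ess_coercive_def coercive_on_def)
  have "l + \<delta> \<le> m" if m: "m \<in> ess_spec P" for m
  proof (rule ccontr)
    assume "\<not> l + \<delta> \<le> m"
    moreover have "(l + \<delta> - m) * (nrm f)\<^sup>2 \<le> ip (shift P m f) f" if f: "f \<in> orth K" for f
      using \<delta>(2)[OF f] orthD(1)[OF f] P(1) by (simp add: ip_shift nrm_power2 algebra_simps)
    ultimately have "coercive_on (orth K) (shift P m)"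
      unfolding coercive_on_def by (intro exI[of _ "l + \<delta> - m"]) simp
    then have "ess_bounded_below (shift P m)"
      unfolding ess_bounded_below_def
      using coercive_on_imp_bounded_below_on[OF symop_shift[OF P(1)] orth_subset_H] K by blast
    then show False using m Weyl_criterion[OF P] by blast
  qed
  then show ?thesis using that \<delta>(1) by blast
qed

definition ess_form_bounds :: "('v \<Rightarrow> 'v) \<Rightarrow> real set" where
  "ess_form_bounds P = {l. \<exists>K. finite K \<and> K \<subseteq> H \<and> (\<forall>f\<in>orth K. l * (nrm f)\<^sup>2 \<le> ip (P f) f)}"

lemma ess_form_bounds_nonempty:
  assumes P: "symop P" "bound_op P L"
  shows "ess_form_bounds P \<noteq> {}"
proof -
  have "- L * (nrm f)\<^sup>2 \<le> ip (P f) f" if "f \<in> H" for f using form_bound[OF P that] by simp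
  then have "- L \<in> ess_form_bounds P"
    unfolding ess_form_bounds_def by (intro CollectI exI[of _ "{}"]) simp
  then show ?thesis by blast
qed

lemma ess_form_bounds_bdd_above:
  assumes P: "symop P" "bound_op P L" and inf: "\<not> fin_dim H"
  shows "bdd_above (ess_form_bounds P)"
proof (rule bdd_aboveI)
  fix l assume "l \<in> ess_form_bounds P"
  then obtain K where K: "finite K" "K \<subseteq> H" "\<And>f. f \<in> orth K \<Longrightarrow> l * (nrm f)\<^sup>2 \<le> ip (P f) f"
    by (auto simp: ess_form_bounds_def)
  obtain f where f: "f \<in> orth K" "nrm f \<noteq> 0" using infinite_dim_orth[OF inf K(1,2)] .
  have "l * (nrm f)\<^sup>2 \<le> L * (nrm f)\<^sup>2" using K(3)[OF f(1)] form_bound[OF P orthD(1)[OF f(1)]] by simp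
  then show "l \<le> L" using f(2) by (simp add: mult_le_cancel_right_pos)
qed

text \<open>On the orthogonal complement of \<open>K \<union> P ` K\<close> the shifted operator maps into the orthogonal
  complement of \<open>K\<close>, where it is positive.\<close>

lemma approximate_ess_form_minimizer:
  assumes P: "symop P" "bound_op P L" and bdd: "bdd_above (ess_form_bounds P)"
    and K': "finite K'" "K' \<subseteq> H" and \<eta>: "0 < \<eta>" "\<eta> \<le> 1"
  defines "s \<equiv> Sup (ess_form_bounds P)"
  shows "\<exists>f\<in>orth K'. nrm f \<noteq> 0 \<and> (nrm (shift P (s - \<eta>) f))\<^sup>2 \<le> 2 * \<eta> * (L + \<bar>s\<bar> + 1) * (nrm f)\<^sup>2"
proof -
  let ?A = "shift P (s - \<eta>)"
  obtain l where "l \<in> ess_form_bounds P" "s - \<eta> < l"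
    using less_cSupE[of "s - \<eta>" "ess_form_bounds P"] \<eta>(1) ess_form_bounds_nonempty[OF P]
    by (auto simp: s_def)
  then obtain K where K: "finite K" "K \<subseteq> H" "\<And>f. f \<in> orth K \<Longrightarrow> l * (nrm f)\<^sup>2 \<le> ip (P f) f"
    by (auto simp: ess_form_bounds_def)
  have A: "symop ?A" using P(1) by (rule symop_shift)
  have "bound_op ?A (L + \<bar>s - \<eta>\<bar>)" using P by (rule bound_op_shift)
  then have A_bound: "bound_op ?A (L + \<bar>s\<bar> + 1)" by (rule bound_op_mono) (use \<eta> in linarith)
  have A_psd: "psd_on (orth K) ?A"
    unfolding psd_on_def
  proof
    fix f assume f: "f \<in> orth K"
    have "(s - \<eta>) * (nrm f)\<^sup>2 \<le> l * (nrm f)\<^sup>2" using \<open>s - \<eta> < l\<close> by (intro mult_right_mono) auto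
    then show "0 \<le> ip (?A f) f"
      using K(3)[OF f] orthD(1)[OF f] P(1) by (simp add: ip_shift nrm_power2)
  qed
  have "s + \<eta> \<notin> ess_form_bounds P" using cSup_upper[OF _ bdd, of "s + \<eta>"] \<eta>(1) by (auto simp: s_def)
  moreover have "s + \<eta> \<in> ess_form_bounds P"
    if "\<forall>f\<in>orth (K \<union> P ` K \<union> K'). (s + \<eta>) * (nrm f)\<^sup>2 \<le> ip (P f) f"
    unfolding ess_form_bounds_def using that K(1,2) K' P(1)
    by (intro CollectI exI[of _ "K \<union> P ` K \<union> K'"]) auto
  ultimately have "\<not> (\<forall>f\<in>orth (K \<union> P ` K \<union> K'). (s + \<eta>) * (nrm f)\<^sup>2 \<le> ip (P f) f)" by blast
  then obtain f where f: "f \<in> orth (K \<union> P ` K \<union> K')" "ip (P f) f < (s + \<eta>) * (nrm f)\<^sup>2"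
    by (auto simp: not_le)
  have fH: "f \<in> H" and fK: "f \<in> orth K" and fK': "f \<in> orth K'" using f(1) by (auto simp: orth_def)
  have "nrm f \<noteq> 0" using f(2) form_bound[OF P fH] by auto
  have "ip (?A f) k = 0" if k: "k \<in> K" for k
    using k K(2) f(1) fH P(1) by (auto simp: orth_def ip_shift symopD)
  then have "?A f \<in> orth K" using A fH by (simp add: orth_def)
  then have "(nrm (?A f))\<^sup>2 \<le> (L + \<bar>s\<bar> + 1) * ip (?A f) f"
    using fK K(2) orth_subset_H by (intro psd_nrm_bound[OF A A_bound subspace_orth _ A_psd])
  also have "\<dots> \<le> (L + \<bar>s\<bar> + 1) * (2 * \<eta> * (nrm f)\<^sup>2)"
    using f(2) fH P(1) bound_op_pos[OF A_bound]
    by (intro mult_left_mono) (auto simp: ip_shift nrm_power2 algebra_simps)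
  also have "\<dots> = 2 * \<eta> * (L + \<bar>s\<bar> + 1) * (nrm f)\<^sup>2" by (simp only: mult_ac)
  finally show ?thesis using fK' \<open>nrm f \<noteq> 0\<close> by blast
qed

lemma ess_spec_nonempty:
  assumes P: "symop P" "bound_op P L" and inf: "\<not> fin_dim H"
  shows "ess_spec P \<noteq> {}"
proof -
  define s where "s = Sup (ess_form_bounds P)"
  have "\<not> ess_bounded_below (shift P s)"
  proof
    assume "ess_bounded_below (shift P s)"
    then obtain K' c where K': "finite K'" "K' \<subseteq> H"
      and c: "c > 0" "\<And>f. f \<in> orth K' \<Longrightarrow> c * nrm f \<le> nrm (shift P s f)"
      by (auto simp: ess_bounded_below_def bounded_below_on_def)
    define M where "M = L + \<bar>s\<bar> + 1"
    have M: "M > 0" using bound_op_pos[OF P(2)] by (simp add: M_def)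
    define \<eta> where "\<eta> = min (min 1 (c / 2)) (c\<^sup>2 / (16 * M))"
    have \<eta>: "0 < \<eta>" "\<eta> \<le> 1" "\<eta> \<le> c / 2" "\<eta> \<le> c\<^sup>2 / (16 * M)" using M c(1) by (auto simp: \<eta>_def)
    obtain f where f: "f \<in> orth K'" "nrm f \<noteq> 0" "(nrm (shift P (s - \<eta>) f))\<^sup>2 \<le> 2 * \<eta> * M * (nrm f)\<^sup>2"
      using approximate_ess_form_minimizer[OF P ess_form_bounds_bdd_above[OF P inf] K' \<eta>(1,2)]
      by (auto simp: s_def M_def)
    have fH: "f \<in> H" using f(1) by (rule orthD)
    have "shift P s f = shift P (s - \<eta>) f - \<eta> *\<^sub>R f" by (simp add: shift_def algebra_simps)
    then have "nrm (shift P s f) \<le> nrm (shift P (s - \<eta>) f) + \<eta> * nrm f"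
      using nrm_triangle_diff[of "shift P (s - \<eta>) f" "\<eta> *\<^sub>R f"] symop_shift[OF P(1)] fH \<eta>(1)
      by (simp add: nrm_scale)
    moreover have "\<eta> * nrm f \<le> c / 2 * nrm f" using \<eta>(3) fH by (intro mult_right_mono) auto
    ultimately have "c / 2 * nrm f \<le> nrm (shift P (s - \<eta>) f)" using c(2)[OF f(1)] by simp
    then have "(c / 2 * nrm f)\<^sup>2 \<le> (nrm (shift P (s - \<eta>) f))\<^sup>2" using c(1) fH by (intro power_mono) auto
    also have "\<dots> \<le> 2 * \<eta> * M * (nrm f)\<^sup>2" by (rule f(3))
    finally have "(c / 2)\<^sup>2 * (nrm f)\<^sup>2 \<le> (2 * \<eta> * M) * (nrm f)\<^sup>2" by (simp only: power_mult_distrib)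
    then have "(c / 2)\<^sup>2 \<le> 2 * \<eta> * M" using f(2) by (simp add: mult_le_cancel_right)
    also have "2 * \<eta> * M \<le> c\<^sup>2 / 8" using \<eta>(4) M by (simp add: field_simps)
    finally have "c\<^sup>2 / 4 \<le> c\<^sup>2 / 8" by (simp add: power_divide)
    then show False using c(1) by simp
  qed
  then show ?thesis using Weyl_criterion[OF P] by blast
qed

theorem Inf_ess_spec_gt_iff:
  assumes P: "symop P" "bound_op P L" and psd: "psd_on H (shift P l)" and inf: "\<not> fin_dim H"
  shows "l < Inf (ess_spec P) \<longleftrightarrow> ess_coercive (shift P l)"
proof
  assume "ess_coercive (shift P l)"
  then obtain \<delta> where \<delta>: "\<delta> > 0" "\<And>m. m \<in> ess_spec P \<Longrightarrow> l + \<delta> \<le> m"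
    using ess_coercive_imp_ess_spec_ge[OF P] by blast
  have "l + \<delta> \<le> Inf (ess_spec P)" using ess_spec_nonempty[OF P inf] \<delta>(2) by (rule cInf_greatest)
  then show "l < Inf (ess_spec P)" using \<delta>(1) by simp
next
  assume less: "l < Inf (ess_spec P)"
  have "l \<le> m" if m: "m \<in> ess_spec P" for m
  proof (rule ccontr)
    assume "\<not> l \<le> m"
    have "(l - m) * (nrm f)\<^sup>2 \<le> ip (shift P m f) f" if "f \<in> H" for f
      using psd that P(1)
      by (auto simp: psd_on_def ip_shift nrm_power2 algebra_simps dest!: bspec[of _ _ f])
    then have "coercive_on (orth {}) (shift P m)"
      using \<open>\<not> l \<le> m\<close> unfolding coercive_on_def by (intro exI[of _ "l - m"]) simp
    then have "ess_bounded_below (shift P m)"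
      using coercive_on_imp_bounded_below_on[OF symop_shift[OF P(1)] orth_subset_H]
      unfolding ess_bounded_below_def by blast
    then show False using m Weyl_criterion[OF P] by blast
  qed
  then have "bdd_below (ess_spec P)" by (rule bdd_belowI)
  then have "l \<notin> ess_spec P" using less cInf_lower[of l "ess_spec P"] by auto
  then have "ess_bounded_below (shift P l)" using Weyl_criterion[OF P] by blast
  then show "ess_coercive (shift P l)"
    using psd_bounded_below_on_imp_coercive_on
      [OF symop_shift[OF P(1)] bound_op_shift[OF P] psd orth_subset_H]
    unfolding ess_bounded_below_def ess_coercive_def by blast
qed

end

section \<open>The space of square integrable functions\<close>

lemma L2D: "f \<in> L2 M \<Longrightarrow> f \<in> borel_measurable M" "f \<in> L2 M \<Longrightarrow> integrable M (\<lambda>x. (f x)\<^sup>2)"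
  by (auto simp: L2_def)

lemma L2_integrable_mult:
  assumes "f \<in> L2 M" "g \<in> L2 M"
  shows "integrable M (\<lambda>x. f x * g x)"
proof (rule Bochner_Integration.integrable_bound)
  show "integrable M (\<lambda>x. (f x)\<^sup>2 + (g x)\<^sup>2)" using assms by (auto simp: L2_def)
  show "(\<lambda>x. f x * g x) \<in> borel_measurable M" using assms by (auto simp: L2_def)
  have "\<bar>a * b\<bar> \<le> a\<^sup>2 + b\<^sup>2" for a b :: real
  proof -
    have "2 * (\<bar>a\<bar> * \<bar>b\<bar>) \<le> a\<^sup>2 + b\<^sup>2" using sum_squares_bound[of "\<bar>a\<bar>" "\<bar>b\<bar>"] by (simp add: mult.assoc)
    moreover have "0 \<le> \<bar>a\<bar> * \<bar>b\<bar>" by simp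
    ultimately show ?thesis unfolding abs_mult by linarith
  qed
  then show "AE x in M. norm (f x * g x) \<le> norm ((f x)\<^sup>2 + (g x)\<^sup>2)" by (simp add: abs_of_nonneg)
qed

lemma L2_dominated:
  assumes f: "f \<in> L2 M" and [measurable]: "g \<in> borel_measurable M"
    and le: "\<And>x. x \<in> space M \<Longrightarrow> \<bar>g x\<bar> \<le> \<bar>f x\<bar>"
  shows "g \<in> L2 M"
proof -
  have "integrable M (\<lambda>x. (g x)\<^sup>2)"
  proof (rule Bochner_Integration.integrable_bound[OF L2D(2)[OF f]])
    show "AE x in M. norm ((g x)\<^sup>2) \<le> norm ((f x)\<^sup>2)"
      using le by (intro AE_I2) (simp add: abs_le_square_iff)
  qed simp
  then show ?thesis by (simp add: L2_def)
qed

lemma subspace_L2: "subspace (L2 M)"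
  unfolding subspace_def
proof (intro conjI ballI allI)
  show "0 \<in> L2 M" by (simp add: L2_def zero_fun_def)
  fix f g :: "'a \<Rightarrow> real" and c :: real assume f: "f \<in> L2 M"
  then show "c *\<^sub>R f \<in> L2 M" by (auto simp: L2_def scaleR_fun_def power_mult_distrib)
  assume g: "g \<in> L2 M"
  have "integrable M (\<lambda>x. (f x)\<^sup>2 + 2 * (f x * g x) + (g x)\<^sup>2)"
    using L2_integrable_mult[OF f g] L2D[OF f] L2D[OF g] by auto
  then have "integrable M (\<lambda>x. (f x + g x)\<^sup>2)" by (simp add: power2_sum algebra_simps)
  then show "f + g \<in> L2 M" using f g by (auto simp: L2_def plus_fun_def)
qed

lemma semi_inner_space_L2: "semi_inner_space (L2 M) (L2_inner M)"
proof
  fix f g h :: "'a \<Rightarrow> real" and c :: real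
  show "subspace (L2 M)" by (rule subspace_L2)
  show "L2_inner M f g = L2_inner M g f" by (simp add: L2_inner_def mult.commute)
  show "0 \<le> L2_inner M f f" by (simp add: L2_inner_def)
  assume f: "f \<in> L2 M" and h: "h \<in> L2 M"
  show "L2_inner M (c *\<^sub>R f) h = c * L2_inner M f h" by (simp add: L2_inner_def mult.assoc)
  assume g: "g \<in> L2 M"
  show "L2_inner M (f + g) h = L2_inner M f h + L2_inner M g h"
    using L2_integrable_mult[OF f h] L2_integrable_mult[OF g h] by (simp add: L2_inner_def distrib_right)
qed

locale L2_space =
  fixes M :: "'a measure"

sublocale L2_space \<subseteq> semi_inner_space "L2 M" "L2_inner M"
  by (rule semi_inner_space_L2)

context L2_space
begin

lemma nrm_power2_eq_integral: "f \<in> L2 M \<Longrightarrow> (nrm f)\<^sup>2 = (\<integral>x. (f x)\<^sup>2 \<partial>M)"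
  using nrm_power2[of f] by (simp add: L2_inner_def power2_eq_square)

lemma nn_integral_power2_eq_nrm:
  assumes "f \<in> L2 M"
  shows "(\<integral>\<^sup>+x. ennreal ((f x)\<^sup>2) \<partial>M) = ennreal ((nrm f)\<^sup>2)"
  using L2D(2)[OF assms] nrm_power2_eq_integral[OF assms] by (simp add: nn_integral_eq_integral)

lemma abs_L2: "f \<in> L2 M \<Longrightarrow> (\<lambda>x. \<bar>f x\<bar>) \<in> L2 M"
  by (auto simp: L2_def)

lemma nrm_abs: "nrm (\<lambda>x. \<bar>f x\<bar>) = nrm f"
  by (simp add: nrm_def L2_inner_def)

lemma L2_I_of_nn_integral_bound:
  assumes "f \<in> borel_measurable M" "(\<integral>\<^sup>+x. ennreal ((f x)\<^sup>2) \<partial>M) \<le> ennreal (c\<^sup>2)" "0 \<le> c"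
  shows "f \<in> L2 M" "nrm f \<le> c"
proof -
  have "integrable M (\<lambda>x. (f x)\<^sup>2)"
    using assms(1,2) by (intro integrableI_nonneg) (auto simp: top_unique less_top[symmetric])
  then show f: "f \<in> L2 M" using assms(1) by (simp add: L2_def)
  have "ennreal ((nrm f)\<^sup>2) \<le> ennreal (c\<^sup>2)" using assms(2) by (simp add: nn_integral_power2_eq_nrm[OF f])
  then have "(nrm f)\<^sup>2 \<le> c\<^sup>2" by simp
  then show "nrm f \<le> c" using assms(3) by (rule power2_le_imp_le)
qed

text \<open>By the triangle inequality the partial sums of the series of absolute values are bounded in
  norm, so monotone convergence makes their limit finite almost everywhere.\<close>

lemma AE_summable_abs_of_summable_nrm:
  assumes D: "\<And>n::nat. D n \<in> L2 M" and summable: "summable (\<lambda>n. nrm (D n))"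
  shows "AE x in M. summable (\<lambda>n. \<bar>D n x\<bar>)"
proof -
  define s where "s N = (\<Sum>n<N. (\<lambda>x. \<bar>D n x\<bar>))" for N
  define C where "C = (\<Sum>n. nrm (D n))"
  have s_apply: "s N x = (\<Sum>n<N. \<bar>D n x\<bar>)" for N x by (simp add: s_def sum_fun_apply)
  have s_L2: "s N \<in> L2 M" for N using D unfolding s_def by (intro H_sum abs_L2)
  have [measurable]: "s N \<in> borel_measurable M" for N using s_L2 by (rule L2D)
  have s_nonneg: "0 \<le> s N x" for N x by (simp add: s_apply sum_nonneg)
  have s_mono: "s N x \<le> s (Suc N) x" for N x by (simp add: s_apply)
  have s_bound: "(\<integral>\<^sup>+x. ennreal ((s N x)\<^sup>2) \<partial>M) \<le> ennreal (C\<^sup>2)" for N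
  proof -
    have "nrm (s N) \<le> (\<Sum>n<N. nrm (D n))"
      unfolding s_def using D nrm_sum_le[of "{..<N}" "\<lambda>n x. \<bar>D n x\<bar>"] by (simp add: abs_L2 nrm_abs)
    also have "\<dots> \<le> C" unfolding C_def using D by (intro sum_le_suminf summable) auto
    finally have "(nrm (s N))\<^sup>2 \<le> C\<^sup>2" using s_L2 by (intro power_mono) auto
    then show ?thesis by (simp add: nn_integral_power2_eq_nrm[OF s_L2] ennreal_leI)
  qed
  have "(\<integral>\<^sup>+x. (SUP N. ennreal ((s N x)\<^sup>2)) \<partial>M) = (SUP N. \<integral>\<^sup>+x. ennreal ((s N x)\<^sup>2) \<partial>M)"
    using s_mono s_nonneg
    by (intro nn_integral_monotone_convergence_SUP)
      (auto intro!: incseq_SucI le_funI ennreal_leI power_mono)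
  also have "\<dots> \<le> ennreal (C\<^sup>2)" by (intro SUP_least s_bound)
  finally have "(\<integral>\<^sup>+x. (SUP N. ennreal ((s N x)\<^sup>2)) \<partial>M) \<noteq> \<infinity>" by (auto simp: top_unique)
  then have "AE x in M. (SUP N. ennreal ((s N x)\<^sup>2)) \<noteq> \<infinity>"
    by (intro nn_integral_PInf_AE) simp_all
  then show ?thesis
  proof eventually_elim
    case (elim x)
    then obtain B where B: "0 \<le> B" "(SUP N. ennreal ((s N x)\<^sup>2)) = ennreal B"
      by (cases "SUP N. ennreal ((s N x)\<^sup>2)") auto
    show ?case
    proof (rule summableI_nonneg_bounded)
      fix N
      have "ennreal ((s N x)\<^sup>2) \<le> ennreal B" unfolding B(2)[symmetric] by (rule SUP_upper) simp
      then have "(s N x)\<^sup>2 \<le> B" using B(1) by simp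
      then show "(\<Sum>n<N. \<bar>D n x\<bar>) \<le> sqrt B" unfolding s_apply[symmetric] by (rule real_le_rsqrt)
    qed simp
  qed
qed

lemma AE_convergent_of_summable_nrm:
  assumes X: "\<And>n::nat. X n \<in> L2 M" and summable: "summable (\<lambda>n. nrm (X (Suc n) - X n))"
  obtains f where "f \<in> borel_measurable M" "AE x in M. (\<lambda>n. X n x) \<longlonglongrightarrow> f x"
proof
  have [measurable]: "X n \<in> borel_measurable M" for n using X by (rule L2D)
  show "(\<lambda>x. lim (\<lambda>n. X n x)) \<in> borel_measurable M" by measurable
  have "AE x in M. summable (\<lambda>n. \<bar>(X (Suc n) - X n) x\<bar>)"
    using X summable by (intro AE_summable_abs_of_summable_nrm[of "\<lambda>n. X (Suc n) - X n"]) auto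
  then show "AE x in M. (\<lambda>n. X n x) \<longlonglongrightarrow> lim (\<lambda>n. X n x)"
  proof eventually_elim
    case (elim x)
    then have "summable (\<lambda>n. X (Suc n) x - X n x)" unfolding minus_apply by (rule summable_rabs_cancel)
    then have "convergent (\<lambda>n. \<Sum>i<n. X (Suc i) x - X i x)" by (rule summable_iff_convergent[THEN iffD1])
    moreover have "(\<Sum>i<n. X (Suc i) x - X i x) = X n x - X 0 x" for n by (rule sum_lessThan_telescope)
    ultimately have "convergent (\<lambda>n. X n x - X 0 x)" by simp
    then have "convergent (\<lambda>n. X n x)"
      using convergent_add_const_right_iff[of "\<lambda>n. X n x" "- X 0 x"] by simp
    then show ?case by (simp add: convergent_LIMSEQ_iff)
  qed
qed

lemma nrm_diff_le_of_AE_limit: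
  assumes X: "\<And>n::nat. X n \<in> L2 M" and g: "g \<in> L2 M" and f: "f \<in> borel_measurable M"
    and lim: "AE x in M. (\<lambda>k. X k x) \<longlonglongrightarrow> f x" and bound: "\<And>k. n \<le> k \<Longrightarrow> nrm (g - X k) \<le> t"
  shows "g - f \<in> L2 M" "nrm (g - f) \<le> t"
proof -
  have [measurable]: "X k \<in> borel_measurable M" "g \<in> borel_measurable M" "f \<in> borel_measurable M" for k
    using X g f by (auto dest: L2D)
  have "g - X n \<in> L2 M" using X g by simp
  from order_trans[OF nrm_nonneg[OF this] bound[OF order_refl]] have "0 \<le> t" .
  have "(\<integral>\<^sup>+x. ennreal ((g x - f x)\<^sup>2) \<partial>M) = (\<integral>\<^sup>+x. liminf (\<lambda>k. ennreal ((g x - X k x)\<^sup>2)) \<partial>M)"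
  proof (rule nn_integral_cong_AE)
    show "AE x in M. ennreal ((g x - f x)\<^sup>2) = liminf (\<lambda>k. ennreal ((g x - X k x)\<^sup>2))"
      using lim
    proof eventually_elim
      case (elim x)
      then have "(\<lambda>k. ennreal ((g x - X k x)\<^sup>2)) \<longlonglongrightarrow> ennreal ((g x - f x)\<^sup>2)" by (intro tendsto_intros)
      then show ?case by (metis lim_imp_Liminf sequentially_bot)
    qed
  qed
  also have "\<dots> \<le> liminf (\<lambda>k. \<integral>\<^sup>+x. ennreal ((g x - X k x)\<^sup>2) \<partial>M)" by (rule nn_integral_liminf) simp
  also have "\<dots> \<le> limsup (\<lambda>k. \<integral>\<^sup>+x. ennreal ((g x - X k x)\<^sup>2) \<partial>M)" by (rule Liminf_le_Limsup) simp
  also have "\<dots> \<le> ennreal (t\<^sup>2)"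
  proof (rule Limsup_bounded, rule eventually_sequentiallyI)
    fix k assume "n \<le> k"
    have gX: "g - X k \<in> L2 M" using X g by simp
    then have "(\<integral>\<^sup>+x. ennreal ((g x - X k x)\<^sup>2) \<partial>M) = ennreal ((nrm (g - X k))\<^sup>2)"
      using nn_integral_power2_eq_nrm[OF gX] by simp
    then show "(\<integral>\<^sup>+x. ennreal ((g x - X k x)\<^sup>2) \<partial>M) \<le> ennreal (t\<^sup>2)"
      using bound[OF \<open>n \<le> k\<close>] gX by (simp add: ennreal_leI power_mono)
  qed
  finally have "(\<integral>\<^sup>+x. ennreal (((g - f) x)\<^sup>2) \<partial>M) \<le> ennreal (t\<^sup>2)" by simp
  moreover have "g - f \<in> borel_measurable M" by (simp add: fun_diff_def)
  ultimately show "g - f \<in> L2 M" "nrm (g - f) \<le> t"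
    using L2_I_of_nn_integral_bound[of "g - f" t] \<open>0 \<le> t\<close> by simp_all
qed

lemma Riesz_Fischer:
  assumes X: "\<And>n::nat. X n \<in> L2 M" and summable: "summable (\<lambda>n. nrm (X (Suc n) - X n))"
  shows "\<exists>f\<in>L2 M. (\<lambda>n. nrm (X n - f)) \<longlonglongrightarrow> 0"
proof -
  define a where "a n = nrm (X (Suc n) - X n)" for n
  have a: "summable a" "0 \<le> a n" for n using summable X by (simp_all add: a_def[abs_def])
  obtain f where f: "f \<in> borel_measurable M" "AE x in M. (\<lambda>n. X n x) \<longlonglongrightarrow> f x"
    using AE_convergent_of_summable_nrm[OF X summable] .
  define t where "t n = suminf a - sum a {..<n}" for n
  have tail: "nrm (X n - X k) \<le> t n" if "n \<le> k" for n k
  proof -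
    have "nrm (X n - X k) \<le> sum a {n..<k}"
      unfolding a_def by (rule nrm_diff_le_sum_increments[OF X that])
    also have "\<dots> = sum a {..<k} - sum a {..<n}"
      using that by (simp add: sum_diff_nat_ivl lessThan_atLeast0)
    also have "\<dots> \<le> t n" using sum_le_suminf[OF a(1), of "{..<k}"] a(2) by (simp add: t_def)
    finally show ?thesis .
  qed
  have diff_L2: "X n - f \<in> L2 M" and dist: "nrm (X n - f) \<le> t n" for n
    using nrm_diff_le_of_AE_limit[OF X X f tail] by simp_all
  have "t \<longlonglongrightarrow> suminf a - suminf a"
    unfolding t_def by (intro tendsto_intros summable_LIMSEQ a)
  then have "t \<longlonglongrightarrow> 0" by simp
  then have "(\<lambda>n. nrm (X n - f)) \<longlonglongrightarrow> 0"
    by (rule Lim_null_comparison[rotated]) (use dist diff_L2 in simp)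
  moreover have "f \<in> L2 M" using H_closed(3)[OF X diff_L2, of 0 0] by simp
  ultimately show ?thesis by blast
qed

end

sublocale L2_space \<subseteq> semi_hilbert_space "L2 M" "L2_inner M"
  by standard (rule Riesz_Fischer)

context L2_space
begin

lemma nrm_zero_iff_AE:
  assumes "f \<in> L2 M"
  shows "nrm f = 0 \<longleftrightarrow> (AE x in M. f x = 0)"
proof -
  have "nrm f = 0 \<longleftrightarrow> (\<integral>x. (f x)\<^sup>2 \<partial>M) = 0" by (simp add: nrm_def L2_inner_def power2_eq_square)
  also have "\<dots> \<longleftrightarrow> (AE x in M. (f x)\<^sup>2 = 0)"
    using L2D[OF assms] by (intro integral_nonneg_eq_0_iff_AE) auto
  finally show ?thesis by simp
qed

lemma ip_cong:
  assumes "\<And>x. x \<in> space M \<Longrightarrow> f x = f' x" "\<And>x. x \<in> space M \<Longrightarrow> g x = g' x"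
  shows "L2_inner M f g = L2_inner M f' g'"
  unfolding L2_inner_def using assms by (intro Bochner_Integration.integral_cong) auto

lemma L2_fin_dim_eq:
  assumes "E \<subseteq> L2 M"
  shows "L2_fin_dim M E \<longleftrightarrow> fin_dim E"
proof -
  have "(AE x in M. f x = (\<Sum>b\<in>B. c b * b x)) \<longleftrightarrow> nrm (f - (\<Sum>b\<in>B. c b *\<^sub>R b)) = 0"
    if "f \<in> E" "B \<subseteq> L2 M" for f B c
    using that assms by (subst nrm_zero_iff_AE) (auto simp: sum_fun_apply subset_iff)
  then have "(\<forall>f\<in>E. \<exists>c. AE x in M. f x = (\<Sum>b\<in>B. c b * b x)) \<longleftrightarrow>
      (\<forall>f\<in>E. \<exists>c. nrm (f - (\<Sum>b\<in>B. c b *\<^sub>R b)) = 0)" if "B \<subseteq> L2 M" for B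
    using that by simp
  then show ?thesis unfolding L2_fin_dim_def fin_dim_def by (intro ex_cong1 conj_cong refl) auto
qed

lemma L2_spectrum_eq:
  assumes P: "symop P"
  shows "L2_spectrum M P = spec P"
proof -
  have "(\<forall>f\<in>L2 M. (AE x in M. P f x - l * f x = 0) \<longrightarrow> (AE x in M. f x = 0)) \<longleftrightarrow>
      (\<forall>f\<in>L2 M. nrm (shift P l f) = 0 \<longrightarrow> nrm f = 0)" for l
  proof (intro ball_cong refl)
    fix f assume f: "f \<in> L2 M"
    have "nrm (shift P l f) = 0 \<longleftrightarrow> (AE x in M. P f x - l * f x = 0)"
      using nrm_zero_iff_AE[OF symop_closed[OF symop_shift[OF P] f, of l]] by (simp add: shift_def)
    then show "((AE x in M. P f x - l * f x = 0) \<longrightarrow> (AE x in M. f x = 0)) \<longleftrightarrow>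
        (nrm (shift P l f) = 0 \<longrightarrow> nrm f = 0)" using nrm_zero_iff_AE[OF f] by simp
  qed
  moreover have "(\<forall>g\<in>L2 M. \<exists>f\<in>L2 M. AE x in M. P f x - l * f x = g x) \<longleftrightarrow> surj_op (shift P l)" for l
  proof -
    have "nrm (shift P l f - g) = 0 \<longleftrightarrow> (AE x in M. P f x - l * f x = g x)"
      if "f \<in> L2 M" "g \<in> L2 M" for f g
      using nrm_zero_iff_AE[OF H_closed(3)[OF symop_closed[OF symop_shift[OF P] that(1), of l] that(2)]]
      by (simp add: shift_def)
    then show ?thesis by (auto simp: surj_op_def)
  qed
  ultimately show ?thesis by (simp add: L2_spectrum_def spec_def)
qed

lemma L2_eigenspace_eq:
  assumes P: "symop P"
  shows "L2_eigenspace M P l = ker (shift P l)"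
proof -
  have "nrm (shift P l f) = 0 \<longleftrightarrow> (AE x in M. P f x = l * f x)" if "f \<in> L2 M" for f
    using nrm_zero_iff_AE[OF symop_closed[OF symop_shift[OF P] that, of l]] by (simp add: shift_def)
  then show ?thesis by (auto simp: L2_eigenspace_def ker_def)
qed

lemma L2_ess_spectrum_eq:
  assumes P: "symop P"
  shows "L2_ess_spectrum M P = ess_spec P"
proof -
  have "(\<exists>f\<in>L2_eigenspace M P l. \<not> (AE x in M. f x = 0)) \<longleftrightarrow> (\<exists>f\<in>ker (shift P l). nrm f \<noteq> 0)" for l
    unfolding L2_eigenspace_eq[OF P] using nrm_zero_iff_AE kerD(1) by metis
  moreover have "L2_fin_dim M (L2_eigenspace M P l) \<longleftrightarrow> fin_dim (ker (shift P l))" for l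
    unfolding L2_eigenspace_eq[OF P] by (rule L2_fin_dim_eq) (auto simp: ker_def)
  ultimately show ?thesis
    unfolding L2_ess_spectrum_def L2_discrete_spectrum_def ess_spec_def discrete_spec_def
      L2_spectrum_eq[OF P] by simp
qed

lemma simple_dense:
  assumes f: "f \<in> L2 M"
  obtains s where "\<And>n. simple_function M (s n)" "\<And>n. s n \<in> L2 M" "nrm_converges s f"
proof -
  have fm [measurable]: "f \<in> borel_measurable M" using f by (rule L2D)
  obtain s where s: "\<And>i. simple_function M (s i)" "\<And>x. x \<in> space M \<Longrightarrow> (\<lambda>i. s i x) \<longlonglongrightarrow> f x"
    "\<And>i x. x \<in> space M \<Longrightarrow> dist (s i x) 0 \<le> 2 * dist (f x) 0"
    using borel_measurable_implies_sequence_metric[OF fm, of 0] by blast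
  have [measurable]: "s i \<in> borel_measurable M" for i
    using s(1) by (rule borel_measurable_simple_function)
  have s_L2: "s n \<in> L2 M" for n
  proof (rule L2_dominated)
    show "2 *\<^sub>R f \<in> L2 M" by (rule subspace_scale[OF subspace_L2 f])
    show "\<bar>s n x\<bar> \<le> \<bar>(2 *\<^sub>R f) x\<bar>" if "x \<in> space M" for x
      using s(3)[OF that, of n] by (simp add: dist_real_def)
  qed simp
  have "(\<lambda>n. \<integral>x. (s n x - f x)\<^sup>2 \<partial>M) \<longlonglongrightarrow> (\<integral>x. 0 \<partial>M)"
  proof (rule integral_dominated_convergence[where w = "\<lambda>x. 9 * (f x)\<^sup>2"])
    show "integrable M (\<lambda>x. 9 * (f x)\<^sup>2)" using L2D(2)[OF f] by simp
    show "AE x in M. (\<lambda>n. (s n x - f x)\<^sup>2) \<longlonglongrightarrow> 0"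
    proof (rule AE_I2)
      fix x assume "x \<in> space M"
      then have "(\<lambda>n. (s n x - f x)\<^sup>2) \<longlonglongrightarrow> (f x - f x)\<^sup>2" by (intro tendsto_intros s)
      then show "(\<lambda>n. (s n x - f x)\<^sup>2) \<longlonglongrightarrow> 0" by simp
    qed
    show "AE x in M. norm ((s n x - f x)\<^sup>2) \<le> 9 * (f x)\<^sup>2" for n
    proof (rule AE_I2)
      fix x assume "x \<in> space M"
      then have "\<bar>s n x - f x\<bar> \<le> \<bar>3 * f x\<bar>" using s(3)[of x n] by (simp add: dist_real_def)
      then have "(s n x - f x)\<^sup>2 \<le> (3 * f x)\<^sup>2" by (simp only: abs_le_square_iff)
      then show "norm ((s n x - f x)\<^sup>2) \<le> 9 * (f x)\<^sup>2" by (simp add: power_mult_distrib)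
    qed
  qed auto
  then have "(\<lambda>n. sqrt (\<integral>x. (s n x - f x)\<^sup>2 \<partial>M)) \<longlonglongrightarrow> sqrt 0"
    by (intro tendsto_real_sqrt) simp
  then have "(\<lambda>n. nrm (s n - f)) \<longlonglongrightarrow> 0"
    by (simp add: nrm_def L2_inner_def power2_eq_square fun_diff_def)
  then have "nrm_converges s f" using s_L2 f by (simp add: nrm_converges_def)
  then show ?thesis by (rule that[OF s(1) s_L2])
qed

end

lemma simple_function_bounded:
  fixes f :: "'a \<Rightarrow> real"
  assumes "simple_function M f"
  obtains C where "0 \<le> C" "\<And>x. x \<in> space M \<Longrightarrow> \<bar>f x\<bar> \<le> C"
proof -
  have "finite ((\<lambda>x. \<bar>f x\<bar>) ` space M)"
    using simple_functionD(1)[OF assms] finite_imageI[of "f ` space M" abs] by (simp add: image_image)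
  then show ?thesis
    by (intro that[of "max 0 (Max ((\<lambda>x. \<bar>f x\<bar>) ` space M))"]) (auto simp: le_max_iff_disj)
qed

lemma (in finite_measure) bounded_L2:
  assumes "f \<in> borel_measurable M" "\<And>x. x \<in> space M \<Longrightarrow> \<bar>f x\<bar> \<le> C"
  shows "f \<in> L2 M"
proof -
  have "(f x)\<^sup>2 \<le> C\<^sup>2" if "x \<in> space M" for x
    unfolding abs_le_square_iff[symmetric] using assms(2)[OF that] by linarith
  then have "integrable M (\<lambda>x. (f x)\<^sup>2)"
    using assms(1) by (intro integrable_const_bound[where B = "C\<^sup>2"]) auto
  then show ?thesis using assms(1) by (simp add: L2_def)
qed

lemma (in finite_measure) simple_L2:
  fixes f :: "'a \<Rightarrow> real"
  assumes "simple_function M f"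
  shows "f \<in> L2 M"
proof -
  obtain C where "\<And>x. x \<in> space M \<Longrightarrow> \<bar>f x\<bar> \<le> C" using simple_function_bounded[OF assms] by metis
  with borel_measurable_simple_function[OF assms] show ?thesis by (rule bounded_L2)
qed

lemma (in finite_measure) simple_comp_L2: "simple_function M F \<Longrightarrow> (\<lambda>x. \<phi> (F x) :: real) \<in> L2 M"
  by (rule simple_L2) (rule simple_function_compose1)

lemma (in finite_measure) indicator_L2 [simp]: "A \<in> sets M \<Longrightarrow> (indicator A :: 'a \<Rightarrow> real) \<in> L2 M"
  by (rule bounded_L2[where C = 1]) (auto simp: indicator_def)

subsection \<open>Partitions into sets of positive measure\<close>

lemma (in finite_measure) measure_pos_of_integral_zero:
  fixes h :: "'a \<Rightarrow> real"
  assumes h: "integrable M h" "(\<integral>x. h x \<partial>M) = 0" "\<not> (AE x in M. h x = 0)"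
  shows "0 < measure M {x \<in> space M. 0 < h x}"
proof (rule ccontr)
  have meas: "{x \<in> space M. 0 < h x} \<in> sets M" using h(1) by measurable
  assume "\<not> ?thesis"
  then have "measure M {x \<in> space M. 0 < h x} = 0"
    using measure_nonneg[of M] by (simp add: order_antisym not_less)
  then have "{x \<in> space M. 0 < h x} \<in> null_sets M"
    using meas by (simp add: null_sets_def emeasure_eq_measure)
  then have "AE x in M. x \<notin> {x \<in> space M. 0 < h x}" by (rule AE_not_in)
  then have nonneg: "AE x in M. 0 \<le> - h x" using AE_space by eventually_elim auto
  have "(\<integral>x. - h x \<partial>M) = 0" using h(2) by simp
  then have "AE x in M. - h x = 0"
    using integral_nonneg_eq_0_iff_AE[OF _ nonneg] h(1) by simp
  then show False using h(3) by simp
qed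

lemma (in finite_measure) split_positive_measure:
  assumes f: "f \<in> L2 M" and D: "D \<in> sets M"
    and "L2_inner M f (indicator D) = 0" "\<not> (AE x in M. f x * indicator D x = 0)"
  obtains U where "U \<in> sets M" "U \<subseteq> D" "0 < measure M U" "0 < measure M (D - U)"
proof -
  define h where "h x = f x * indicator D x" for x
  define U where "U = {x \<in> space M. 0 < h x}"
  have h: "integrable M h" "(\<integral>x. h x \<partial>M) = 0" "\<not> (AE x in M. h x = 0)"
    using L2_integrable_mult[OF f indicator_L2[OF D]] assms(3,4)
    by (simp_all add: h_def[abs_def] L2_inner_def)
  have "integrable M (\<lambda>x. - h x)" "(\<integral>x. - h x \<partial>M) = 0" "\<not> (AE x in M. - h x = 0)" using h by simp_all
  then have "0 < measure M {x \<in> space M. 0 < - h x}" by (rule measure_pos_of_integral_zero)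
  also have "\<dots> \<le> measure M (D - U)"
  proof (rule finite_measure_mono)
    show "{x \<in> space M. 0 < - h x} \<subseteq> D - U" by (auto simp: h_def U_def indicator_def split: if_splits)
    show "D - U \<in> sets M" using D h(1) unfolding U_def by measurable
  qed
  finally have "0 < measure M (D - U)" .
  moreover have "U \<in> sets M" using h(1) unfolding U_def by measurable
  moreover have "U \<subseteq> D" by (auto simp: U_def h_def indicator_def split: if_splits)
  moreover have "0 < measure M U" unfolding U_def using h by (rule measure_pos_of_integral_zero)
  ultimately show ?thesis using that by blast
qed

lemma splittable_cell:
  fixes D :: "nat \<Rightarrow> 'a set"
  assumes M: "finite_measure M" and inf: "\<not> L2_fin_dim M (L2 M)"
    and D: "\<And>i. i < k \<Longrightarrow> D i \<in> sets M" "(\<Union>i<k. D i) = space M"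
  shows "\<exists>i<k. \<exists>U\<in>sets M. U \<subseteq> D i \<and> 0 < measure M U \<and> 0 < measure M (D i - U)"
proof -
  interpret finite_measure M by (rule M)
  interpret L2_space M .
  have "(\<lambda>i. indicator (D i) :: 'a \<Rightarrow> real) ` {..<k} \<subseteq> L2 M" using D(1) by auto
  from infinite_dim_orth[OF _ _ this] obtain f
    where f: "f \<in> orth ((\<lambda>i. indicator (D i)) ` {..<k})" "nrm f \<noteq> 0"
    using inf L2_fin_dim_eq[OF order_refl] by blast
  have f_L2: "f \<in> L2 M" using f(1) by (rule orthD)
  have "\<exists>i<k. \<not> (AE x in M. f x * indicator (D i) x = 0)"
  proof (rule ccontr)
    assume "\<not> ?thesis"
    then have "AE x in M. \<forall>i\<in>{..<k}. f x * indicator (D i) x = 0" by (intro AE_finite_allI) auto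
    then have "AE x in M. f x = 0" using AE_space
    proof eventually_elim
      case (elim x)
      then obtain i where "i < k" "x \<in> D i" using D(2) by blast
      then show ?case using bspec[OF elim(1), of i] by simp
    qed
    then show False using f(2) nrm_zero_iff_AE[OF f_L2] by simp
  qed
  then obtain i where i: "i < k" "\<not> (AE x in M. f x * indicator (D i) x = 0)" by blast
  have "L2_inner M f (indicator (D i)) = 0" using f(1) i(1) by (intro orthD(2)) auto
  then obtain U where "U \<in> sets M" "U \<subseteq> D i" "0 < measure M U" "0 < measure M (D i - U)"
    using split_positive_measure[OF f_L2 D(1)[OF i(1)] _ i(2)] by blast
  then show ?thesis using i(1) by blast
qed

lemma disjoint_family_on_split:
  fixes k :: nat
  assumes D: "disjoint_family_on D {..<k}" and U: "i < k" "U \<subseteq> D i"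
  shows "disjoint_family_on (\<lambda>l. if l = k then D i - U else if l = i then U else D l) {..<Suc k}"
  unfolding disjoint_family_on_def
proof (intro ballI impI)
  have D_inter: "D l \<inter> D m = {}" if "l < k" "m < k" "l \<noteq> m" for l m
    using D that by (intro disjoint_family_onD) auto
  fix l m assume "l \<in> {..<Suc k}" "m \<in> {..<Suc k}" "l \<noteq> m"
  then show "(if l = k then D i - U else if l = i then U else D l) \<inter>
      (if m = k then D i - U else if m = i then U else D m) = {}"
    using D_inter[of l m] D_inter[of l i] D_inter[of m i] U
    by (auto simp: less_Suc_eq split: if_splits)
qed

lemma (in prob_space) infinite_dim_partition:
  fixes k :: nat
  assumes inf: "\<not> L2_fin_dim M (L2 M)" and "1 \<le> k"
  shows "\<exists>D. (\<forall>i<k. D i \<in> sets M \<and> 0 < measure M (D i)) \<and>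
    disjoint_family_on D {..<k} \<and> (\<Union>i<k. D i) = space M"
  using assms(2)
proof (induction k rule: nat_induct_at_least)
  case base
  show ?case by (intro exI[of _ "\<lambda>_. space M"]) (auto simp: disjoint_family_on_def prob_space)
next
  case (Suc k)
  then obtain D where D_pos: "\<forall>i<k. D i \<in> sets M \<and> 0 < measure M (D i)"
    and D_disjoint: "disjoint_family_on D {..<k}" and D_cover: "(\<Union>i<k. D i) = space M"
    by (elim exE conjE)
  have "\<exists>i<k. \<exists>U\<in>sets M. U \<subseteq> D i \<and> 0 < measure M U \<and> 0 < measure M (D i - U)"
    using D_pos by (intro splittable_cell[OF finite_measure_axioms inf _ D_cover]) auto
  then obtain i U where i: "i < k"
    and U: "U \<in> sets M" "U \<subseteq> D i" "0 < measure M U" "0 < measure M (D i - U)" by blast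
  define E where "E l = (if l = k then D i - U else if l = i then U else D l)" for l
  have "\<forall>l<Suc k. E l \<in> sets M \<and> 0 < measure M (E l)"
    using D_pos U i by (auto simp: E_def less_Suc_eq)
  moreover have "(\<Union>l<Suc k. E l) = space M"
    unfolding D_cover[symmetric] using i U(2) by (auto simp: E_def less_Suc_eq split: if_splits)
  moreover have "disjoint_family_on E {..<Suc k}"
    unfolding E_def by (rule disjoint_family_on_split[OF D_disjoint i U(2)])
  ultimately show ?case by blast
qed

section \<open>Reversible Markov operators\<close>

locale reversible_markov = prob_space M for M :: "'a measure" +
  fixes P :: "('a \<Rightarrow> real) \<Rightarrow> 'a \<Rightarrow> real"
  assumes markov: "markov_operator M P" and rev: "reversible M P"

sublocale reversible_markov \<subseteq> L2_space M .

context reversible_markov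
begin

lemma symop_P: "symop P"
  unfolding symop_def
proof (intro conjI ballI)
  fix f assume f: "f \<in> L2 M"
  then show "P f \<in> L2 M" using markov by (auto simp: markov_operator_def L2_operator_def)
  fix g assume g: "g \<in> L2 M"
  have "L2_inner M (P f) g = L2_inner M g (P f)" by (simp add: L2_inner_def mult.commute)
  also have "\<dots> = L2_inner M f (P g)" using rev f g by (simp add: reversible_def)
  finally show "L2_inner M (P f) g = L2_inner M f (P g)" .
qed

lemma P_L2 [simp]: "f \<in> L2 M \<Longrightarrow> P f \<in> L2 M"
  using symop_P by simp

lemma ip_P_cong:
  assumes "f \<in> L2 M" "g \<in> L2 M" "f' \<in> L2 M" "g' \<in> L2 M"
    and "\<And>x. x \<in> space M \<Longrightarrow> f x = f' x" "\<And>x. x \<in> space M \<Longrightarrow> g x = g' x"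
  shows "L2_inner M f (P g) = L2_inner M f' (P g')"
proof -
  have "L2_inner M f (P g) = L2_inner M f' (P g)" using assms by (intro ip_cong) auto
  also have "\<dots> = L2_inner M (P f') g" using assms by (simp add: symopD[OF symop_P])
  also have "\<dots> = L2_inner M (P f') g'" using assms by (intro ip_cong) auto
  also have "\<dots> = L2_inner M f' (P g')" using assms by (simp add: symopD[OF symop_P])
  finally show ?thesis .
qed

lemma ip_P_nonneg:
  assumes "f \<in> L2 M" "g \<in> L2 M" "\<And>x. 0 \<le> f x" "\<And>x. 0 \<le> g x"
  shows "0 \<le> L2_inner M f (P g)"
proof -
  have "AE x in M. 0 \<le> P g x" using markov assms by (simp add: markov_operator_def)
  then have "AE x in M. 0 \<le> f x * P g x" using assms(3) by (auto elim!: eventually_mono)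
  then show ?thesis unfolding L2_inner_def by (rule integral_nonneg_AE)
qed

subsection \<open>The transition weights of a simple function\<close>

definition cell :: "('a \<Rightarrow> 'b) \<Rightarrow> 'b \<Rightarrow> 'a \<Rightarrow> real" where
  "cell F u = indicator (F -` {u} \<inter> space M)"

text \<open>\<open>kernel_sum F \<Phi>\<close> plays the role of the integral of \<open>\<Phi> (F x) (F y)\<close> against
  \<open>\<mu>(dx) P(x, dy)\<close>; for a simple \<open>F\<close> it makes sense although \<open>P\<close> need not have a kernel.\<close>

definition kernel_sum :: "('a \<Rightarrow> 'b) \<Rightarrow> ('b \<Rightarrow> 'b \<Rightarrow> real) \<Rightarrow> real" where
  "kernel_sum F \<Phi> = (\<Sum>u\<in>F ` space M. \<Sum>v\<in>F ` space M. \<Phi> u v * L2_inner M (cell F u) (P (cell F v)))"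

lemma cell_L2 [simp]: "simple_function M F \<Longrightarrow> cell F u \<in> L2 M"
  unfolding cell_def by (simp add: simple_functionD(2))

lemma simple_eq_sum_cells:
  assumes "simple_function M F" "x \<in> space M"
  shows "\<phi> (F x) = (\<Sum>u\<in>F ` space M. \<phi> u *\<^sub>R cell F u) x"
proof -
  have "(\<Sum>u\<in>F ` space M. \<phi> u *\<^sub>R cell F u) x = (\<Sum>u\<in>F ` space M. if u = F x then \<phi> u else 0)"
    unfolding sum_fun_apply using assms by (intro sum.cong) (auto simp: cell_def indicator_def)
  then show ?thesis using assms simple_functionD(1)[OF assms(1)] by simp
qed

lemma kernel_sum_mono:
  assumes "simple_function M F"
    and "\<And>u v. u \<in> F ` space M \<Longrightarrow> v \<in> F ` space M \<Longrightarrow> \<Phi> u v \<le> \<Psi> u v"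
  shows "kernel_sum F \<Phi> \<le> kernel_sum F \<Psi>"
proof -
  have "0 \<le> L2_inner M (cell F u) (P (cell F v))" for u v
    using assms(1) by (intro ip_P_nonneg) (auto simp: cell_def)
  then show ?thesis unfolding kernel_sum_def using assms(2) by (intro sum_mono mult_right_mono) auto
qed

lemma kernel_sum_cong:
  assumes "\<And>u v. u \<in> F ` space M \<Longrightarrow> v \<in> F ` space M \<Longrightarrow> \<Phi> u v = \<Psi> u v"
  shows "kernel_sum F \<Phi> = kernel_sum F \<Psi>"
  unfolding kernel_sum_def using assms by (intro sum.cong) auto

lemma kernel_sum_add: "kernel_sum F (\<lambda>u v. \<Phi> u v + \<Psi> u v) = kernel_sum F \<Phi> + kernel_sum F \<Psi>"
  by (simp add: kernel_sum_def sum.distrib distrib_right)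

lemma kernel_sum_diff: "kernel_sum F (\<lambda>u v. \<Phi> u v - \<Psi> u v) = kernel_sum F \<Phi> - kernel_sum F \<Psi>"
  by (simp add: kernel_sum_def sum_subtractf left_diff_distrib)

lemma kernel_sum_scale: "kernel_sum F (\<lambda>u v. c * \<Phi> u v) = c * kernel_sum F \<Phi>"
  by (simp add: kernel_sum_def sum_distrib_left mult.assoc)

lemmas kernel_sum_linear = kernel_sum_add kernel_sum_diff kernel_sum_scale

lemma kernel_sum_swap:
  assumes F: "simple_function M F"
  shows "kernel_sum F (\<lambda>u v. \<Phi> v u) = kernel_sum F \<Phi>"
proof -
  have "L2_inner M (cell F u) (P (cell F v)) = L2_inner M (cell F v) (P (cell F u))" for u v
    using F ip_sym[of "P (cell F u)" "cell F v"] by (simp flip: symopD[OF symop_P])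
  then show ?thesis unfolding kernel_sum_def by (subst sum.swap) simp
qed

lemma kernel_sum_symmetrize:
  assumes F: "simple_function M F"
  shows "kernel_sum F (\<lambda>u v. (\<Phi> u v + \<Phi> v u) / 2) = kernel_sum F \<Phi>"
proof -
  have "kernel_sum F (\<lambda>u v. (\<Phi> u v + \<Phi> v u) / 2) = kernel_sum F (\<lambda>u v. 1 / 2 * \<Phi> u v + 1 / 2 * \<Phi> v u)"
    by (simp add: add_divide_distrib)
  then show ?thesis unfolding kernel_sum_linear kernel_sum_swap[OF F, of \<Phi>] by simp
qed

lemma integral_kernel_sum:
  assumes "\<And>u v. integrable N (\<lambda>t. \<Phi> t u v)"
  shows "(\<integral>t. kernel_sum F (\<Phi> t) \<partial>N) = kernel_sum F (\<lambda>u v. \<integral>t. \<Phi> t u v \<partial>N)"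
proof -
  let ?w = "\<lambda>u v. L2_inner M (cell F u) (P (cell F v))"
  have "(\<integral>t. kernel_sum F (\<Phi> t) \<partial>N) = (\<Sum>u\<in>F ` space M. \<integral>t. (\<Sum>v\<in>F ` space M. \<Phi> t u v * ?w u v) \<partial>N)"
    unfolding kernel_sum_def
    by (intro Bochner_Integration.integral_sum Bochner_Integration.integrable_sum integrable_mult_left assms)
  also have "\<dots> = (\<Sum>u\<in>F ` space M. \<Sum>v\<in>F ` space M. \<integral>t. \<Phi> t u v * ?w u v \<partial>N)"
    by (intro sum.cong refl Bochner_Integration.integral_sum integrable_mult_left assms)
  finally show ?thesis by (simp add: kernel_sum_def)
qed

lemma ip_P_simple:
  assumes F: "simple_function M F"
  shows "L2_inner M (\<lambda>x. \<phi> (F x)) (P (\<lambda>x. \<psi> (F x))) = kernel_sum F (\<lambda>u v. \<phi> u * \<psi> v)"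
proof -
  let ?V = "F ` space M"
  let ?f = "\<Sum>u\<in>?V. \<phi> u *\<^sub>R cell F u" and ?g = "\<Sum>v\<in>?V. \<psi> v *\<^sub>R cell F v"
  have H: "?f \<in> L2 M" "?g \<in> L2 M" using F by auto
  have "L2_inner M (\<lambda>x. \<phi> (F x)) (P (\<lambda>x. \<psi> (F x))) = L2_inner M ?f (P ?g)"
    by (rule ip_P_cong[OF simple_comp_L2[OF F] simple_comp_L2[OF F] H])
      (auto intro!: simple_eq_sum_cells[OF F])
  also have "\<dots> = (\<Sum>u\<in>?V. L2_inner M (\<phi> u *\<^sub>R cell F u) (P ?g))"
    using F H by (intro ip_sum_left) auto
  also have "\<dots> = (\<Sum>u\<in>?V. \<phi> u * L2_inner M (P (cell F u)) ?g)"
    using F H by (intro sum.cong) (auto simp: ip_simps symopD[OF symop_P])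
  also have "\<dots> = (\<Sum>u\<in>?V. \<phi> u * (\<Sum>v\<in>?V. L2_inner M (P (cell F u)) (\<psi> v *\<^sub>R cell F v)))"
    using F H by (intro sum.cong arg_cong2[where f = "(*)"] refl ip_sum_right) auto
  also have "\<dots> = kernel_sum F (\<lambda>u v. \<phi> u * \<psi> v)"
    unfolding kernel_sum_def using F
    by (auto simp: sum_distrib_left ip_simps symopD[OF symop_P] mult.assoc intro!: sum.cong)
  finally show ?thesis .
qed

lemma ip_simple:
  assumes F: "simple_function M F"
  shows "L2_inner M (\<lambda>x. \<phi> (F x)) (\<lambda>x. \<psi> (F x)) = kernel_sum F (\<lambda>u v. \<phi> u * \<psi> u)"
proof -
  have P_one: "AE x in M. P (\<lambda>_. 1) x = 1" using markov by (simp add: markov_operator_def)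
  have one_L2: "(\<lambda>_. 1) \<in> L2 M" using simple_comp_L2[OF F, of "\<lambda>_. 1"] .
  have "L2_inner M (\<lambda>x. \<phi> (F x)) (\<lambda>x. \<psi> (F x)) = L2_inner M (\<lambda>x. \<phi> (F x) * \<psi> (F x)) (P (\<lambda>_. 1))"
    unfolding L2_inner_def
  proof (rule integral_cong_AE)
    show "AE x in M. \<phi> (F x) * \<psi> (F x) = \<phi> (F x) * \<psi> (F x) * P (\<lambda>_. 1) x" using P_one by auto
  qed (use L2D(1)[OF simple_comp_L2[OF F]] L2D(1)[OF P_L2[OF one_L2]] in measurable)
  also have "\<dots> = kernel_sum F (\<lambda>u v. \<phi> u * \<psi> u * 1)"
    using ip_P_simple[OF F, of "\<lambda>u. \<phi> u * \<psi> u" "\<lambda>_. 1"] by simp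
  finally show ?thesis by simp
qed

lemma nrm_simple: "simple_function M F \<Longrightarrow> (nrm (\<lambda>x. \<phi> (F x)))\<^sup>2 = kernel_sum F (\<lambda>u v. (\<phi> u)\<^sup>2)"
  using nrm_power2[OF simple_comp_L2, of F \<phi>] ip_simple[of F \<phi> \<phi>] by (simp add: power2_eq_square)

lemma measure_simple:
  assumes F: "simple_function M F"
  shows "measure M {x \<in> space M. Q (F x)} = kernel_sum F (\<lambda>u v. of_bool (Q u))"
proof -
  have meas: "{x \<in> space M. Q (F x)} \<in> sets M"
    using simple_functionD(2)[OF F, of "Collect Q"] by (simp add: vimage_def Int_def conj_commute)
  have "(\<integral>x. indicator {x \<in> space M. Q (F x)} x \<partial>M) = (\<integral>x. of_bool (Q (F x)) * (1::real) \<partial>M)"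
    by (intro Bochner_Integration.integral_cong) (auto split: split_indicator)
  then have "measure M {x \<in> space M. Q (F x)} = L2_inner M (\<lambda>x. of_bool (Q (F x))) (\<lambda>x. 1)"
    using meas by (simp add: L2_inner_def Int_absorb2)
  also have "\<dots> = kernel_sum F (\<lambda>u v. of_bool (Q u) * 1)"
    using ip_simple[OF F, of "\<lambda>u. of_bool (Q u)" "\<lambda>_. 1"] by simp
  finally show ?thesis by simp
qed

lemma ip_P_indicator_simple:
  assumes F: "simple_function M F"
    and A: "A \<in> sets M" "\<And>x. x \<in> space M \<Longrightarrow> x \<in> A \<longleftrightarrow> Q (F x)"
    and B: "B \<in> sets M" "\<And>x. x \<in> space M \<Longrightarrow> x \<in> B \<longleftrightarrow> R (F x)"
  shows "L2_inner M (indicator A) (P (indicator B)) = kernel_sum F (\<lambda>u v. of_bool (Q u) * of_bool (R v))"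
proof -
  have "L2_inner M (indicator A) (P (indicator B)) =
      L2_inner M (\<lambda>x. of_bool (Q (F x))) (P (\<lambda>x. of_bool (R (F x))))"
    by (rule ip_P_cong[OF _ _ simple_comp_L2[OF F] simple_comp_L2[OF F]]) (use A B in auto)
  then show ?thesis using ip_P_simple[OF F, of "\<lambda>u. of_bool (Q u)" "\<lambda>v. of_bool (R v)"] by simp
qed

subsection \<open>The energy form\<close>

lemma ip_P_le_simple:
  fixes f g :: "'a \<Rightarrow> real"
  assumes f: "simple_function M f" and g: "simple_function M g"
  shows "L2_inner M f (P g) \<le> ((nrm f)\<^sup>2 + (nrm g)\<^sup>2) / 2"
proof -
  define F where "F x = (f x, g x)" for x
  have F: "simple_function M F" unfolding F_def using f g by (rule simple_function_Pair)
  have "L2_inner M f (P g) = kernel_sum F (\<lambda>u v. fst u * snd v)"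
    using ip_P_simple[OF F, of fst snd] by (simp add: F_def)
  also have "\<dots> \<le> kernel_sum F (\<lambda>u v. 1 / 2 * (fst u)\<^sup>2 + 1 / 2 * (snd v)\<^sup>2)"
  proof (rule kernel_sum_mono[OF F])
    fix u v :: "real \<times> real"
    show "fst u * snd v \<le> 1 / 2 * (fst u)\<^sup>2 + 1 / 2 * (snd v)\<^sup>2"
      using sum_squares_bound[of "fst u" "snd v"] by simp
  qed
  also have "\<dots> = ((nrm f)\<^sup>2 + (nrm g)\<^sup>2) / 2"
    unfolding kernel_sum_linear using kernel_sum_swap[OF F, of "\<lambda>u v. (snd u)\<^sup>2"]
      nrm_simple[OF F, of fst] nrm_simple[OF F, of snd] by (simp add: F_def)
  finally show ?thesis .
qed

lemma ip_le_of_simple: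
  assumes h: "h \<in> L2 M" and f: "f \<in> L2 M"
    and simple: "\<And>s. simple_function M s \<Longrightarrow> L2_inner M s h \<le> ((nrm s)\<^sup>2 + c) / 2"
  shows "L2_inner M f h \<le> ((nrm f)\<^sup>2 + c) / 2"
proof -
  obtain s where s: "\<And>n. simple_function M (s n)" "nrm_converges s f"
    using simple_dense[OF f] by metis
  show ?thesis
  proof (rule LIMSEQ_le)
    show "(\<lambda>n. L2_inner M (s n) h) \<longlonglongrightarrow> L2_inner M f h"
      using s(2) nrm_converges_const[OF h] by (rule tendsto_ip)
    show "(\<lambda>n. ((nrm (s n))\<^sup>2 + c) / 2) \<longlonglongrightarrow> ((nrm f)\<^sup>2 + c) / 2"
      by (intro tendsto_intros tendsto_nrm s(2)) simp
    show "\<exists>N. \<forall>n\<ge>N. L2_inner M (s n) h \<le> ((nrm (s n))\<^sup>2 + c) / 2" using simple[OF s(1)] by blast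
  qed
qed

lemma ip_P_le:
  assumes f: "f \<in> L2 M" and g: "g \<in> L2 M"
  shows "L2_inner M f (P g) \<le> ((nrm f)\<^sup>2 + (nrm g)\<^sup>2) / 2"
proof (rule ip_le_of_simple[OF P_L2[OF g] f])
  fix s :: "'a \<Rightarrow> real" assume s: "simple_function M s"
  have s_L2: "s \<in> L2 M" using s by (rule simple_L2)
  have "L2_inner M g (P s) \<le> ((nrm g)\<^sup>2 + (nrm s)\<^sup>2) / 2"
  proof (rule ip_le_of_simple[OF P_L2[OF s_L2] g])
    show "L2_inner M r (P s) \<le> ((nrm r)\<^sup>2 + (nrm s)\<^sup>2) / 2" if "simple_function M r" for r
      using that s by (rule ip_P_le_simple)
  qed
  then show "L2_inner M s (P g) \<le> ((nrm s)\<^sup>2 + (nrm g)\<^sup>2) / 2"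
    using symopD[OF symop_P s_L2 g] ip_sym[of g "P s"] s_L2 g by (simp add: add.commute)
qed

lemma bound_op_P: "bound_op P 1"
proof -
  have "nrm (P f) \<le> nrm f" if f: "f \<in> L2 M" for f
  proof (rule power2_le_imp_le)
    show "(nrm (P f))\<^sup>2 \<le> (nrm f)\<^sup>2" using ip_P_le[of "P f" f] f by (simp add: nrm_power2[of "P f"])
  qed (use f in simp)
  then show ?thesis by (simp add: bound_op_def)
qed

definition energy :: "('a \<Rightarrow> real) \<Rightarrow> real" where
  "energy f = L2_inner M (shift P (-1) f) f"

lemma energy_eq: "f \<in> L2 M \<Longrightarrow> energy f = (nrm f)\<^sup>2 + L2_inner M f (P f)"
  using ip_shift[OF symop_P, of f f "-1"] by (simp add: energy_def symopD[OF symop_P] nrm_power2)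

lemma energy_zero: "energy (\<lambda>x. 0) = 0"
  by (simp add: energy_def L2_inner_def)

lemma symop_energy: "symop (shift P (-1))"
  using symop_P by (rule symop_shift)

lemma abs_ip_P_le: "f \<in> L2 M \<Longrightarrow> \<bar>L2_inner M f (P f)\<bar> \<le> (nrm f)\<^sup>2"
  using form_bound[OF symop_P bound_op_P, of f] by (simp add: symopD[OF symop_P])

lemma psd_energy: "psd_on (L2 M) (shift P (-1))"
  unfolding psd_on_def energy_def[symmetric] using abs_ip_P_le by (fastforce simp: energy_eq abs_le_iff)

lemma energy_le: "f \<in> L2 M \<Longrightarrow> energy f \<le> 2 * (nrm f)\<^sup>2"
  using abs_ip_P_le[of f] by (simp add: energy_eq abs_le_iff)

lemma energy_simple:
  assumes F: "simple_function M F"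
  shows "energy (\<lambda>x. \<phi> (F x)) = kernel_sum F (\<lambda>u v. (\<phi> u + \<phi> v)\<^sup>2 / 2)"
proof -
  have "kernel_sum F (\<lambda>u v. (\<phi> u + \<phi> v)\<^sup>2 / 2) = kernel_sum F (\<lambda>u v. ((\<phi> u)\<^sup>2 + (\<phi> v)\<^sup>2) / 2 + \<phi> u * \<phi> v)"
    by (simp add: power2_sum add_divide_distrib)
  also have "\<dots> = kernel_sum F (\<lambda>u v. (\<phi> u)\<^sup>2) + kernel_sum F (\<lambda>u v. \<phi> u * \<phi> v)"
    unfolding kernel_sum_add kernel_sum_symmetrize[OF F] ..
  finally show ?thesis
    using F by (simp add: energy_eq simple_comp_L2 nrm_simple ip_P_simple)
qed

lemma energy_cong:
  assumes "f \<in> L2 M" "g \<in> L2 M" "\<And>x. x \<in> space M \<Longrightarrow> f x = g x"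
  shows "energy f = energy g"
  unfolding energy_eq[OF assms(1)] energy_eq[OF assms(2)] nrm_def
  using assms ip_P_cong[of f f g g] ip_cong[of f g f g] by simp

end

sublocale reversible_markov \<subseteq> energy: semi_inner_space "L2 M" "\<lambda>f g. L2_inner M (shift P (-1) f) g"
  by (intro semi_inner_space_form symop_energy subspace_L2 order_refl psd_energy)

context reversible_markov
begin

lemma energy_nrm_power2: "f \<in> L2 M \<Longrightarrow> (energy.nrm f)\<^sup>2 = energy f"
  unfolding energy_def by (rule energy.nrm_power2)

lemma energy_nonneg: "f \<in> L2 M \<Longrightarrow> 0 \<le> energy f"
  unfolding energy_def by (rule energy.ip_nonneg)

lemma energy_scale: "f \<in> L2 M \<Longrightarrow> energy (c *\<^sub>R f) = c\<^sup>2 * energy f"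
  by (simp add: energy_nrm_power2[symmetric] energy.nrm_scale power_mult_distrib)

section \<open>Almost bipartite pairs of sets\<close>

definition almost_bipartite :: "real \<Rightarrow> 'a set \<Rightarrow> 'a set \<Rightarrow> bool" where
  "almost_bipartite \<kappa> A B \<longleftrightarrow> A \<in> sets M \<and> B \<in> sets M \<and> A \<inter> B = {} \<and> 0 < measure M (A \<union> B) \<and>
      (1 - \<kappa>) * measure M (A \<union> B) < 2 * L2_inner M (indicator A) (P (indicator B))"

lemma level_set_kernel_bound:
  fixes u v \<kappa> :: real
  assumes "\<kappa> > 0"
  shows "(1 - \<kappa>) * ((u\<^sup>2 + v\<^sup>2) / 2) - of_bool (u * v < 0) * min (u\<^sup>2) (v\<^sup>2)
      \<le> 1 / \<kappa> * ((u + v)\<^sup>2 / 2) - \<kappa> / 2 * ((u\<^sup>2 + v\<^sup>2) / 2)"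
proof (cases "u * v < 0")
  case True
  have am_gm: "x * y \<le> x\<^sup>2 / \<kappa> + \<kappa> / 4 * y\<^sup>2" for x y
  proof -
    have "0 \<le> (x - \<kappa> / 2 * y)\<^sup>2 / \<kappa>" using assms by simp
    also have "\<dots> = x\<^sup>2 / \<kappa> + \<kappa> / 4 * y\<^sup>2 - x * y" using assms by (simp add: field_simps power2_eq_square)
    finally show ?thesis by simp
  qed
  have "u\<^sup>2 + v\<^sup>2 - 2 * min (u\<^sup>2) (v\<^sup>2) = max ((u + v) * (u - v)) ((u + v) * (v - u))"
    by (simp add: min_def max_def power2_eq_square algebra_simps)
  also have "\<dots> \<le> (u + v)\<^sup>2 / \<kappa> + \<kappa> / 4 * (u - v)\<^sup>2"
    using am_gm[of "u + v" "u - v"] am_gm[of "u + v" "v - u"] by (simp add: power2_commute)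
  also have "\<dots> \<le> (u + v)\<^sup>2 / \<kappa> + \<kappa> / 4 * (2 * (u\<^sup>2 + v\<^sup>2))"
  proof -
    have "(u - v)\<^sup>2 \<le> 2 * (u\<^sup>2 + v\<^sup>2)"
      using zero_le_power2[of "u + v"] by (simp add: power2_sum power2_diff)
    then show ?thesis using assms by (intro add_left_mono mult_left_mono) auto
  qed
  finally show ?thesis using True by (simp add: field_simps)
next
  case False
  then have uv: "u\<^sup>2 + v\<^sup>2 \<le> (u + v)\<^sup>2" by (simp add: power2_sum)
  have "1 \<le> 1 / \<kappa> + \<kappa> / 2"
  proof -
    have "0 \<le> (\<kappa> - 1)\<^sup>2 + 1" by simp
    then have "2 * \<kappa> \<le> 2 + \<kappa>\<^sup>2" by (simp add: power2_diff)
    then show ?thesis using assms by (simp add: field_simps power2_eq_square)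
  qed
  then have "1 * (u\<^sup>2 + v\<^sup>2) \<le> (1 / \<kappa> + \<kappa> / 2) * (u\<^sup>2 + v\<^sup>2)" by (intro mult_right_mono) auto
  also have "\<dots> \<le> (u + v)\<^sup>2 / \<kappa> + \<kappa> / 2 * (u\<^sup>2 + v\<^sup>2)"
    using divide_right_mono[OF uv, of \<kappa>] assms by (simp add: algebra_simps add_divide_distrib)
  finally show ?thesis using False by (simp add: field_simps)
qed

lemma level_set_kernel_nonneg:
  fixes t :: real
  assumes f: "simple_function M f"
    and none: "\<And>A B. A \<union> B \<subseteq> {x \<in> space M. f x \<noteq> 0} \<Longrightarrow> \<not> almost_bipartite \<kappa> A B" and t: "0 \<le> t"
  shows "0 \<le> kernel_sum f (\<lambda>u v. (1 - \<kappa>) * ((of_bool (t < u\<^sup>2) + of_bool (t < v\<^sup>2)) / 2) -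
      of_bool (u * v < 0 \<and> t < u\<^sup>2 \<and> t < v\<^sup>2))"
proof -
  define A where "A = {x \<in> space M. 0 < f x \<and> t < (f x)\<^sup>2}"
  define B where "B = {x \<in> space M. f x < 0 \<and> t < (f x)\<^sup>2}"
  have [measurable]: "f \<in> borel_measurable M" using f by (rule borel_measurable_simple_function)
  have AB: "A \<in> sets M" "B \<in> sets M" "A \<inter> B = {}" unfolding A_def B_def by (measurable, measurable, auto)
  have "f x \<noteq> 0" if "t < (f x)\<^sup>2" for x using that t by auto
  then have union: "A \<union> B = {x \<in> space M. t < (f x)\<^sup>2}" by (auto simp: A_def B_def neq_iff)
  have measure_eq: "measure M (A \<union> B) = kernel_sum f (\<lambda>u v. (of_bool (t < u\<^sup>2) + of_bool (t < v\<^sup>2)) / 2)"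
    unfolding union using measure_simple[OF f, of "\<lambda>u. t < u\<^sup>2"]
      kernel_sum_symmetrize[OF f, of "\<lambda>u v. of_bool (t < u\<^sup>2)"] by simp
  have "L2_inner M (indicator A) (P (indicator B)) =
      kernel_sum f (\<lambda>u v. of_bool (0 < u \<and> t < u\<^sup>2) * of_bool (v < 0 \<and> t < v\<^sup>2))"
    using AB by (intro ip_P_indicator_simple[OF f]) (auto simp: A_def B_def)
  also have "\<dots> = kernel_sum f (\<lambda>u v. (of_bool (0 < u \<and> t < u\<^sup>2) * of_bool (v < 0 \<and> t < v\<^sup>2) +
      of_bool (0 < v \<and> t < v\<^sup>2) * of_bool (u < 0 \<and> t < u\<^sup>2)) / 2)"
    using kernel_sum_symmetrize[OF f, of "\<lambda>u v. of_bool (0 < u \<and> t < u\<^sup>2) * of_bool (v < 0 \<and> t < v\<^sup>2)"]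
    by simp
  also have "\<dots> = kernel_sum f (\<lambda>u v. 1 / 2 * of_bool (u * v < 0 \<and> t < u\<^sup>2 \<and> t < v\<^sup>2))"
    by (intro kernel_sum_cong) (auto simp: mult_less_0_iff)
  finally have ip_eq: "2 * L2_inner M (indicator A) (P (indicator B)) =
      kernel_sum f (\<lambda>u v. of_bool (u * v < 0 \<and> t < u\<^sup>2 \<and> t < v\<^sup>2))"
    by (simp only: kernel_sum_scale)
  have "2 * L2_inner M (indicator A) (P (indicator B)) \<le> (1 - \<kappa>) * measure M (A \<union> B)"
  proof (cases "0 < measure M (A \<union> B)")
    case True
    have "\<not> almost_bipartite \<kappa> A B" by (rule none) (auto simp: A_def B_def)
    then show ?thesis using AB True by (simp add: almost_bipartite_def)
  next
    case False
    then have "measure M (A \<union> B) = 0" using measure_nonneg[of M "A \<union> B"] by linarith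
    moreover have "2 * L2_inner M (indicator A) (P (indicator B)) \<le> measure M (A \<union> B)"
      unfolding measure_eq ip_eq by (rule kernel_sum_mono[OF f]) auto
    ultimately show ?thesis by simp
  qed
  then show ?thesis unfolding kernel_sum_diff kernel_sum_scale measure_eq ip_eq by simp
qed

lemma dual_Cheeger_level_sets:
  assumes f: "simple_function M f" and \<kappa>: "\<kappa> > 0" and small: "energy f < \<kappa>\<^sup>2 / 2 * (nrm f)\<^sup>2"
  shows "\<exists>A B. almost_bipartite \<kappa> A B \<and> A \<union> B \<subseteq> {x \<in> space M. f x \<noteq> 0}"
proof (rule ccontr)
  assume none: "\<not> ?thesis"
  define \<Phi> where "\<Phi> t u v = (1 - \<kappa>) * ((indicator {0..<u\<^sup>2} t + indicator {0..<v\<^sup>2} t) / 2) -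
      of_bool (u * v < 0) * indicator {0..<min (u\<^sup>2) (v\<^sup>2)} t" for t u v :: real
  have "\<not> almost_bipartite \<kappa> A B" if "A \<union> B \<subseteq> {x \<in> space M. f x \<noteq> 0}" for A B
    using none that by blast
  note nonneg = level_set_kernel_nonneg[OF f this]
  have \<Phi>_nonneg: "0 \<le> kernel_sum f (\<Phi> t)" for t
  proof (cases "0 \<le> t")
    case True
    then have "\<Phi> t = (\<lambda>u v. (1 - \<kappa>) * ((of_bool (t < u\<^sup>2) + of_bool (t < v\<^sup>2)) / 2) -
        of_bool (u * v < 0 \<and> t < u\<^sup>2 \<and> t < v\<^sup>2))"
      by (auto simp: \<Phi>_def fun_eq_iff indicator_def)
    then show ?thesis using nonneg[OF _ True] by simp
  next
    case False
    then have "\<Phi> t = (\<lambda>u v. 0)" by (auto simp: \<Phi>_def fun_eq_iff)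
    then show ?thesis by (simp add: kernel_sum_def)
  qed
  have interval: "has_bochner_integral lborel (indicator {0..<c}) c" if "0 \<le> c" for c :: real
    using has_bochner_integral_real_indicator[of "{0..<c}" lborel] that by simp
  have "has_bochner_integral lborel (\<lambda>t. \<Phi> t u v)
      ((1 - \<kappa>) * ((u\<^sup>2 + v\<^sup>2) / 2) - of_bool (u * v < 0) * min (u\<^sup>2) (v\<^sup>2))" for u v
    unfolding \<Phi>_def
    by (intro has_bochner_integral_diff has_bochner_integral_mult_right has_bochner_integral_divide
        has_bochner_integral_add interval) auto
  then have \<Phi>_integrable: "integrable lborel (\<lambda>t. \<Phi> t u v)"
    and \<Phi>_integral: "(\<integral>t. \<Phi> t u v \<partial>lborel) =
      (1 - \<kappa>) * ((u\<^sup>2 + v\<^sup>2) / 2) - of_bool (u * v < 0) * min (u\<^sup>2) (v\<^sup>2)"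
    for u v by (simp_all add: has_bochner_integral_iff)
  have "0 \<le> (\<integral>t. kernel_sum f (\<Phi> t) \<partial>lborel)"
    using \<Phi>_nonneg by (intro Bochner_Integration.integral_nonneg) auto
  also have "\<dots> = kernel_sum f (\<lambda>u v. (1 - \<kappa>) * ((u\<^sup>2 + v\<^sup>2) / 2) - of_bool (u * v < 0) * min (u\<^sup>2) (v\<^sup>2))"
    unfolding integral_kernel_sum[OF \<Phi>_integrable] \<Phi>_integral ..
  also have "\<dots> \<le> kernel_sum f (\<lambda>u v. 1 / \<kappa> * ((u + v)\<^sup>2 / 2) - \<kappa> / 2 * ((u\<^sup>2 + v\<^sup>2) / 2))"
    by (intro kernel_sum_mono[OF f] level_set_kernel_bound[OF \<kappa>])
  also have "\<dots> = 1 / \<kappa> * energy f - \<kappa> / 2 * (nrm f)\<^sup>2"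
    unfolding kernel_sum_linear kernel_sum_symmetrize[OF f, of "\<lambda>u v. u\<^sup>2"]
    using energy_simple[OF f, of "\<lambda>u. u"] nrm_simple[OF f, of "\<lambda>u. u"] by simp
  finally have "\<kappa>\<^sup>2 / 2 * (nrm f)\<^sup>2 \<le> energy f" using \<kappa> by (simp add: field_simps power2_eq_square)
  then show False using small by simp
qed

subsection \<open>Energy of functions cut along a pair of sets\<close>

definition defect :: "'a set \<Rightarrow> 'a set \<Rightarrow> real" where
  "defect A B = measure M (A \<union> B) - 2 * L2_inner M (indicator A) (P (indicator B))"

definition sgn_pair :: "'a set \<Rightarrow> 'a set \<Rightarrow> 'a \<Rightarrow> real" where
  "sgn_pair A B x = indicator A x - indicator B x"

text \<open>The defect is the \<open>kernel_sum\<close>-mass of the pairs of points that are not separated by the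
  bipartition, counted with weight 1 inside \<open>A\<close> or \<open>B\<close> and with weight 1/2 across the boundary of
  \<open>A \<union> B\<close>.\<close>

definition defect_kernel :: "real \<Rightarrow> real \<Rightarrow> real" where
  "defect_kernel s t = (s\<^sup>2 + t\<^sup>2) / 2 - of_bool (s = 1 \<and> t = - 1) - of_bool (s = - 1 \<and> t = 1)"

lemma sgn_pair_simple: "A \<in> sets M \<Longrightarrow> B \<in> sets M \<Longrightarrow> simple_function M (sgn_pair A B)"
  unfolding sgn_pair_def[abs_def] by (intro simple_function_diff simple_function_indicator)

lemma sgn_pair_L2: "A \<in> sets M \<Longrightarrow> B \<in> sets M \<Longrightarrow> sgn_pair A B \<in> L2 M"
  by (intro simple_L2 sgn_pair_simple)

lemma sgn_pair_range: "A \<inter> B = {} \<Longrightarrow> sgn_pair A B x \<in> {-1, 0, 1}"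
  by (auto simp: sgn_pair_def indicator_def)

lemma sgn_pair_iff:
  assumes "A \<inter> B = {}"
  shows "sgn_pair A B x = 1 \<longleftrightarrow> x \<in> A" "sgn_pair A B x = - 1 \<longleftrightarrow> x \<in> B" "sgn_pair A B x = 0 \<longleftrightarrow> x \<notin> A \<union> B"
  using assms by (auto simp: sgn_pair_def indicator_def)

definition labelled :: "('a \<Rightarrow> real) \<Rightarrow> 'a set \<Rightarrow> 'a set \<Rightarrow> 'a \<Rightarrow> real \<times> real" where
  "labelled f A B x = (f x, sgn_pair A B x)"

lemma fst_labelled [simp]: "fst (labelled f A B x) = f x"
  and snd_labelled [simp]: "snd (labelled f A B x) = sgn_pair A B x"
  by (simp_all add: labelled_def)

lemma simple_labelled:
  assumes "simple_function M f" "A \<in> sets M" "B \<in> sets M"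
  shows "simple_function M (labelled f A B)"
  unfolding labelled_def[abs_def] by (intro simple_function_Pair assms sgn_pair_simple)

lemma snd_labelled_range: "A \<inter> B = {} \<Longrightarrow> u \<in> labelled f A B ` space M \<Longrightarrow> snd u \<in> {-1, 0, 1}"
  by (metis imageE sgn_pair_range snd_labelled)

lemma nrm_sgn_pair:
  assumes "A \<in> sets M" "B \<in> sets M" "A \<inter> B = {}"
  shows "(nrm (sgn_pair A B))\<^sup>2 = measure M (A \<union> B)"
proof -
  have "(nrm (sgn_pair A B))\<^sup>2 = (\<integral>x. indicator (A \<union> B) x \<partial>M)"
    unfolding nrm_power2_eq_integral[OF sgn_pair_L2[OF assms(1,2)]] using assms(3)
    by (intro Bochner_Integration.integral_cong) (auto simp: sgn_pair_def indicator_def)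
  also have "\<dots> = measure M (A \<union> B)" using assms(1,2) sets.sets_into_space by (simp add: Int_absorb2)
  finally show ?thesis .
qed

lemma kernel_sum_defect_kernel:
  assumes F: "simple_function M F" and AB: "A \<in> sets M" "B \<in> sets M" "A \<inter> B = {}"
    and \<sigma>: "\<And>x. \<sigma> (F x) = sgn_pair A B x"
  shows "kernel_sum F (\<lambda>u v. defect_kernel (\<sigma> u) (\<sigma> v)) = defect A B"
proof -
  let ?J = "\<lambda>u v. of_bool (\<sigma> u = 1) * of_bool (\<sigma> v = - 1)"
  have "kernel_sum F (\<lambda>u v. defect_kernel (\<sigma> u) (\<sigma> v)) =
      kernel_sum F (\<lambda>u v. ((\<sigma> u)\<^sup>2 + (\<sigma> v)\<^sup>2) / 2 - 2 * ((?J u v + ?J v u) / 2))"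
    by (intro kernel_sum_cong) (simp add: defect_kernel_def)
  also have "\<dots> = kernel_sum F (\<lambda>u v. (\<sigma> u)\<^sup>2) - 2 * kernel_sum F ?J"
    unfolding kernel_sum_diff kernel_sum_scale kernel_sum_symmetrize[OF F] ..
  also have "kernel_sum F ?J = L2_inner M (indicator A) (P (indicator B))"
    using AB by (intro ip_P_indicator_simple[OF F, symmetric]) (auto simp: \<sigma> sgn_pair_iff)
  also have "kernel_sum F (\<lambda>u v. (\<sigma> u)\<^sup>2) = measure M (A \<union> B)"
    using nrm_simple[OF F, of \<sigma>] nrm_sgn_pair[OF AB] unfolding \<sigma> by simp
  finally show ?thesis by (simp add: defect_def)
qed

lemma energy_compare:
  assumes f: "simple_function M f" and C: "\<And>x. x \<in> space M \<Longrightarrow> \<bar>f x\<bar> \<le> C"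
    and AB: "A \<in> sets M" "B \<in> sets M" "A \<inter> B = {}"
    and \<phi>: "\<And>a b s t. \<bar>a\<bar> \<le> C \<Longrightarrow> \<bar>b\<bar> \<le> C \<Longrightarrow> s \<in> {-1, 0, 1} \<Longrightarrow> t \<in> {-1, 0, 1} \<Longrightarrow>
        (\<phi> a s + \<phi> b t)\<^sup>2 / 2 \<le> (a + b)\<^sup>2 / 2 + K * defect_kernel s t"
  shows "energy (\<lambda>x. \<phi> (f x) (sgn_pair A B x)) \<le> energy f + K * defect A B"
proof -
  let ?F = "labelled f A B"
  note F = simple_labelled[OF f AB(1,2)]
  have "energy (\<lambda>x. \<phi> (f x) (sgn_pair A B x)) =
      kernel_sum ?F (\<lambda>u v. (\<phi> (fst u) (snd u) + \<phi> (fst v) (snd v))\<^sup>2 / 2)"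
    using energy_simple[OF F, of "\<lambda>u. \<phi> (fst u) (snd u)"] by simp
  also have "\<dots> \<le> kernel_sum ?F (\<lambda>u v. (fst u + fst v)\<^sup>2 / 2 + K * defect_kernel (snd u) (snd v))"
  proof (rule kernel_sum_mono[OF F])
    fix u v assume uv: "u \<in> ?F ` space M" "v \<in> ?F ` space M"
    then have "\<bar>fst u\<bar> \<le> C" "\<bar>fst v\<bar> \<le> C" using C by auto
    then show "(\<phi> (fst u) (snd u) + \<phi> (fst v) (snd v))\<^sup>2 / 2
        \<le> (fst u + fst v)\<^sup>2 / 2 + K * defect_kernel (snd u) (snd v)"
      using uv by (intro \<phi> snd_labelled_range[OF AB(3)])
  qed
  also have "\<dots> = energy f + K * defect A B"
    unfolding kernel_sum_add kernel_sum_scale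
    using energy_simple[OF F, of fst] kernel_sum_defect_kernel[OF F AB, of snd] by simp
  finally show ?thesis .
qed

lemma energy_sgn_pair:
  assumes "A \<in> sets M" "B \<in> sets M" "A \<inter> B = {}"
  shows "energy (sgn_pair A B) \<le> 2 * defect A B"
proof -
  have "energy (sgn_pair A B) \<le> energy (\<lambda>x. 0) + 2 * defect A B"
    by (rule energy_compare[of "\<lambda>x. 0" 0 A B "\<lambda>a s. s" 2]) (use assms in \<open>auto simp: defect_kernel_def\<close>)
  then show ?thesis by (simp add: energy_zero)
qed

lemma defect_nonneg: "A \<in> sets M \<Longrightarrow> B \<in> sets M \<Longrightarrow> A \<inter> B = {} \<Longrightarrow> 0 \<le> defect A B"
  using energy_sgn_pair[of A B] energy_nonneg[OF sgn_pair_L2[of A B]] by linarith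

lemma almost_bipartite_defect:
  assumes "almost_bipartite \<delta> A B" "\<delta> > 0"
  shows "defect A B \<le> \<delta> * measure M (A \<union> B)" "defect A B \<le> \<delta>"
proof -
  show "defect A B \<le> \<delta> * measure M (A \<union> B)"
    using assms by (simp add: almost_bipartite_def defect_def algebra_simps)
  also have "\<dots> \<le> \<delta>" using assms(2) by (simp add: mult_left_le)
  finally show "defect A B \<le> \<delta>" .
qed

lemma almost_bipartite_mono: "almost_bipartite \<delta> A B \<Longrightarrow> \<delta> \<le> \<kappa> \<Longrightarrow> almost_bipartite \<kappa> A B"
  unfolding almost_bipartite_def by (smt (verit) mult_right_mono)

definition restr :: "'a set \<Rightarrow> ('a \<Rightarrow> real) \<Rightarrow> 'a \<Rightarrow> real" where
  "restr D f = (\<lambda>x. indicator D x * f x)"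

lemma simple_restr: "simple_function M f \<Longrightarrow> D \<in> sets M \<Longrightarrow> simple_function M (restr D f)"
  unfolding restr_def by (intro simple_function_mult simple_function_indicator)

lemma energy_restr_outside:
  assumes f: "simple_function M f" and C: "\<And>x. x \<in> space M \<Longrightarrow> \<bar>f x\<bar> \<le> C"
    and AB: "A \<in> sets M" "B \<in> sets M" "A \<inter> B = {}"
  shows "energy (restr (space M - (A \<union> B)) f) \<le> energy f + 8 * C\<^sup>2 * defect A B"
proof -
  have "energy (restr (space M - (A \<union> B)) f) = energy (\<lambda>x. of_bool (sgn_pair A B x = 0) * f x)"
  proof (rule energy_cong)
    show "restr (space M - (A \<union> B)) f \<in> L2 M" using f AB by (intro simple_L2 simple_restr) auto
    show "(\<lambda>x. of_bool (sgn_pair A B x = 0) * f x) \<in> L2 M"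
      using simple_comp_L2[OF simple_labelled[OF f AB(1,2)], of "\<lambda>u. of_bool (snd u = 0) * fst u"]
      by simp
  qed (auto simp: restr_def sgn_pair_iff[OF AB(3)] indicator_def)
  also have "\<dots> \<le> energy f + 8 * C\<^sup>2 * defect A B"
  proof (rule energy_compare[OF f C AB, where \<phi> = "\<lambda>a s. of_bool (s = 0) * a"])
    fix a b s t :: real
    assume bounds: "\<bar>a\<bar> \<le> C" "\<bar>b\<bar> \<le> C" "s \<in> {-1, 0, 1}" "t \<in> {-1, 0, 1}"
    have "a\<^sup>2 \<le> C\<^sup>2" "b\<^sup>2 \<le> C\<^sup>2" using bounds(1,2) by (auto simp: abs_le_square_iff[symmetric])
    then have "a\<^sup>2 \<le> (a + b)\<^sup>2 + 8 * C\<^sup>2" "b\<^sup>2 \<le> (a + b)\<^sup>2 + 8 * C\<^sup>2"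
      using zero_le_power2[of "a + b"] zero_le_power2[of C] by linarith+
    then show "(of_bool (s = 0) * a + of_bool (t = 0) * b)\<^sup>2 / 2
        \<le> (a + b)\<^sup>2 / 2 + 8 * C\<^sup>2 * defect_kernel s t"
      using bounds(3,4) by (auto simp: defect_kernel_def)
  qed
  finally show ?thesis .
qed

text \<open>The part of \<open>s * a\<close> above the level \<open>c\<close>, carrying the sign \<open>s\<close> again. The part below \<open>c\<close> is
  \<open>signed_excess (- c) (- a) s\<close>.\<close>

definition signed_excess :: "real \<Rightarrow> real \<Rightarrow> real \<Rightarrow> real" where
  "signed_excess c a s = s * max (s * a - c) 0"

lemma signed_excess_square_le:
  assumes "\<bar>a\<bar> \<le> C" "\<bar>c\<bar> \<le> C" "s \<in> {-1, 0, 1}"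
  shows "(signed_excess c a s)\<^sup>2 \<le> 4 * C\<^sup>2 * s\<^sup>2"
proof -
  have "\<bar>s * a\<bar> \<le> C" using assms by auto
  then have "max (s * a - c) 0 \<le> 2 * C" using assms(2) by (simp add: abs_le_iff)
  then have "\<bar>s\<bar> * max (s * a - c) 0 \<le> \<bar>s\<bar> * (2 * C)" by (intro mult_left_mono) auto
  then have "\<bar>signed_excess c a s\<bar> \<le> \<bar>2 * C * s\<bar>"
    using assms(2) by (simp add: signed_excess_def abs_mult mult_ac)
  then have "(signed_excess c a s)\<^sup>2 \<le> (2 * C * s)\<^sup>2" by (simp only: abs_le_square_iff)
  then show ?thesis by (simp add: power_mult_distrib)
qed

lemma signed_excess_compare:
  assumes bounds: "\<bar>a\<bar> \<le> C" "\<bar>b\<bar> \<le> C" "\<bar>c\<bar> \<le> C" and s: "s \<in> {-1, 0, 1}" and t: "t \<in> {-1, 0, 1}"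
  shows "(signed_excess c a s + signed_excess c b t)\<^sup>2 / 2 \<le> (a + b)\<^sup>2 / 2 + 8 * C\<^sup>2 * defect_kernel s t"
proof (cases "s * t = - 1")
  case True
  have lipschitz: "\<bar>max x 0 - max y 0\<bar> \<le> \<bar>x - y\<bar>" for x y :: real
    by (cases "x \<le> 0"; cases "y \<le> 0") (auto simp: max_def)
  consider (pos_neg) "s = 1" "t = - 1" | (neg_pos) "s = - 1" "t = 1" using True s t by auto
  then have "\<bar>signed_excess c a s + signed_excess c b t\<bar> \<le> \<bar>a + b\<bar>"
  proof cases
    case pos_neg
    then show ?thesis using lipschitz[of "a - c" "- b - c"] by (simp add: signed_excess_def)
  next
    case neg_pos
    then show ?thesis using lipschitz[of "b - c" "- a - c"] by (simp add: signed_excess_def add.commute)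
  qed
  then have "(signed_excess c a s + signed_excess c b t)\<^sup>2 \<le> (a + b)\<^sup>2" by (simp only: abs_le_square_iff)
  moreover have "defect_kernel s t = 0" using True s t by (auto simp: defect_kernel_def)
  ultimately show ?thesis by simp
next
  case False
  have "(signed_excess c a s + signed_excess c b t)\<^sup>2
      \<le> 2 * (signed_excess c a s)\<^sup>2 + 2 * (signed_excess c b t)\<^sup>2"
    using zero_le_power2[of "signed_excess c a s - signed_excess c b t"]
    by (simp add: power2_sum power2_diff)
  also have "\<dots> \<le> 2 * (4 * C\<^sup>2 * s\<^sup>2) + 2 * (4 * C\<^sup>2 * t\<^sup>2)"
    by (intro add_mono mult_left_mono signed_excess_square_le bounds s t) auto
  also have "\<dots> = 2 * (8 * C\<^sup>2 * defect_kernel s t)"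
  proof -
    have kernel_eq: "defect_kernel s t = (s\<^sup>2 + t\<^sup>2) / 2" using False by (auto simp: defect_kernel_def)
    show ?thesis unfolding kernel_eq by (simp add: algebra_simps)
  qed
  finally show ?thesis using zero_le_power2[of "a + b"] by linarith
qed

lemma energy_signed_excess:
  assumes f: "simple_function M f" and C: "\<And>x. x \<in> space M \<Longrightarrow> \<bar>f x\<bar> \<le> C" and c: "\<bar>c\<bar> \<le> C"
    and AB: "A \<in> sets M" "B \<in> sets M" "A \<inter> B = {}"
  shows "energy (\<lambda>x. signed_excess c (f x) (sgn_pair A B x)) \<le> energy f + 8 * C\<^sup>2 * defect A B"
  by (rule energy_compare[OF f C AB signed_excess_compare[OF _ _ c]])

text \<open>Orthogonality to \<open>sgn_pair A B\<close> says that \<open>f\<close>, multiplied by the sign, has mean zero on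
  \<open>A \<union> B\<close>, so subtracting a constant there does not decrease the norm.\<close>

lemma nrm_signed_excess_ge:
  assumes f: "simple_function M f" and AB: "A \<in> sets M" "B \<in> sets M" "A \<inter> B = {}"
    and orth: "L2_inner M f (sgn_pair A B) = 0"
  shows "(nrm (restr (A \<union> B) f))\<^sup>2 \<le> (nrm (\<lambda>x. signed_excess c (f x) (sgn_pair A B x)))\<^sup>2 +
    (nrm (\<lambda>x. signed_excess (- c) (- f x) (sgn_pair A B x)))\<^sup>2"
proof -
  let ?F = "labelled f A B"
  note F = simple_labelled[OF f AB(1,2)]
  have "restr (A \<union> B) f = (\<lambda>x. (sgn_pair A B x)\<^sup>2 * f x)"
    using AB(3) by (auto simp: fun_eq_iff restr_def sgn_pair_def indicator_def)
  then have restr_eq: "(nrm (restr (A \<union> B) f))\<^sup>2 = kernel_sum ?F (\<lambda>u v. ((snd u)\<^sup>2 * fst u)\<^sup>2)"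
    using nrm_simple[OF F, of "\<lambda>u. (snd u)\<^sup>2 * fst u"] by simp
  have orth_eq: "kernel_sum ?F (\<lambda>u v. fst u * snd u) = 0"
    using ip_simple[OF F, of fst snd] orth by simp
  have "0 \<le> kernel_sum ?F (\<lambda>u v. (snd u)\<^sup>2)" using nrm_simple[OF F, of snd] by (metis zero_le_power2)
  then have "(nrm (restr (A \<union> B) f))\<^sup>2 \<le>
      kernel_sum ?F (\<lambda>u v. ((snd u)\<^sup>2 * fst u)\<^sup>2 - 2 * c * (fst u * snd u) + c\<^sup>2 * (snd u)\<^sup>2)"
    unfolding kernel_sum_linear orth_eq restr_eq by simp
  also have "\<dots> = kernel_sum ?F (\<lambda>u v.
      (signed_excess c (fst u) (snd u))\<^sup>2 + (signed_excess (- c) (- fst u) (snd u))\<^sup>2)"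
  proof (rule kernel_sum_cong)
    fix u v assume "u \<in> ?F ` space M"
    then have "snd u \<in> {-1, 0, 1}" by (rule snd_labelled_range[OF AB(3)])
    then show "((snd u)\<^sup>2 * fst u)\<^sup>2 - 2 * c * (fst u * snd u) + c\<^sup>2 * (snd u)\<^sup>2 =
        (signed_excess c (fst u) (snd u))\<^sup>2 + (signed_excess (- c) (- fst u) (snd u))\<^sup>2"
      by (auto simp: signed_excess_def max_def power2_eq_square algebra_simps)
  qed
  also have "\<dots> = (nrm (\<lambda>x. signed_excess c (f x) (sgn_pair A B x)))\<^sup>2 +
      (nrm (\<lambda>x. signed_excess (- c) (- f x) (sgn_pair A B x)))\<^sup>2"
    unfolding kernel_sum_add using nrm_simple[OF F, of "\<lambda>u. signed_excess c (fst u) (snd u)"]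
      nrm_simple[OF F, of "\<lambda>u. signed_excess (- c) (- fst u) (snd u)"] by simp
  finally show ?thesis .
qed

lemma balanced_level:
  assumes f: "simple_function M f" and C: "0 \<le> C" "\<And>x. x \<in> space M \<Longrightarrow> \<bar>f x\<bar> \<le> C"
    and AB: "A \<in> sets M" "B \<in> sets M" "A \<inter> B = {}"
  obtains c where "\<bar>c\<bar> \<le> C" "(nrm (\<lambda>x. signed_excess c (f x) (sgn_pair A B x)))\<^sup>2 =
    (nrm (\<lambda>x. signed_excess (- c) (- f x) (sgn_pair A B x)))\<^sup>2"
proof -
  let ?F = "labelled f A B"
  note F = simple_labelled[OF f AB(1,2)]
  define \<rho> where
    "\<rho> c u = (signed_excess c (fst u) (snd u))\<^sup>2 - (signed_excess (- c) (- fst u) (snd u))\<^sup>2" for c u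
  define g where "g c = kernel_sum ?F (\<lambda>u v. \<rho> c u)" for c
  have g_eq: "g c = (nrm (\<lambda>x. signed_excess c (f x) (sgn_pair A B x)))\<^sup>2 -
      (nrm (\<lambda>x. signed_excess (- c) (- f x) (sgn_pair A B x)))\<^sup>2" for c
    unfolding g_def \<rho>_def kernel_sum_diff
    using nrm_simple[OF F, of "\<lambda>u. signed_excess c (fst u) (snd u)"]
      nrm_simple[OF F, of "\<lambda>u. signed_excess (- c) (- fst u) (snd u)"] by simp
  have continuous: "continuous_on {-C..C} g"
    unfolding g_def kernel_sum_def \<rho>_def signed_excess_def by (intro continuous_intros)
  have "0 \<le> \<rho> (- C) u \<and> \<rho> C u \<le> 0" if u: "u \<in> ?F ` space M" for u
  proof -
    have "\<bar>fst u\<bar> \<le> C" using u C(2) by auto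
    then show ?thesis
      using snd_labelled_range[OF AB(3) u] by (auto simp: \<rho>_def signed_excess_def abs_le_iff max_def)
  qed
  then have "kernel_sum ?F (\<lambda>u v. 0) \<le> g (- C)" "g C \<le> kernel_sum ?F (\<lambda>u v. 0)"
    unfolding g_def by (auto intro!: kernel_sum_mono[OF F])
  then have "0 \<le> g (- C)" "g C \<le> 0" by (simp_all add: kernel_sum_def)
  then obtain c where "- C \<le> c" "c \<le> C" "g c = 0"
    using IVT2'[of g C 0 "-C"] C(1) continuous by auto
  then show ?thesis using that[of c] by (simp add: g_eq abs_le_iff)
qed

lemma split_pair:
  assumes f: "simple_function M f" and C: "0 \<le> C" "\<And>x. x \<in> space M \<Longrightarrow> \<bar>f x\<bar> \<le> C"
    and AB: "A \<in> sets M" "B \<in> sets M" "A \<inter> B = {}"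
    and orth: "L2_inner M f (sgn_pair A B) = 0" and \<kappa>: "\<kappa> > 0"
    and small: "energy f + 8 * C\<^sup>2 * defect A B < \<kappa>\<^sup>2 / 4 * (nrm (restr (A \<union> B) f))\<^sup>2"
  obtains A\<^sub>1 B\<^sub>1 A\<^sub>2 B\<^sub>2 where "almost_bipartite \<kappa> A\<^sub>1 B\<^sub>1" "almost_bipartite \<kappa> A\<^sub>2 B\<^sub>2"
    "A\<^sub>1 \<union> B\<^sub>1 \<subseteq> A \<union> B" "A\<^sub>2 \<union> B\<^sub>2 \<subseteq> A \<union> B" "(A\<^sub>1 \<union> B\<^sub>1) \<inter> (A\<^sub>2 \<union> B\<^sub>2) = {}"
proof -
  obtain c where c: "\<bar>c\<bar> \<le> C" "(nrm (\<lambda>x. signed_excess c (f x) (sgn_pair A B x)))\<^sup>2 =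
      (nrm (\<lambda>x. signed_excess (- c) (- f x) (sgn_pair A B x)))\<^sup>2"
    using balanced_level[OF f C AB] .
  define p where "p x = signed_excess c (f x) (sgn_pair A B x)" for x
  define q where "q x = signed_excess (- c) (- f x) (sgn_pair A B x)" for x
  have simple: "simple_function M p" "simple_function M q"
    using simple_function_compose1[OF simple_labelled[OF f AB(1,2)], of "\<lambda>u. signed_excess c (fst u) (snd u)"]
      simple_function_compose1[OF simple_labelled[OF f AB(1,2)], of "\<lambda>u. signed_excess (- c) (- fst u) (snd u)"]
    by (simp_all add: p_def[abs_def] q_def[abs_def])
  have "(nrm (restr (A \<union> B) f))\<^sup>2 \<le> (nrm p)\<^sup>2 + (nrm q)\<^sup>2"
    using nrm_signed_excess_ge[OF f AB orth] unfolding p_def q_def .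
  then have half: "(nrm (restr (A \<union> B) f))\<^sup>2 \<le> 2 * (nrm p)\<^sup>2" "(nrm (restr (A \<union> B) f))\<^sup>2 \<le> 2 * (nrm q)\<^sup>2"
    using c(2) unfolding p_def[symmetric] q_def[symmetric] by linarith+
  have "\<kappa>\<^sup>2 / 4 * (nrm (restr (A \<union> B) f))\<^sup>2 \<le> \<kappa>\<^sup>2 / 2 * (nrm p)\<^sup>2"
    "\<kappa>\<^sup>2 / 4 * (nrm (restr (A \<union> B) f))\<^sup>2 \<le> \<kappa>\<^sup>2 / 2 * (nrm q)\<^sup>2"
    using half[THEN mult_left_mono, of "\<kappa>\<^sup>2 / 4"] by auto
  moreover have "energy p \<le> energy f + 8 * C\<^sup>2 * defect A B"
    unfolding p_def by (rule energy_signed_excess[OF f C(2) c(1) AB])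
  moreover have "energy q \<le> energy f + 8 * C\<^sup>2 * defect A B"
    using energy_signed_excess[of "\<lambda>x. - f x" C "- c" A B] simple_function_uminus[OF f] C(2) c(1) AB
      energy_scale[OF simple_L2[OF f], of "-1"]
    by (simp add: q_def[abs_def] fun_Compl_def comp_def)
  ultimately have "energy p < \<kappa>\<^sup>2 / 2 * (nrm p)\<^sup>2" "energy q < \<kappa>\<^sup>2 / 2 * (nrm q)\<^sup>2" using small by linarith+
  then obtain A\<^sub>1 B\<^sub>1 A\<^sub>2 B\<^sub>2 where pairs: "almost_bipartite \<kappa> A\<^sub>1 B\<^sub>1" "almost_bipartite \<kappa> A\<^sub>2 B\<^sub>2"
    and support: "A\<^sub>1 \<union> B\<^sub>1 \<subseteq> {x \<in> space M. p x \<noteq> 0}" "A\<^sub>2 \<union> B\<^sub>2 \<subseteq> {x \<in> space M. q x \<noteq> 0}"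
    using dual_Cheeger_level_sets[OF simple(1) \<kappa>] dual_Cheeger_level_sets[OF simple(2) \<kappa>] by blast
  have "x \<in> A \<union> B \<and> q x = 0" if "p x \<noteq> 0" for x
    using that sgn_pair_iff[OF AB(3), of x]
    by (auto simp: p_def q_def signed_excess_def max_def split: if_splits)
  moreover have "x \<in> A \<union> B" if "q x \<noteq> 0" for x
    using that sgn_pair_iff[OF AB(3), of x] by (auto simp: q_def signed_excess_def)
  ultimately show ?thesis using that[OF pairs] support by fast
qed

section \<open>Families of almost bipartite pairs\<close>

definition almost_bipartite_family :: "nat \<Rightarrow> real \<Rightarrow> (nat \<Rightarrow> 'a set) \<Rightarrow> (nat \<Rightarrow> 'a set) \<Rightarrow> bool" where
  "almost_bipartite_family k \<delta> A B \<longleftrightarrow>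
    (\<forall>i<k. almost_bipartite \<delta> (A i) (B i)) \<and> disjoint_family_on (\<lambda>i. A i \<union> B i) {..<k}"

lemma almost_bipartite_familyD:
  assumes "almost_bipartite_family k \<delta> A B" "i < k"
  shows "almost_bipartite \<delta> (A i) (B i)" "A i \<in> sets M" "B i \<in> sets M" "A i \<inter> B i = {}"
  using assms by (auto simp: almost_bipartite_family_def almost_bipartite_def)

lemma almost_bipartite_family_disjoint:
  "almost_bipartite_family k \<delta> A B \<Longrightarrow> i < k \<Longrightarrow> j < k \<Longrightarrow> i \<noteq> j \<Longrightarrow> (A i \<union> B i) \<inter> (A j \<union> B j) = {}"
  unfolding almost_bipartite_family_def by (elim conjE disjoint_family_onD) auto

lemma almost_bipartite_family_insert:
  assumes fam: "almost_bipartite_family k \<delta> A B" and "\<delta> \<le> \<kappa>" and new: "almost_bipartite \<kappa> A' B'"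
    and disjoint: "\<And>i. i < k \<Longrightarrow> (A i \<union> B i) \<inter> (A' \<union> B') = {}"
  shows "almost_bipartite_family (Suc k) \<kappa> (A(k := A')) (B(k := B'))"
proof -
  have "almost_bipartite \<kappa> (A i) (B i)" if "i < k" for i
    using almost_bipartite_familyD(1)[OF fam that] \<open>\<delta> \<le> \<kappa>\<close> by (rule almost_bipartite_mono)
  moreover have "disjoint_family_on (\<lambda>i. (A(k := A')) i \<union> (B(k := B')) i) {..<Suc k}"
    unfolding disjoint_family_on_def
  proof (intro ballI impI)
    fix i j assume "i \<in> {..<Suc k}" "j \<in> {..<Suc k}" "i \<noteq> j"
    then show "((A(k := A')) i \<union> (B(k := B')) i) \<inter> ((A(k := A')) j \<union> (B(k := B')) j) = {}"
      using disjoint[of i] disjoint[of j] almost_bipartite_family_disjoint[OF fam, of i j]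
      by (cases "i = k"; cases "j = k") (auto simp: less_Suc_eq)
  qed
  ultimately show ?thesis using new by (simp add: almost_bipartite_family_def less_Suc_eq)
qed

lemma almost_bipartite_family_replace:
  assumes fam: "almost_bipartite_family k \<delta> A B" and "\<delta> \<le> \<kappa>" and i: "i < k"
    and new: "almost_bipartite \<kappa> A' B'" "A' \<union> B' \<subseteq> A i \<union> B i"
  shows "almost_bipartite_family k \<kappa> (A(i := A')) (B(i := B'))"
proof -
  have "almost_bipartite \<kappa> (A j) (B j)" if "j < k" for j
    using almost_bipartite_familyD(1)[OF fam that] \<open>\<delta> \<le> \<kappa>\<close> by (rule almost_bipartite_mono)
  moreover have "disjoint_family_on (\<lambda>j. (A(i := A')) j \<union> (B(i := B')) j) {..<k}"
    unfolding disjoint_family_on_def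
  proof (intro ballI impI)
    fix j l assume jl: "j \<in> {..<k}" "l \<in> {..<k}" "j \<noteq> l"
    then have "(A j \<union> B j) \<inter> (A l \<union> B l) = {}" by (intro almost_bipartite_family_disjoint[OF fam]) auto
    then show "((A(i := A')) j \<union> (B(i := B')) j) \<inter> ((A(i := A')) l \<union> (B(i := B')) l) = {}"
      using new(2) jl(3) by (cases "j = i"; cases "l = i") auto
  qed
  ultimately show ?thesis using new(1) by (simp add: almost_bipartite_family_def)
qed

lemma restr_L2:
  assumes f: "f \<in> L2 M" and D: "D \<in> sets M"
  shows "restr D f \<in> L2 M"
proof -
  have "integrable M (\<lambda>x. indicator D x *\<^sub>R (f x)\<^sup>2)"
    using D L2D(2)[OF f] by (rule integrable_mult_indicator)
  moreover have "(restr D f x)\<^sup>2 = indicator D x *\<^sub>R (f x)\<^sup>2" for x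
    by (simp add: restr_def indicator_def)
  ultimately show ?thesis using D L2D(1)[OF f] by (simp add: L2_def restr_def)
qed

lemma nrm_restr_power2:
  assumes "f \<in> L2 M" "D \<in> sets M"
  shows "(nrm (restr D f))\<^sup>2 = (\<integral>x. indicator D x * (f x)\<^sup>2 \<partial>M)"
  unfolding nrm_power2_eq_integral[OF restr_L2[OF assms]]
  by (intro Bochner_Integration.integral_cong) (auto simp: restr_def indicator_def)

lemma nrm_power2_partition:
  assumes f: "f \<in> L2 M" and I: "finite I" and D: "\<And>i. i \<in> I \<Longrightarrow> D i \<in> sets M"
    and disjoint: "disjoint_family_on D I"
  shows "(nrm f)\<^sup>2 = (nrm (restr (space M - (\<Union>i\<in>I. D i)) f))\<^sup>2 + (\<Sum>i\<in>I. (nrm (restr (D i) f))\<^sup>2)"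
proof -
  define R where "R = space M - (\<Union>i\<in>I. D i)"
  have R: "R \<in> sets M" unfolding R_def using I D by (intro sets.Diff sets.finite_UN) auto
  have integrable: "integrable M (\<lambda>x. indicator E x * (f x)\<^sup>2)" if "E \<in> sets M" for E
    using integrable_mult_indicator[OF that L2D(2)[OF f]] by simp
  have "(nrm f)\<^sup>2 = (\<integral>x. indicator R x * (f x)\<^sup>2 + (\<Sum>i\<in>I. indicator (D i) x * (f x)\<^sup>2) \<partial>M)"
    unfolding nrm_power2_eq_integral[OF f]
  proof (rule Bochner_Integration.integral_cong)
    fix x assume "x \<in> space M"
    then have "1 = indicator R x + (indicator (\<Union>i\<in>I. D i) x :: real)" by (auto simp: R_def indicator_def)
    also have "\<dots> = indicator R x + (\<Sum>i\<in>I. indicator (D i) x)"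
      using indicator_UN_disjoint[OF I disjoint] by simp
    finally have "1 * (f x)\<^sup>2 = (indicator R x + (\<Sum>i\<in>I. indicator (D i) x)) * (f x)\<^sup>2" by simp
    then show "(f x)\<^sup>2 = indicator R x * (f x)\<^sup>2 + (\<Sum>i\<in>I. indicator (D i) x * (f x)\<^sup>2)"
      by (simp only: distrib_right sum_distrib_right mult_1)
  qed simp
  also have "\<dots> = (\<integral>x. indicator R x * (f x)\<^sup>2 \<partial>M) + (\<integral>x. (\<Sum>i\<in>I. indicator (D i) x * (f x)\<^sup>2) \<partial>M)"
    using R D by (intro Bochner_Integration.integral_add Bochner_Integration.integrable_sum integrable)
  also have "(\<integral>x. (\<Sum>i\<in>I. indicator (D i) x * (f x)\<^sup>2) \<partial>M) = (\<Sum>i\<in>I. \<integral>x. indicator (D i) x * (f x)\<^sup>2 \<partial>M)"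
    using D by (intro Bochner_Integration.integral_sum integrable)
  finally show ?thesis using f R D by (simp add: nrm_restr_power2 R_def)
qed

lemma energy_restr_outside_family:
  assumes f: "simple_function M f" and C: "\<And>x. x \<in> space M \<Longrightarrow> \<bar>f x\<bar> \<le> C"
    and fam: "almost_bipartite_family k \<delta> A B" and \<delta>: "\<delta> > 0" and "m \<le> k"
  shows "energy (restr (space M - (\<Union>i<m. A i \<union> B i)) f) \<le> energy f + real m * (8 * C\<^sup>2 * \<delta>)"
  using \<open>m \<le> k\<close>
proof (induction m)
  case 0
  have "restr (space M) f x = f x" if "x \<in> space M" for x using that by (simp add: restr_def)
  then have "energy (restr (space M) f) = energy f"
    using f by (intro energy_cong simple_L2 simple_restr) auto
  then show ?case by simp
next
  case (Suc m)
  let ?R = "space M - (\<Union>i<m. A i \<union> B i)"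
  have m: "m < k" using Suc.prems by simp
  note AB = almost_bipartite_familyD[OF fam m]
  have "A i \<union> B i \<in> sets M" if "i < m" for i
    using almost_bipartite_familyD(2,3)[OF fam, of i] that m by auto
  then have R: "?R \<in> sets M" by (intro sets.Diff sets.finite_UN) auto
  have "restr (space M - (\<Union>i<Suc m. A i \<union> B i)) f = restr (space M - (A m \<union> B m)) (restr ?R f)"
    by (auto simp: restr_def fun_eq_iff indicator_def less_Suc_eq)
  moreover have "energy (restr (space M - (A m \<union> B m)) (restr ?R f)) \<le>
      energy (restr ?R f) + 8 * C\<^sup>2 * defect (A m) (B m)"
  proof (rule energy_restr_outside[OF simple_restr[OF f R] _ AB(2-4)])
    show "\<bar>restr ?R f x\<bar> \<le> C" if "x \<in> space M" for x
      using C[OF that] by (auto simp: restr_def indicator_def)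
  qed
  moreover have "8 * C\<^sup>2 * defect (A m) (B m) \<le> 8 * C\<^sup>2 * \<delta>"
    using almost_bipartite_defect(2)[OF AB(1) \<delta>] by (intro mult_left_mono) auto
  ultimately show ?case using Suc.IH m by (simp add: algebra_simps)
qed

subsection \<open>Enlarging a family\<close>

lemma extend_family_outside:
  assumes f: "simple_function M f" and fam: "almost_bipartite_family k \<delta> A B" and "\<delta> \<le> \<kappa>" and \<kappa>: "\<kappa> > 0"
  defines "g \<equiv> restr (space M - (\<Union>i<k. A i \<union> B i)) f"
  assumes small: "energy g < \<kappa>\<^sup>2 / 2 * (nrm g)\<^sup>2"
  shows "\<exists>A' B'. almost_bipartite_family (Suc k) \<kappa> A' B'"
proof -
  have "A i \<union> B i \<in> sets M" if "i < k" for i using almost_bipartite_familyD(2,3)[OF fam that] by auto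
  then have "simple_function M g"
    unfolding g_def using f by (intro simple_restr sets.Diff sets.finite_UN) auto
  from dual_Cheeger_level_sets[OF this \<kappa> small]
  obtain A' B' where new: "almost_bipartite \<kappa> A' B'" "A' \<union> B' \<subseteq> {x \<in> space M. g x \<noteq> 0}" by blast
  have "(A i \<union> B i) \<inter> (A' \<union> B') = {}" if "i < k" for i
  proof -
    have "g x = 0" if "x \<in> A i \<union> B i" for x
    proof -
      have "x \<notin> space M - (\<Union>i<k. A i \<union> B i)" using that \<open>i < k\<close> by blast
      then show ?thesis by (simp add: g_def restr_def)
    qed
    then show ?thesis using new(2) by blast
  qed
  from almost_bipartite_family_insert[OF fam \<open>\<delta> \<le> \<kappa>\<close> new(1) this] show ?thesis by blast
qed

lemma extend_family_by_splitting:
  assumes f: "simple_function M f" and C: "0 \<le> C" "\<And>x. x \<in> space M \<Longrightarrow> \<bar>f x\<bar> \<le> C"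
    and fam: "almost_bipartite_family k \<delta> A B" and "\<delta> \<le> \<kappa>" and \<kappa>: "\<kappa> > 0" and i: "i < k"
    and orth: "L2_inner M f (sgn_pair (A i) (B i)) = 0"
    and small: "energy f + 8 * C\<^sup>2 * defect (A i) (B i) < \<kappa>\<^sup>2 / 4 * (nrm (restr (A i \<union> B i) f))\<^sup>2"
  shows "\<exists>A' B'. almost_bipartite_family (Suc k) \<kappa> A' B'"
proof -
  obtain A\<^sub>1 B\<^sub>1 A\<^sub>2 B\<^sub>2 where pairs: "almost_bipartite \<kappa> A\<^sub>1 B\<^sub>1" "almost_bipartite \<kappa> A\<^sub>2 B\<^sub>2"
    "A\<^sub>1 \<union> B\<^sub>1 \<subseteq> A i \<union> B i" "A\<^sub>2 \<union> B\<^sub>2 \<subseteq> A i \<union> B i" "(A\<^sub>1 \<union> B\<^sub>1) \<inter> (A\<^sub>2 \<union> B\<^sub>2) = {}"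
    using split_pair[OF f C almost_bipartite_familyD(2-4)[OF fam i] orth \<kappa> small] .
  have "((A(i := A\<^sub>1)) l \<union> (B(i := B\<^sub>1)) l) \<inter> (A\<^sub>2 \<union> B\<^sub>2) = {}" if "l < k" for l
  proof (cases "l = i")
    case True
    then show ?thesis using pairs(5) by simp
  next
    case False
    then have "(A l \<union> B l) \<inter> (A i \<union> B i) = {}" by (rule almost_bipartite_family_disjoint[OF fam that i])
    then show ?thesis using False pairs(4) by auto
  qed
  from almost_bipartite_family_insert[OF
      almost_bipartite_family_replace[OF fam \<open>\<delta> \<le> \<kappa>\<close> i pairs(1,3)] order_refl pairs(2) this]
  show ?thesis by blast
qed

lemma large_summand:
  fixes t :: real
  assumes "t \<le> x + (\<Sum>i<k. y i)" "x < t / real (Suc k)"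
  shows "\<exists>i<k. t / real (Suc k) \<le> y i"
proof (rule ccontr)
  assume "\<not> ?thesis"
  then have "(\<Sum>i<k. y i) \<le> (\<Sum>i<k. t / real (Suc k))" by (intro sum_mono) (auto simp: not_le less_imp_le)
  then have "t < t / real (Suc k) + real k * (t / real (Suc k))" using assms by simp
  also have "\<dots> = real (Suc k) * (t / real (Suc k))" by (simp add: add_divide_distrib distrib_right)
  also have "\<dots> = t" by (simp del: of_nat_Suc)
  finally show False by simp
qed

lemma extend_family_of_orthogonal_function:
  assumes f: "simple_function M f" and C: "0 \<le> C" "\<And>x. x \<in> space M \<Longrightarrow> \<bar>f x\<bar> \<le> C"
    and fam: "almost_bipartite_family k \<delta> A B" and \<delta>: "0 < \<delta>" "\<delta> \<le> \<kappa>"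
    and orth: "\<And>i. i < k \<Longrightarrow> L2_inner M f (sgn_pair (A i) (B i)) = 0"
    and nrm: "1 / 4 \<le> (nrm f)\<^sup>2"
    and small: "energy f + real (Suc k) * (8 * C\<^sup>2 * \<delta>) < \<kappa>\<^sup>2 / 4 * (1 / (4 * real (Suc k)))"
  shows "\<exists>A' B'. almost_bipartite_family (Suc k) \<kappa> A' B'"
proof -
  define n where "n = real (Suc k)"
  define g where "g = restr (space M - (\<Union>i<k. A i \<union> B i)) f"
  have \<kappa>: "\<kappa> > 0" using \<delta> by simp
  have C\<delta>: "0 \<le> 8 * C\<^sup>2 * \<delta>" using \<delta>(1) by simp
  have "(nrm f)\<^sup>2 = (nrm g)\<^sup>2 + (\<Sum>i<k. (nrm (restr (A i \<union> B i) f))\<^sup>2)"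
    unfolding g_def using fam almost_bipartite_familyD(2,3)[OF fam]
    by (intro nrm_power2_partition simple_L2[OF f]) (auto simp: almost_bipartite_family_def)
  with nrm have total: "1 / 4 \<le> (nrm g)\<^sup>2 + (\<Sum>i<k. (nrm (restr (A i \<union> B i) f))\<^sup>2)" by simp
  show ?thesis
  proof (cases "1 / (4 * n) \<le> (nrm g)\<^sup>2")
    case True
    have "energy g \<le> energy f + real k * (8 * C\<^sup>2 * \<delta>)"
      unfolding g_def by (rule energy_restr_outside_family[OF f C(2) fam \<delta>(1) order_refl])
    also have "\<dots> < \<kappa>\<^sup>2 / 4 * (1 / (4 * n))" using small C\<delta> by (simp add: n_def algebra_simps)
    also have "\<dots> \<le> \<kappa>\<^sup>2 / 2 * (nrm g)\<^sup>2" using True \<kappa> by (intro mult_mono) (auto simp: n_def)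
    finally show ?thesis unfolding g_def by (rule extend_family_outside[OF f fam \<delta>(2) \<kappa>])
  next
    case False
    then obtain i where i: "i < k" "1 / (4 * n) \<le> (nrm (restr (A i \<union> B i) f))\<^sup>2"
      using large_summand[OF total] by (auto simp: n_def)
    have "8 * C\<^sup>2 * defect (A i) (B i) \<le> 8 * C\<^sup>2 * \<delta>"
      using almost_bipartite_defect(2)[OF almost_bipartite_familyD(1)[OF fam i(1)] \<delta>(1)]
      by (intro mult_left_mono) auto
    also have "\<dots> \<le> n * (8 * C\<^sup>2 * \<delta>)" using mult_right_mono[OF _ C\<delta>, of 1 n] by (simp add: n_def)
    finally have "energy f + 8 * C\<^sup>2 * defect (A i) (B i) < \<kappa>\<^sup>2 / 4 * (1 / (4 * n))"
      using small by (simp add: n_def)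
    also have "\<dots> \<le> \<kappa>\<^sup>2 / 4 * (nrm (restr (A i \<union> B i) f))\<^sup>2" using i(2) by (intro mult_left_mono) auto
    finally have "energy f + 8 * C\<^sup>2 * defect (A i) (B i) < \<kappa>\<^sup>2 / 4 * (nrm (restr (A i \<union> B i) f))\<^sup>2" .
    then show ?thesis
      using C(2) by (intro extend_family_by_splitting[OF f C(1) _ fam \<delta>(2) \<kappa> i(1) orth[OF i(1)]])
  qed
qed

subsection \<open>Simple functions of low energy\<close>

lemma almost_orthonormal_simple_functions:
  assumes "\<not> ess_coercive (shift P (-1))" and \<tau>: "\<tau> > 0"
  shows "\<exists>v w. (\<forall>i<n::nat. v i \<in> L2 M \<and> simple_function M (w i) \<and> nrm (w i - v i) < \<tau> \<and>
      energy.nrm (w i) \<le> 3 * \<tau>) \<and>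
    (\<forall>i<n. \<forall>j<n. L2_inner M (v i) (v j) = (if i = j then 1 else 0))"
proof -
  obtain v where v: "\<And>i. i < n \<Longrightarrow> v i \<in> L2 M" "\<And>i. i < n \<Longrightarrow> energy (v i) < \<tau>\<^sup>2"
    and orthonormal: "\<forall>i<n. \<forall>j<n. L2_inner M (v i) (v j) = (if i = j then 1 else 0)"
    using not_ess_coercive_orthonormal_family[OF symop_energy psd_energy assms(1), of "\<tau>\<^sup>2" n] \<tau>
    by (auto simp: energy_def)
  have "\<exists>w. simple_function M w \<and> nrm (w - v i) < \<tau> \<and> energy.nrm w \<le> 3 * \<tau>" if i: "i < n" for i
  proof -
    obtain s where s: "\<And>m. simple_function M (s m)" "nrm_converges s (v i)"
      using simple_dense[OF v(1)[OF i]] by metis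
    obtain m where m: "nrm (s m - v i) < \<tau>"
      using order_tendstoD(2)[OF nrm_convergesD(3)[OF s(2)] \<tau>] by (auto simp: eventually_sequentially)
    have L2: "s m \<in> L2 M" "s m - v i \<in> L2 M" using simple_L2[OF s(1)] v(1)[OF i] by auto
    have "energy.nrm (v i) \<le> \<tau>"
    proof (rule power2_le_imp_le)
      show "(energy.nrm (v i))\<^sup>2 \<le> \<tau>\<^sup>2" using v(2)[OF i] by (simp add: energy_nrm_power2[OF v(1)[OF i]])
    qed (use \<tau> in simp)
    moreover have "energy.nrm (s m - v i) \<le> 2 * \<tau>"
    proof (rule power2_le_imp_le)
      have "energy (s m - v i) \<le> 2 * (nrm (s m - v i))\<^sup>2" by (rule energy_le[OF L2(2)])
      also have "\<dots> \<le> 2 * \<tau>\<^sup>2" using m L2(2) by (intro mult_left_mono power_mono) auto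
      also have "\<dots> \<le> (2 * \<tau>)\<^sup>2" by (simp add: power_mult_distrib)
      finally show "(energy.nrm (s m - v i))\<^sup>2 \<le> (2 * \<tau>)\<^sup>2" by (simp add: energy_nrm_power2[OF L2(2)])
    qed (use \<tau> in simp)
    moreover have "energy.nrm (s m) \<le> energy.nrm (v i) + energy.nrm (s m - v i)"
      using energy.nrm_triangle[OF v(1)[OF i] L2(2)] by simp
    ultimately show ?thesis using s(1) m by (intro exI[of _ "s m"]) auto
  qed
  then obtain w where "\<forall>i<n. simple_function M (w i) \<and> nrm (w i - v i) < \<tau> \<and> energy.nrm (w i) \<le> 3 * \<tau>"
    by metis
  then show ?thesis using v(1) orthonormal by blast
qed

definition test_function :: "real \<Rightarrow> real \<Rightarrow> ('a \<Rightarrow> real) \<Rightarrow> bool" where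
  "test_function \<theta> C f \<longleftrightarrow> simple_function M f \<and> (\<forall>x\<in>space M. \<bar>f x\<bar> \<le> C) \<and> 1 / 4 \<le> (nrm f)\<^sup>2 \<and> energy f \<le> \<theta>"

lemma nrm_normalized_combination_ge:
  assumes v: "\<And>i. i < n \<Longrightarrow> v i \<in> L2 M"
    and orthonormal: "\<And>i j. i < n \<Longrightarrow> j < n \<Longrightarrow> L2_inner M (v i) (v j) = (if i = j then 1 else 0)"
    and w: "\<And>i. i < n \<Longrightarrow> w i \<in> L2 M" "\<And>i. i < n \<Longrightarrow> nrm (w i - v i) \<le> \<tau>"
    and a: "(\<Sum>l<n. (a l)\<^sup>2) = 1" "\<And>l. l < n \<Longrightarrow> \<bar>a l\<bar> \<le> 1"
  shows "1 - real n * \<tau> \<le> nrm (\<Sum>l<n. a l *\<^sub>R w l)"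
proof -
  let ?f = "\<Sum>l<n. a l *\<^sub>R w l" and ?g = "\<Sum>l<n. a l *\<^sub>R v l"
  have L2: "?f \<in> L2 M" "?g \<in> L2 M" using v w(1) by auto
  have "(nrm ?g)\<^sup>2 = (\<Sum>l<n. (nrm (a l *\<^sub>R v l))\<^sup>2)"
    using v orthonormal by (intro nrm_sum_power2_orthogonal) (auto simp: ip_simps)
  also have "\<dots> = (\<Sum>l<n. (a l)\<^sup>2)"
    using v orthonormal by (intro sum.cong) (auto simp: nrm_scale power_mult_distrib nrm_power2)
  finally have "(nrm ?g)\<^sup>2 = 1\<^sup>2" using a(1) by simp
  then have "nrm ?g = 1"
    using L2(2) by (simp add: power2_eq_1_iff) (metis nrm_nonneg neg_0_le_iff_le not_one_le_zero)
  have "?g - ?f = - (\<Sum>l<n. a l *\<^sub>R (w l - v l))"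
    by (simp add: scaleR_diff_right sum_subtractf)
  then have "nrm (?g - ?f) = nrm (\<Sum>l<n. a l *\<^sub>R (w l - v l))"
    using nrm_minus_commute[OF L2] by (simp add: scaleR_diff_right sum_subtractf)
  also have "\<dots> \<le> real (card {..<n}) * \<tau>"
    using v w a(2) by (intro nrm_combination_le) auto
  finally have "nrm (?g - ?f) \<le> real n * \<tau>" by simp
  then show ?thesis using nrm_le_diff[OF L2(2,1)] \<open>nrm ?g = 1\<close> by simp
qed

lemma test_function_combination:
  assumes v: "\<And>i. i < n \<Longrightarrow> v i \<in> L2 M"
    and orthonormal: "\<And>i j. i < n \<Longrightarrow> j < n \<Longrightarrow> L2_inner M (v i) (v j) = (if i = j then 1 else 0)"
    and w: "\<And>i. i < n \<Longrightarrow> simple_function M (w i)" "\<And>i. i < n \<Longrightarrow> nrm (w i - v i) \<le> \<tau>"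
      "\<And>i. i < n \<Longrightarrow> energy.nrm (w i) \<le> \<rho>"
    and c: "\<And>i. i < n \<Longrightarrow> 0 \<le> c i" "\<And>i x. i < n \<Longrightarrow> x \<in> space M \<Longrightarrow> \<bar>w i x\<bar> \<le> c i"
    and small: "real n * \<tau> \<le> 1 / 2" "real n * \<rho> \<le> sqrt \<theta>" "0 \<le> \<theta>"
    and a: "(\<Sum>l<n. (a l)\<^sup>2) = 1" "\<And>l. l < n \<Longrightarrow> \<bar>a l\<bar> \<le> 1"
  shows "test_function \<theta> (\<Sum>i<n. c i) (\<Sum>l<n. a l *\<^sub>R w l)"
  unfolding test_function_def
proof (intro conjI ballI)
  let ?f = "\<Sum>l<n. a l *\<^sub>R w l"
  have w_L2: "w i \<in> L2 M" if "i < n" for i using w(1)[OF that] by (rule simple_L2)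
  have f_apply: "?f = (\<lambda>x. \<Sum>l<n. a l * w l x)" by (simp add: fun_eq_iff sum_fun_apply)
  show "simple_function M ?f"
    unfolding f_apply
    using w(1) by (intro simple_function_sum simple_function_mult simple_function_const) auto
  show "\<bar>?f x\<bar> \<le> (\<Sum>i<n. c i)" if "x \<in> space M" for x
  proof -
    have "\<bar>?f x\<bar> \<le> (\<Sum>l<n. \<bar>a l * w l x\<bar>)" unfolding f_apply by (rule sum_abs)
    also have "\<dots> \<le> (\<Sum>l<n. 1 * c l)"
      unfolding abs_mult using a(2) c that by (intro sum_mono mult_mono) auto
    finally show ?thesis by simp
  qed
  have "1 - real n * \<tau> \<le> nrm ?f" by (rule nrm_normalized_combination_ge[OF v orthonormal w_L2 w(2) a])
  then have "(1 / 2)\<^sup>2 \<le> (nrm ?f)\<^sup>2" using small(1) by (intro power_mono) auto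
  then show "1 / 4 \<le> (nrm ?f)\<^sup>2" by (simp add: power2_eq_square)
  have f_L2: "?f \<in> L2 M" using w_L2 by auto
  have "energy.nrm ?f \<le> real (card {..<n}) * \<rho>"
    using w_L2 w(3) a(2) by (intro energy.nrm_combination_le) auto
  also have "\<dots> \<le> sqrt \<theta>" using small(2) by simp
  finally have "(energy.nrm ?f)\<^sup>2 \<le> (sqrt \<theta>)\<^sup>2" using f_L2 by (intro power_mono energy.nrm_nonneg) auto
  then show "energy ?f \<le> \<theta>" using small(3) f_L2 by (simp add: energy_nrm_power2)
qed

lemma low_energy_test_functions:
  assumes "\<not> ess_coercive (shift P (-1))" and \<theta>: "\<theta> > 0"
  shows "\<exists>w C. 0 \<le> C \<and> (\<forall>l<n::nat. w l \<in> L2 M) \<and>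
    (\<forall>a. (\<Sum>l<n. (a l)\<^sup>2) = 1 \<longrightarrow> (\<forall>l<n. \<bar>a l\<bar> \<le> 1) \<longrightarrow> test_function \<theta> C (\<Sum>l<n. a l *\<^sub>R w l))"
proof -
  define \<tau> where "\<tau> = min (1 / (2 * real (Suc n))) (sqrt \<theta> / (3 * real (Suc n)))"
  have \<tau>: "\<tau> > 0" using \<theta> by (simp add: \<tau>_def)
  have n\<tau>: "real n * \<tau> \<le> 1 / 2" "real n * (3 * \<tau>) \<le> sqrt \<theta>"
  proof -
    have "real n * \<tau> \<le> real (Suc n) * (1 / (2 * real (Suc n)))"
      using \<tau> by (intro mult_mono) (auto simp: \<tau>_def)
    also have "\<dots> = 1 / 2" by (simp add: field_simps del: of_nat_Suc)
    finally show "real n * \<tau> \<le> 1 / 2" .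
    have "real n * (3 * \<tau>) \<le> real (Suc n) * (3 * (sqrt \<theta> / (3 * real (Suc n))))"
      using \<tau> by (intro mult_mono) (auto simp: \<tau>_def)
    also have "\<dots> = sqrt \<theta>" by (simp add: field_simps del: of_nat_Suc)
    finally show "real n * (3 * \<tau>) \<le> sqrt \<theta>" .
  qed
  obtain v w where v: "\<And>i. i < n \<Longrightarrow> v i \<in> L2 M"
    and orthonormal: "\<And>i j. i < n \<Longrightarrow> j < n \<Longrightarrow> L2_inner M (v i) (v j) = (if i = j then 1 else 0)"
    and w: "\<And>i. i < n \<Longrightarrow> simple_function M (w i)" "\<And>i. i < n \<Longrightarrow> nrm (w i - v i) < \<tau>"
      "\<And>i. i < n \<Longrightarrow> energy.nrm (w i) \<le> 3 * \<tau>"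
    using almost_orthonormal_simple_functions[OF assms(1) \<tau>, of n] by blast
  have w_L2: "w i \<in> L2 M" if "i < n" for i using w(1)[OF that] by (rule simple_L2)
  have "\<exists>c\<ge>0. \<forall>x\<in>space M. \<bar>w i x\<bar> \<le> c" if "i < n" for i
    using simple_function_bounded[OF w(1)[OF that]] by metis
  then obtain c where c: "\<And>i. i < n \<Longrightarrow> 0 \<le> c i" "\<And>i x. i < n \<Longrightarrow> x \<in> space M \<Longrightarrow> \<bar>w i x\<bar> \<le> c i" by metis
  have "test_function \<theta> (\<Sum>i<n. c i) (\<Sum>l<n. a l *\<^sub>R w l)"
    if "(\<Sum>l<n. (a l)\<^sup>2) = 1" "\<forall>l<n. \<bar>a l\<bar> \<le> 1" for a
    using \<theta> that(2)
    by (intro test_function_combination[OF v orthonormal w(1) less_imp_le[OF w(2)] w(3) c n\<tau> _ that(1)])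
      auto
  then show ?thesis using w_L2 c(1) by (intro exI[of _ w] exI[of _ "\<Sum>i<n. c i"]) (auto intro: sum_nonneg)
qed

subsection \<open>Coercivity and the size of families\<close>

text \<open>The order of choices matters: the sup norm bound \<open>C\<close> of the test functions is fixed before the
  family is chosen, so its defects can be made small compared with \<open>C\<close>.\<close>

lemma extend_family:
  assumes "\<not> ess_coercive (shift P (-1))" and \<kappa>: "\<kappa> > 0"
    and fam: "\<And>\<delta>. \<delta> > 0 \<Longrightarrow> \<exists>A B. almost_bipartite_family k \<delta> A B"
  shows "\<exists>A B. almost_bipartite_family (Suc k) \<kappa> A B"
proof -
  define n where "n = Suc k"
  have n: "real n > 0" by (simp add: n_def)
  define \<theta> where "\<theta> = \<kappa>\<^sup>2 / (32 * n)"
  have \<theta>: "\<theta> > 0" using \<kappa> n by (simp add: \<theta>_def)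
  obtain w C where C: "0 \<le> C" and w: "\<forall>l<n. w l \<in> L2 M"
    and test: "\<And>a. (\<Sum>l<n. (a l)\<^sup>2) = 1 \<Longrightarrow> \<forall>l<n. \<bar>a l\<bar> \<le> 1 \<Longrightarrow> test_function \<theta> C (\<Sum>l<n. a l *\<^sub>R w l)"
    using low_energy_test_functions[OF assms(1) \<theta>, of n] by blast
  define \<delta> where "\<delta> = min \<kappa> (\<theta> / (16 * (C\<^sup>2 + 1) * n))"
  have C1: "0 < 16 * (C\<^sup>2 + 1) * real n" using n by (intro mult_pos_pos) (auto intro: add_nonneg_pos)
  have \<delta>: "0 < \<delta>" "\<delta> \<le> \<kappa>" using \<kappa> \<theta> C1 by (auto simp: \<delta>_def)
  have "real n * (8 * C\<^sup>2 * \<delta>) \<le> 8 * (C\<^sup>2 + 1) * n * \<delta>" using n \<delta> by (simp add: algebra_simps)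
  also have "\<dots> \<le> 8 * (C\<^sup>2 + 1) * n * (\<theta> / (16 * (C\<^sup>2 + 1) * n))"
    using n by (intro mult_left_mono) (auto simp: \<delta>_def)
  also have "\<dots> = \<theta> / 2" using C1 by (simp add: field_simps)
  finally have C\<delta>: "real n * (8 * C\<^sup>2 * \<delta>) \<le> \<theta> / 2" .
  obtain A B where AB: "almost_bipartite_family k \<delta> A B" using fam[OF \<delta>(1)] by blast
  define S where "S = (\<lambda>i. sgn_pair (A i) (B i)) ` {..<k}"
  have S: "finite S" "S \<subseteq> L2 M" "card S < card {..<n}"
    using almost_bipartite_familyD(2,3)[OF AB] card_image_le[of "{..<k}" "\<lambda>i. sgn_pair (A i) (B i)"]
    by (auto simp: S_def n_def sgn_pair_L2)
  obtain a where a: "(\<Sum>l<n. (a l)\<^sup>2) = 1" "\<forall>l<n. \<bar>a l\<bar> \<le> 1" and orth: "(\<Sum>l<n. a l *\<^sub>R w l) \<in> orth S"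
    using normalized_combination_orth[OF S(1,2) finite_lessThan S(3), of w] w by (auto simp: Ball_def)
  define f where "f = (\<Sum>l<n. a l *\<^sub>R w l)"
  have f: "simple_function M f" "\<And>x. x \<in> space M \<Longrightarrow> \<bar>f x\<bar> \<le> C" "1 / 4 \<le> (nrm f)\<^sup>2" "energy f \<le> \<theta>"
    using test[OF a] by (auto simp: test_function_def f_def)
  have "L2_inner M f (sgn_pair (A i) (B i)) = 0" if "i < k" for i
    using orthD(2)[OF orth] that by (simp add: S_def f_def)
  moreover have "energy f + real n * (8 * C\<^sup>2 * \<delta>) < \<kappa>\<^sup>2 / 4 * (1 / (4 * real n))"
  proof -
    have "energy f + real n * (8 * C\<^sup>2 * \<delta>) < 2 * \<theta>" using f(4) C\<delta> \<theta> by linarith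
    then show ?thesis by (simp add: \<theta>_def)
  qed
  ultimately show ?thesis
    unfolding n_def by (intro extend_family_of_orthogonal_function[OF f(1) C f(2) AB \<delta> _ f(3)])
qed

lemma not_ess_coercive_imp_family:
  assumes "\<not> ess_coercive (shift P (-1))" "\<delta> > 0"
  shows "\<exists>A B. almost_bipartite_family k \<delta> A B"
  using assms(2)
proof (induction k arbitrary: \<delta>)
  case 0
  then show ?case by (simp add: almost_bipartite_family_def disjoint_family_on_def)
next
  case (Suc k)
  show ?case by (rule extend_family[OF assms(1) Suc.prems Suc.IH])
qed

lemma sgn_pair_orthogonal:
  assumes "(A \<union> B) \<inter> (A' \<union> B') = {}"
  shows "L2_inner M (sgn_pair A B) (sgn_pair A' B') = 0"
proof -
  have "sgn_pair A B x * sgn_pair A' B' x = 0" for x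
    using assms by (auto simp: sgn_pair_def indicator_def)
  then show ?thesis by (simp only: L2_inner_def integral_zero)
qed

lemma energy_combination_sgn_pairs:
  assumes fam: "almost_bipartite_family k \<delta> A B" and \<delta>: "\<delta> > 0"
  shows "energy (\<Sum>l<k. a l *\<^sub>R sgn_pair (A l) (B l))
    \<le> 2 * real k * \<delta> * (\<Sum>l<k. (a l)\<^sup>2 * measure M (A l \<union> B l))"
proof -
  define s where "s l = sgn_pair (A l) (B l)" for l
  have s_L2: "s l \<in> L2 M" if "l < k" for l
    using almost_bipartite_familyD(2,3)[OF fam that] by (simp add: s_def sgn_pair_L2)
  have combination_L2: "(\<Sum>l<k. a l *\<^sub>R s l) \<in> L2 M" using s_L2 by auto
  have "energy (\<Sum>l<k. a l *\<^sub>R s l) = (energy.nrm (\<Sum>l<k. a l *\<^sub>R s l))\<^sup>2"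
    by (rule energy_nrm_power2[OF combination_L2, symmetric])
  also have "\<dots> \<le> real (card {..<k}) * (\<Sum>l<k. (energy.nrm (a l *\<^sub>R s l))\<^sup>2)"
    using s_L2 by (intro energy.nrm_sum_power2_le) auto
  also have "\<dots> = real k * (\<Sum>l<k. (a l)\<^sup>2 * energy (s l))"
    using s_L2 by (simp add: energy_nrm_power2 energy_scale)
  also have "\<dots> \<le> real k * (\<Sum>l<k. (a l)\<^sup>2 * (2 * \<delta> * measure M (A l \<union> B l)))"
  proof (intro mult_left_mono sum_mono)
    fix l assume "l \<in> {..<k}"
    then have l: "l < k" by simp
    have "energy (s l) \<le> 2 * defect (A l) (B l)"
      unfolding s_def by (rule energy_sgn_pair[OF almost_bipartite_familyD(2-4)[OF fam l]])
    then show "energy (s l) \<le> 2 * \<delta> * measure M (A l \<union> B l)"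
      using almost_bipartite_defect(1)[OF almost_bipartite_familyD(1)[OF fam l] \<delta>] by simp
  qed auto
  finally show ?thesis by (simp add: s_def sum_distrib_left mult_ac)
qed

lemma nrm_combination_sgn_pairs:
  assumes fam: "almost_bipartite_family k \<delta> A B"
  shows "(nrm (\<Sum>l<k. a l *\<^sub>R sgn_pair (A l) (B l)))\<^sup>2 = (\<Sum>l<k. (a l)\<^sup>2 * measure M (A l \<union> B l))"
proof -
  have L2: "sgn_pair (A l) (B l) \<in> L2 M"
    and sgn_pair_nrm: "(nrm (sgn_pair (A l) (B l)))\<^sup>2 = measure M (A l \<union> B l)" if "l < k" for l
    using almost_bipartite_familyD[OF fam that] by (simp_all add: sgn_pair_L2 nrm_sgn_pair)
  have "(nrm (\<Sum>l<k. a l *\<^sub>R sgn_pair (A l) (B l)))\<^sup>2 = (\<Sum>l<k. (nrm (a l *\<^sub>R sgn_pair (A l) (B l)))\<^sup>2)"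
  proof (rule nrm_sum_power2_orthogonal)
    fix i j assume ij: "i \<in> {..<k}" "j \<in> {..<k}" "i \<noteq> j"
    then have "L2_inner M (sgn_pair (A i) (B i)) (sgn_pair (A j) (B j)) = 0"
      by (intro sgn_pair_orthogonal almost_bipartite_family_disjoint[OF fam]) auto
    then show "L2_inner M (a i *\<^sub>R sgn_pair (A i) (B i)) (a j *\<^sub>R sgn_pair (A j) (B j)) = 0"
      using ij L2 by (simp add: ip_simps)
  qed (use L2 in auto)
  also have "\<dots> = (\<Sum>l<k. (a l)\<^sup>2 * measure M (A l \<union> B l))"
    using L2 sgn_pair_nrm by (intro sum.cong) (auto simp: nrm_scale power_mult_distrib)
  finally show ?thesis .
qed

lemma ess_coercive_imp_no_family:
  assumes "ess_coercive (shift P (-1))"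
  shows "\<exists>k. \<exists>\<delta>>0. \<forall>A B. \<not> almost_bipartite_family k \<delta> A B"
proof -
  obtain K \<epsilon> where K: "finite K" "K \<subseteq> L2 M" and \<epsilon>: "\<epsilon> > 0" "\<And>f. f \<in> orth K \<Longrightarrow> \<epsilon> * (nrm f)\<^sup>2 \<le> energy f"
    using assms by (auto simp: ess_coercive_def coercive_on_def energy_def)
  define k where "k = Suc (card K)"
  define \<delta> where "\<delta> = \<epsilon> / (4 * real k)"
  have k: "real k > 0" by (simp add: k_def)
  then have \<delta>: "\<delta> > 0" using \<epsilon>(1) by (simp add: \<delta>_def)
  have "\<not> almost_bipartite_family k \<delta> A B" for A B
  proof
    assume fam: "almost_bipartite_family k \<delta> A B"
    define s where "s l = sgn_pair (A l) (B l)" for l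
    define f where "f a = (\<Sum>l<k. a l *\<^sub>R s l)" for a
    have "card K < card {..<k}" by (simp add: k_def)
    moreover have "s l \<in> L2 M" if "l < k" for l
      using almost_bipartite_familyD(2,3)[OF fam that] by (simp add: s_def sgn_pair_L2)
    ultimately obtain a where a: "(\<Sum>l<k. (a l)\<^sup>2) = 1" and orth: "f a \<in> orth K"
      using normalized_combination_orth[OF K finite_lessThan, of k s] by (auto simp: f_def)
    have f_nrm: "(nrm (f a))\<^sup>2 = (\<Sum>l<k. (a l)\<^sup>2 * measure M (A l \<union> B l))"
      unfolding f_def s_def by (rule nrm_combination_sgn_pairs[OF fam])
    have "0 < (nrm (f a))\<^sup>2"
    proof -
      have "(\<Sum>l<k. (a l)\<^sup>2) \<noteq> 0" using a by simp
      then obtain l where "l \<in> {..<k}" "(a l)\<^sup>2 \<noteq> 0" by (rule sum.not_neutral_contains_not_neutral)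
      then show ?thesis
        unfolding f_nrm using almost_bipartite_familyD(1)[OF fam]
        by (intro sum_pos2[of _ l]) (auto simp: almost_bipartite_def)
    qed
    have "\<epsilon> * (nrm (f a))\<^sup>2 \<le> energy (f a)" using \<epsilon>(2) orth by simp
    also have "\<dots> \<le> 2 * real k * \<delta> * (nrm (f a))\<^sup>2"
      unfolding f_nrm unfolding f_def s_def by (rule energy_combination_sgn_pairs[OF fam \<delta>])
    also have "\<dots> = \<epsilon> / 2 * (nrm (f a))\<^sup>2" using k by (simp add: \<delta>_def)
    finally show False using \<epsilon>(1) \<open>0 < (nrm (f a))\<^sup>2\<close> by simp
  qed
  then show ?thesis using \<delta> by blast
qed

section \<open>The dual Cheeger constants\<close>

definition disjoint_pairs :: "nat \<Rightarrow> (nat \<Rightarrow> 'a set) \<Rightarrow> (nat \<Rightarrow> 'a set) \<Rightarrow> bool" where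
  "disjoint_pairs k A B \<longleftrightarrow>
    (\<forall>i<k. A i \<in> sets M \<and> B i \<in> sets M \<and> A i \<inter> B i = {} \<and> 0 < measure M (A i \<union> B i)) \<and>
    disjoint_family_on (\<lambda>i. A i \<union> B i) {..<k}"

definition ratio :: "'a set \<Rightarrow> 'a set \<Rightarrow> real" where
  "ratio A B = 2 * L2_inner M (indicator A) (P (indicator B)) / measure M (A \<union> B)"

definition cheeger_values :: "nat \<Rightarrow> real set" where
  "cheeger_values k = {Min ((\<lambda>i. ratio (A i) (B i)) ` {..<k}) | A B. disjoint_pairs k A B}"

lemma index_of_pair: "\<exists>i<k. p = 2 * i + 1 \<or> p = 2 * i + 2" if "p \<in> {1..2*k}" for p k :: nat
  using that by (intro exI[of _ "(p - 1) div 2"]) (auto; presburger)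

lemma disjoint_interleaved:
  fixes A :: "nat \<Rightarrow> 'b set"
  shows "(\<forall>p\<in>{1..2*k}. \<forall>q\<in>{1..2*k}. p \<noteq> q \<longrightarrow> A p \<inter> A q = {}) \<longleftrightarrow>
    (\<forall>i<k. A (2 * i + 1) \<inter> A (2 * i + 2) = {}) \<and>
    disjoint_family_on (\<lambda>i. A (2 * i + 1) \<union> A (2 * i + 2)) {..<k}"
    (is "?disjoint \<longleftrightarrow> ?within \<and> ?between")
proof (intro iffI conjI allI impI)
  assume ?disjoint
  then show "A (2 * i + 1) \<inter> A (2 * i + 2) = {}" if "i < k" for i
    using that by auto
  show ?between
    unfolding disjoint_family_on_def
  proof (intro ballI impI)
    fix i j assume ij: "i \<in> {..<k}" "j \<in> {..<k}" "i \<noteq> j"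
    have "A p \<inter> A q = {}" if "p \<in> {2 * i + 1, 2 * i + 2}" "q \<in> {2 * j + 1, 2 * j + 2}" for p q
    proof -
      have "p \<in> {1..2*k}" "q \<in> {1..2*k}" "p \<noteq> q" using that ij by (auto; presburger)+
      then show ?thesis using \<open>?disjoint\<close> by blast
    qed
    then show "(A (2 * i + 1) \<union> A (2 * i + 2)) \<inter> (A (2 * j + 1) \<union> A (2 * j + 2)) = {}"
      by (simp add: Int_Un_distrib Int_Un_distrib2)
  qed
next
  assume within_between: "?within \<and> ?between"
  show ?disjoint
  proof (intro ballI impI)
    fix p q assume pq: "p \<in> {1..2*k}" "q \<in> {1..2*k}" "p \<noteq> q"
    obtain i j where ij: "i < k" "p = 2 * i + 1 \<or> p = 2 * i + 2" "j < k" "q = 2 * j + 1 \<or> q = 2 * j + 2"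
      using index_of_pair[OF pq(1)] index_of_pair[OF pq(2)] by blast
    show "A p \<inter> A q = {}"
    proof (cases "i = j")
      case True
      then show ?thesis using ij pq(3) within_between by auto
    next
      case False
      then have "(A (2 * i + 1) \<union> A (2 * i + 2)) \<inter> (A (2 * j + 1) \<union> A (2 * j + 2)) = {}"
        using within_between ij(1,3) by (auto simp: disjoint_family_on_def)
      then show ?thesis using ij(2,4) by auto
    qed
  qed
qed

lemma interleaved_pairs:
  "disjoint_pairs k (\<lambda>i. A (2 * i + 1)) (\<lambda>i. A (2 * i + 2)) \<longleftrightarrow>
    (\<forall>p\<in>{1..2*k}. A p \<in> sets M) \<and> (\<forall>p\<in>{1..2*k}. \<forall>q\<in>{1..2*k}. p \<noteq> q \<longrightarrow> A p \<inter> A q = {}) \<and>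
    (\<forall>i\<in>{1..k}. measure M (A (2*i-1) \<union> A (2*i)) > 0)"
    (is "_ \<longleftrightarrow> ?sets \<and> _ \<and> ?positive")
proof -
  have index_range: "2 * i + 1 \<in> {1..2*k}" "2 * i + 2 \<in> {1..2*k}" if "i < k" for i using that by auto
  have "{1..k} = Suc ` {..<k}" by (simp add: image_Suc_lessThan)
  then have positive: "?positive \<longleftrightarrow> (\<forall>i<k. 0 < measure M (A (2 * i + 1) \<union> A (2 * i + 2)))" by auto
  have sets: "?sets \<longleftrightarrow> (\<forall>i<k. A (2 * i + 1) \<in> sets M \<and> A (2 * i + 2) \<in> sets M)"
    using index_of_pair index_range by blast
  show ?thesis unfolding positive sets disjoint_interleaved disjoint_pairs_def by blast
qed

lemma dual_cheeger_eq: "dual_cheeger M P k = Sup (cheeger_values k)"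
proof -
  let ?odd = "\<lambda>A :: nat \<Rightarrow> 'a set. \<lambda>i. A (2 * i + 1)" and ?even = "\<lambda>A :: nat \<Rightarrow> 'a set. \<lambda>i. A (2 * i + 2)"
  have "{1..k} = Suc ` {..<k}" by (simp add: image_Suc_lessThan)
  then have ratios: "(\<lambda>i. 2 * L2_inner M (indicator (A (2*i-1))) (P (indicator (A (2*i)))) /
      measure M (A (2*i-1) \<union> A (2*i))) ` {1..k} = (\<lambda>i. ratio (?odd A i) (?even A i)) ` {..<k}" for A
    by (simp add: image_image ratio_def)
  have "dual_cheeger M P k =
      Sup {Min ((\<lambda>i. ratio (?odd A i) (?even A i)) ` {..<k}) | A. disjoint_pairs k (?odd A) (?even A)}"
    unfolding dual_cheeger_def interleaved_pairs[symmetric] ratios ..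
  also have "{Min ((\<lambda>i. ratio (?odd A i) (?even A i)) ` {..<k}) | A. disjoint_pairs k (?odd A) (?even A)} =
      cheeger_values k"
    (is "?values = _")
  proof
    show "cheeger_values k \<subseteq> ?values"
    proof
      fix m assume "m \<in> cheeger_values k"
      then obtain A B where AB: "m = Min ((\<lambda>i. ratio (A i) (B i)) ` {..<k})" "disjoint_pairs k A B"
        by (auto simp: cheeger_values_def)
      define C where "C p = (if odd p then A (p div 2) else B (p div 2 - 1))" for p
      have C: "C (2 * i + 1) = A i" "C (2 * i + 2) = B i" for i by (simp_all add: C_def)
      show "m \<in> ?values" by (intro CollectI exI[of _ C]) (simp only: C AB simp_thms)
    qed
  qed (auto simp: cheeger_values_def)
  finally show ?thesis .
qed

lemma ratio_bounds:
  assumes "A \<in> sets M" "B \<in> sets M" "A \<inter> B = {}" "0 < measure M (A \<union> B)"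
  shows "0 \<le> ratio A B" "ratio A B \<le> 1"
proof -
  show "0 \<le> ratio A B"
    unfolding ratio_def using assms by (intro divide_nonneg_pos mult_nonneg_nonneg ip_P_nonneg) auto
  show "ratio A B \<le> 1"
    using defect_nonneg[OF assms(1-3)] assms(4) by (simp add: ratio_def defect_def divide_le_eq)
qed

lemma cheeger_values_bounds:
  assumes k: "k \<ge> 1" and m: "m \<in> cheeger_values k"
  shows "0 \<le> m" "m \<le> 1"
proof -
  obtain A B where AB: "disjoint_pairs k A B" and m: "m = Min ((\<lambda>i. ratio (A i) (B i)) ` {..<k})"
    using m by (auto simp: cheeger_values_def)
  have "m \<in> (\<lambda>i. ratio (A i) (B i)) ` {..<k}"
    unfolding m using k by (intro Min_in) (auto simp: lessThan_empty_iff)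
  then obtain i where "i < k" "m = ratio (A i) (B i)" by auto
  then show "0 \<le> m" "m \<le> 1" using AB ratio_bounds[of "A i" "B i"] by (auto simp: disjoint_pairs_def)
qed

lemma cheeger_values_bdd_above: "k \<ge> 1 \<Longrightarrow> bdd_above (cheeger_values k)"
  by (rule bdd_aboveI) (rule cheeger_values_bounds(2))

lemma almost_bipartite_family_iff:
  "almost_bipartite_family k \<delta> A B \<longleftrightarrow> disjoint_pairs k A B \<and> (\<forall>i<k. 1 - \<delta> < ratio (A i) (B i))"
  unfolding almost_bipartite_family_def almost_bipartite_def disjoint_pairs_def ratio_def
  by (auto simp: pos_less_divide_eq)

lemma cheeger_value_gt_iff:
  assumes k: "k \<ge> 1"
  shows "(\<exists>m\<in>cheeger_values k. 1 - \<delta> < m) \<longleftrightarrow> (\<exists>A B. almost_bipartite_family k \<delta> A B)"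
proof -
  have Min_gt: "1 - \<delta> < Min ((\<lambda>i. ratio (A i) (B i)) ` {..<k}) \<longleftrightarrow>
      (\<forall>i<k. 1 - \<delta> < ratio (A i) (B i))" for A B
    using k by (subst Min_gr_iff) (auto simp: lessThan_empty_iff)
  show ?thesis unfolding almost_bipartite_family_iff cheeger_values_def Min_gt[symmetric] by blast
qed

lemma cheeger_values_nonempty:
  assumes "\<not> fin_dim (L2 M)" "k \<ge> 1"
  shows "cheeger_values k \<noteq> {}"
proof -
  obtain D where D: "\<forall>i<k. D i \<in> sets M \<and> 0 < measure M (D i)" "disjoint_family_on D {..<k}"
    using infinite_dim_partition[OF _ assms(2)] assms(1) L2_fin_dim_eq[OF order_refl] by blast
  then have "disjoint_pairs k D (\<lambda>_. {})" by (simp add: disjoint_pairs_def)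
  then show ?thesis unfolding cheeger_values_def by blast
qed

lemma dual_cheeger_nonneg:
  assumes "\<not> fin_dim (L2 M)" and k: "k \<ge> 1"
  shows "0 \<le> dual_cheeger M P k"
proof -
  obtain m where m: "m \<in> cheeger_values k" using cheeger_values_nonempty[OF assms] by blast
  then have "m \<le> dual_cheeger M P k"
    unfolding dual_cheeger_eq using cheeger_values_bdd_above[OF k] by (intro cSup_upper)
  then show ?thesis using cheeger_values_bounds(1)[OF k m] by simp
qed

lemma one_le_dual_cheeger:
  assumes "\<not> ess_coercive (shift P (-1))" and k: "k \<ge> 1"
  shows "1 \<le> dual_cheeger M P k"
proof (rule field_le_epsilon)
  fix \<delta> :: real assume "\<delta> > 0"
  then obtain m where m: "m \<in> cheeger_values k" "1 - \<delta> < m"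
    using cheeger_value_gt_iff[OF k] not_ess_coercive_imp_family[OF assms(1)] by blast
  then have "m \<le> dual_cheeger M P k"
    unfolding dual_cheeger_eq using cheeger_values_bdd_above[OF k] by (intro cSup_upper)
  then show "1 \<le> dual_cheeger M P k + \<delta>" using m(2) by simp
qed

lemma dual_cheeger_less_one:
  assumes "\<not> fin_dim (L2 M)" "ess_coercive (shift P (-1))"
  obtains k where "k \<ge> 1" "dual_cheeger M P k < 1"
proof -
  obtain k \<delta> where \<delta>: "\<delta> > 0" "\<forall>A B. \<not> almost_bipartite_family k \<delta> A B"
    using ess_coercive_imp_no_family[OF assms(2)] by blast
  have "almost_bipartite_family 0 \<delta> A B" for A B
    by (simp add: almost_bipartite_family_def disjoint_family_on_def)
  then have "k \<noteq> 0" using \<delta>(2) by metis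
  then have k: "k \<ge> 1" by simp
  have "dual_cheeger M P k \<le> 1 - \<delta>"
    unfolding dual_cheeger_eq
  proof (rule cSup_least[OF cheeger_values_nonempty[OF assms(1) k]])
    show "m \<le> 1 - \<delta>" if "m \<in> cheeger_values k" for m
      using cheeger_value_gt_iff[OF k, of \<delta>] \<delta>(2) that by (meson not_le)
  qed
  then show ?thesis using that[OF k] \<delta>(1) by simp
qed

lemma INF_dual_cheeger_less_one_iff:
  assumes inf: "\<not> fin_dim (L2 M)"
  shows "(INF k\<in>{1..}. dual_cheeger M P k) < 1 \<longleftrightarrow> ess_coercive (shift P (-1))"
proof
  assume less: "(INF k\<in>{1..}. dual_cheeger M P k) < 1"
  show "ess_coercive (shift P (-1))"
  proof (rule ccontr)
    assume "\<not> ?thesis"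
    then have "1 \<le> (INF k\<in>{1..}. dual_cheeger M P k)" by (intro cINF_greatest one_le_dual_cheeger) auto
    then show False using less by simp
  qed
next
  assume "ess_coercive (shift P (-1))"
  then obtain k where k: "k \<ge> 1" "dual_cheeger M P k < 1" using dual_cheeger_less_one[OF inf] by blast
  have "bdd_below (dual_cheeger M P ` {1..})"
    using dual_cheeger_nonneg[OF inf] by (intro bdd_belowI2) auto
  then have "(INF k\<in>{1..}. dual_cheeger M P k) \<le> dual_cheeger M P k"
    using k(1) by (intro cINF_lower) auto
  then show "(INF k\<in>{1..}. dual_cheeger M P k) < 1" using k(2) by simp
qed

lemma lambda_ess_bot_gt_iff:
  assumes inf: "\<not> fin_dim (L2 M)"
  shows "lambda_ess_bot M P > - 1 \<longleftrightarrow> ess_coercive (shift P (-1))"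
  unfolding lambda_ess_bot_def L2_ess_spectrum_eq[OF symop_P]
  by (rule Inf_ess_spec_gt_iff[OF symop_P bound_op_P psd_energy inf])

end

theorem theorem8p4:
  fixes M :: "'a measure" and P :: "('a \<Rightarrow> real) \<Rightarrow> ('a \<Rightarrow> real)"
  assumes "prob_space M"
    and "\<not> L2_fin_dim M (L2 M)"
    and "markov_operator M P"
    and "reversible M P"
  shows "lambda_ess_bot M P > -1 \<longleftrightarrow> (INF k\<in>{1..}. dual_cheeger M P k) < 1"
proof -
  interpret reversible_markov M P
    using assms by (simp add: reversible_markov_def reversible_markov_axioms_def)
  have "\<not> fin_dim (L2 M)" using assms(2) L2_fin_dim_eq[OF order_refl] by simp
  then show ?thesis using lambda_ess_bot_gt_iff INF_dual_cheeger_less_one_iff by simp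
qed

end
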